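(* For every square-free integer $m>1$, the quotient group $G_m/P_m$ has infinite rank.
   Context: Let $F_m=\mathbb{Q}[\sqrt{-m}]$. Let $\mathcal{S}_m$ be the multiplicative subgroup of $F_m\setminus\{0\}$ consisting of all nonzero elements $a+b\sqrt{-m}$ ($a,b\in\mathbb{Q}$) such that $a^2+mb^2$ is the square of a rational number, and let $G_m=\mathcal{S}_m/\mathbb{Q}^*$, an abelian group (written additively). A primitive triple is $(x,y,z)\in\mathbb{Z}\times\mathbb{Z}\times\mathbb{N}$ with $\gcd(x,y,z)=1$ and $x^2+my^2=z^2$; $[x,y,z]$ denotes the class of $x+y\sqrt{-m}$ in $G_m$. Every element of $G_m$ is represented by a primitive triple, unique up to $[x,y,z]\sim[-x,-y,z]$. $P_m\subseteq G_m$ is the subgroup generated by all $[1,Y,X]$ where $(X,Y)\in\mathbb{N}\times\mathbb{Z}$ satisfies Pell's equation $X^2-mY^2=1$. The rank of an abelian group is the maximal cardinality of a subset that is linearly independent over $\mathbb{Z}$. *)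

theory Defs
  imports
    "HOL-Algebra.Algebra"
    "HOL-Computational_Algebra.Squarefree"
    "HOL-Library.Extended_Nat"
begin

section \<open>Rank of an abelian group\<close>

definition int_independent :: "('a, 'b) monoid_scheme \<Rightarrow> 'a set \<Rightarrow> bool" where
  "int_independent G A \<longleftrightarrow>
     A \<subseteq> carrier G \<and>
     (\<forall>T c. finite T \<longrightarrow> T \<subseteq> A \<longrightarrow>
        (\<Otimes>\<^bsub>G\<^esub>x\<in>T. x [^]\<^bsub>G\<^esub> (c x :: int)) = \<one>\<^bsub>G\<^esub> \<longrightarrow> (\<forall>x\<in>T. c x = 0))"

definition ecard :: "'a set \<Rightarrow> enat" where
  "ecard A = (if finite A then enat (card A) else \<infinity>)"

text \<open>The library groups are written multiplicatively, so an integer linear combination is a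
  product of integer powers. The supremum is attained, because all
  maximal independent subsets of an abelian group have the same cardinality (in \<open>enat\<close>, where
  all infinite cardinalities are identified).\<close>

definition group_rank :: "('a, 'b) monoid_scheme \<Rightarrow> enat" where
  "group_rank G = Sup {ecard A | A. int_independent G A}"

section \<open>The groups of triples\<close>

text \<open>The imaginary quadratic field is realised inside the complex numbers; for \<open>m > 0\<close>,
  \<open>csqrt (- m)\<close> is the root with positive imaginary part.\<close>

definition quad_elem :: "int \<Rightarrow> rat \<Rightarrow> rat \<Rightarrow> complex" where
  "quad_elem m a b = of_rat a + of_rat b * csqrt (- of_int m)"

definition S_group :: "int \<Rightarrow> complex monoid" where
  "S_group m =
     \<lparr>carrier = {quad_elem m a b | a b.
                  quad_elem m a b \<noteq> 0 \<and> (\<exists>c :: rat. a\<^sup>2 + of_int m * b\<^sup>2 = c\<^sup>2)},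
      monoid.mult = (*), one = 1\<rparr>"

definition G_group :: "int \<Rightarrow> complex set monoid" where
  "G_group m = S_group m Mod (\<rat> - {0})"

text \<open>The class \<open>[x, y, z]\<close> depends on \<open>x\<close> and \<open>y\<close> only.\<close>

definition triple_class :: "int \<Rightarrow> int \<times> int \<times> nat \<Rightarrow> complex set" where
  "triple_class m = (\<lambda>(x, y, z). (\<rat> - {0}) #>\<^bsub>S_group m\<^esub> quad_elem m (of_int x) (of_int y))"

definition P_subgroup :: "int \<Rightarrow> complex set set" where
  "P_subgroup m = generate (G_group m)
     {triple_class m (1, v, u) | u v. (int u)\<^sup>2 - m * v\<^sup>2 = 1}"

end

theory Submission
  imports Defs "HOL-Complex_Analysis.Complex_Analysis" "HOL-Number_Theory.Number_Theory"
begin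

text \<open>
  An odd prime \<open>p\<close> that splits in \<open>\<rat>(\<surd>-m)\<close> gives an additive functional on \<open>G\<^sub>m\<close>: the difference of
  the orders of an element at the two primes above \<open>p\<close>.  On the generator \<open>[1, v, u]\<close> of \<open>P\<^sub>m\<close> it takes
  the value \<open>0\<close> if \<open>p\<close> does not divide \<open>u\<close>, and plus or minus twice the multiplicity of \<open>p\<close> in \<open>u\<close>
  otherwise (\<open>ord_diff_value\<close>).  For every such \<open>p > m\<close> there is a class \<open>(t + \<surd>-m)\<^sup>2\<close> at which the
  functional of \<open>p\<close> does not vanish while those of all larger primes do.  So it suffices to find
  infinitely many \<open>p\<close> for which no element of \<open>P\<^sub>m\<close> looks like this from the point of view of the
  functionals at \<open>p\<close> and above (\<open>rank_criterion\<close>).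

  Let \<open>(x\<^sub>1, y\<^sub>1)\<close> be the fundamental solution of Pell's equation and \<open>(x\<^sub>n, y\<^sub>n)\<close> its powers.  Two cases
  need different primes.

  If \<open>x\<^sub>1 + 1\<close> is not a square, some primes divide no \<open>x\<^sub>n\<close> at all.  Indeed \<open>x\<^sub>n = 2w\<^sup>2 - 1\<close> for even \<open>n\<close>, and
  \<open>(x\<^sub>n + 1)(x\<^sub>1 + 1)\<close> is a square for odd \<open>n\<close>; hence a prime modulo which neither \<open>2\<close> nor \<open>x\<^sub>1 + 1\<close> is a
  square divides no \<open>x\<^sub>n\<close>, and its functional kills \<open>P\<^sub>m\<close>.  That infinitely many of these primes split
  (\<open>infinitely_many_primes_with_symbols\<close>) is shown analytically.  Write \<open>c = x\<^sub>1 + 1\<close>.  Were there only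
  finitely many, then at almost all primes the quadratic symbols of \<open>2\<close>, \<open>c\<close>, \<open>-2m\<close>, \<open>-cm\<close> would be
  four times \<open>1\<close>, or twice \<open>1\<close> and twice \<open>-1\<close>.  The product of the four \<open>L\<close>-functions would then have
  nonnegative coefficients that are at least \<open>1\<close> at the squares, and it is holomorphic for \<open>Re s > 0\<close>.
  By Landau's argument its Dirichlet series converges at \<open>s = 1/2\<close>, where it dominates a harmonic
  series (\<open>four_characters_impossible\<close>).

  If \<open>x\<^sub>1 + 1\<close> is a square, then \<open>x\<^sub>n + 1\<close> is a square for \<open>n = 3\<^sup>j\<close>, and for such \<open>n > 1\<close> the quotient \<open>x\<^sub>3\<^sub>n / x\<^sub>n\<close>
  splits into two coprime factors.  So there are two new primes \<open>p < q\<close> with the same rank of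
  apparition \<open>r = 3n\<close>, that is, whose first multiple in the sequence is \<open>x\<^sub>r\<close>
  (\<open>two_primes_of_rank_power3\<close>).  For an element of \<open>P\<^sub>m\<close> on which all functionals above \<open>p\<close> vanish, the
  values at \<open>p\<close> and at \<open>q\<close> are fixed multiples of one integer, up to corrections that come from the
  indices divisible by \<open>rp\<close> or \<open>rq\<close>, where the multiplicities of \<open>p\<close> and \<open>q\<close> grow.  The corrections are
  sums of the same kind attached to the indices \<open>rp\<^sup>i\<close> and \<open>rq\<^sup>i\<close>; they vanish by descending induction,
  because each of these indices again is the rank of some prime, which exceeds \<open>p\<close>
  (\<open>twisted_sum_eq_0\<close>).  The value at \<open>q\<close> is \<open>0\<close>, hence so is the value at \<open>p\<close>.
\<close>

(* Plain prime denotes primality in a factorial semiring, not that of a monoid with a carrier. *)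
hide_const (open) Divisibility.prime

section \<open>Rank of a quotient and additive functionals\<close>

lemma additive_on_int_pow:
  fixes G (structure) and h :: "'a \<Rightarrow> int"
  assumes "group G"
    and add: "\<And>x y. x \<in> carrier G \<Longrightarrow> y \<in> carrier G \<Longrightarrow> h (x \<otimes>\<^bsub>G\<^esub> y) = h x + h y"
  shows "h \<one>\<^bsub>G\<^esub> = 0"
    and "x \<in> carrier G \<Longrightarrow> h (inv\<^bsub>G\<^esub> x) = - h x"
    and "x \<in> carrier G \<Longrightarrow> h (x [^]\<^bsub>G\<^esub> (k::int)) = k * h x"
proof -
  interpret group G by fact
  show one: "h \<one>\<^bsub>G\<^esub> = 0" using add[of \<one> \<one>] by simp
  show inv: "h (inv\<^bsub>G\<^esub> x) = - h x" if "x \<in> carrier G" for x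
    using add[of x "inv x"] that one by simp
  have pow: "h (x [^]\<^bsub>G\<^esub> (n::nat)) = int n * h x" if "x \<in> carrier G" for x n
    by (induction n) (use that one add in \<open>auto simp: algebra_simps\<close>)
  show "h (x [^]\<^bsub>G\<^esub> (k::int)) = k * h x" if "x \<in> carrier G"
  proof (cases "k \<ge> 0")
    case True
    then obtain n where "k = int n" using nonneg_int_cases by blast
    then show ?thesis using pow[OF that] by (simp add: int_pow_int)
  next
    case False
    then obtain n where k: "k = - int n" by (metis int_cases2 linear of_nat_0_le_iff)
    then show ?thesis using pow[OF that] inv[of "x [^] n"] that by (simp add: int_pow_neg int_pow_int)
  qed
qed

text \<open>The functionals \<open>h i\<close> turn elements of \<open>G\<close> into functions of \<open>i\<close>.  Since \<open>V\<close> is closed under addition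
and negation and contains the functions of the generators, it contains those of the whole generated
subgroup.  A relation between the cosets of the \<open>g j\<close> therefore puts the corresponding combination of
their functions into \<open>V\<close>.\<close>

lemma group_rank_quotient_infinite:
  fixes G (structure) and h :: "'i \<Rightarrow> 'a \<Rightarrow> int" and g :: "nat \<Rightarrow> 'a"
  assumes "comm_group G" and gens: "gens \<subseteq> carrier G"
    and add: "\<And>i x y. x \<in> carrier G \<Longrightarrow> y \<in> carrier G \<Longrightarrow> h i (x \<otimes>\<^bsub>G\<^esub> y) = h i x + h i y"
    and V0: "(\<lambda>i. 0) \<in> V"
    and V_add: "\<And>f f'. f \<in> V \<Longrightarrow> f' \<in> V \<Longrightarrow> (\<lambda>i. f i + f' i) \<in> V"
    and V_minus: "\<And>f. f \<in> V \<Longrightarrow> (\<lambda>i. - f i) \<in> V"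
    and V_gens: "\<And>x. x \<in> gens \<Longrightarrow> (\<lambda>i. h i x) \<in> V"
    and g: "\<And>j. g j \<in> carrier G"
    and indep: "\<And>N c. (\<lambda>i. \<Sum>j<N. c j * h i (g j)) \<in> V \<Longrightarrow> \<forall>j<N. c j = 0"
  shows "group_rank (G Mod generate G gens) = \<infinity>"
proof -
  interpret comm_group G by fact
  define H where "H = generate G gens"
  have H: "subgroup H G" unfolding H_def by (rule generate_is_subgroup[OF gens])
  have nH: "H \<lhd> G" using H by (simp add: normal_iff_subgroup)
  interpret nH: normal H G by (rule nH)
  interpret Q: comm_group "G Mod H" by (rule abelian_FactGroup[OF H])
  have h_one: "h i \<one> = 0" for i
    by (rule additive_on_int_pow(1)[where h = "h i"]) (use add in \<open>auto intro: group_axioms\<close>)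
  have h_inv: "h i (inv x) = - h i x" if "x \<in> carrier G" for i x
    by (rule additive_on_int_pow(2)[where h = "h i"]) (use add that in \<open>auto intro: group_axioms\<close>)
  have h_pow: "h i (x [^] k) = k * h i x" if "x \<in> carrier G" for i x and k :: int
    by (rule additive_on_int_pow(3)[where h = "h i"]) (use add that in \<open>auto intro: group_axioms\<close>)
  have HV: "(\<lambda>i. h i x) \<in> V" if "x \<in> H" for x
    using that unfolding H_def
  proof (induction rule: generate.induct)
    case one
    then show ?case using V0 h_one by simp
  next
    case (incl x)
    then show ?case by (rule V_gens)
  next
    case (inv x)
    then show ?case using V_minus[OF V_gens[OF inv]] h_inv gens by (simp add: subset_iff)
  next
    case (eng x y)
    then have "x \<in> carrier G" "y \<in> carrier G" using generate_in_carrier[OF gens] by auto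
    then show ?case using V_add[OF eng.IH] add by simp
  qed
  define q where "q x = H #> x" for x
  have q_carr: "q x \<in> carrier (G Mod H)" if "x \<in> carrier G" for x
    using that by (auto simp: q_def carrier_FactGroup)
  have prod: "(\<Otimes>\<^bsub>G Mod H\<^esub>j\<in>J. q (g j) [^]\<^bsub>G Mod H\<^esub> (c j :: int)) = q (\<Otimes>j\<in>J. g j [^] c j)
      \<and> (\<forall>i. h i (\<Otimes>j\<in>J. g j [^] c j) = (\<Sum>j\<in>J. c j * h i (g j)))"
    if "finite J" for J and c
    using that
  proof (induction J)
    case empty
    then show ?case using coset_join2[of \<one> H] H h_one by (simp add: q_def)
  next
    case (insert a J)
    have c1: "(\<lambda>j. g j [^] c j) \<in> J \<rightarrow> carrier G" "g a [^] c a \<in> carrier G" using g by auto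
    have c2: "(\<lambda>j. q (g j) [^]\<^bsub>G Mod H\<^esub> c j) \<in> J \<rightarrow> carrier (G Mod H)"
      "q (g a) [^]\<^bsub>G Mod H\<^esub> c a \<in> carrier (G Mod H)" using g q_carr by auto
    have fp: "(\<Otimes>j\<in>J. g j [^] c j) \<in> carrier G" using c1 by auto
    have e: "q (g a) [^]\<^bsub>G Mod H\<^esub> c a = q (g a [^] c a)"
      unfolding q_def by (rule nH.FactGroup_int_pow[OF g])
    show ?case
      using insert c1 c2 fp e h_pow[OF g] add
      by (simp add: q_def nH.rcos_sum)
  qed
  have key: "\<forall>j\<in>J. c j = 0"
    if J: "finite J" and eq: "(\<Otimes>\<^bsub>G Mod H\<^esub>j\<in>J. q (g j) [^]\<^bsub>G Mod H\<^esub> (c j :: int)) = \<one>\<^bsub>G Mod H\<^esub>" for J c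
  proof -
    let ?x = "\<Otimes>j\<in>J. g j [^] c j"
    have xc: "?x \<in> carrier G" using g by auto
    have "H #> ?x = H" using prod[OF J, of c] eq by (simp add: q_def)
    then have "?x \<in> H" using xc H by (metis rcos_self)
    from HV[OF this] have V: "(\<lambda>i. \<Sum>j\<in>J. c j * h i (g j)) \<in> V" using prod[OF J, of c] by simp
    \<comment> \<open>Only initial segments of the index set occur in the hypothesis, so the coefficients are extended by zero.\<close>
    obtain N where N: "J \<subseteq> {..<N}" using J finite_nat_iff_bounded by blast
    define c' where "c' j = (if j \<in> J then c j else 0)" for j
    have "(\<Sum>j<N. c' j * h i (g j)) = (\<Sum>j\<in>J. c j * h i (g j))" for i
      by (rule sum.mono_neutral_cong_right) (use N in \<open>auto simp: c'_def\<close>)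
    then have "\<forall>j<N. c' j = 0" using V by (intro indep) simp
    then show ?thesis using N by (auto simp: c'_def)
  qed
  have inj: "inj (\<lambda>j. q (g j))"
  proof (rule injI, rule ccontr)
    fix a b assume ab: "q (g a) = q (g b)" "a \<noteq> b"
    define c :: "nat \<Rightarrow> int" where "c j = (if j = a then 1 else -1)" for j
    have "(\<Otimes>\<^bsub>G Mod H\<^esub>j\<in>{a,b}. q (g j) [^]\<^bsub>G Mod H\<^esub> (c j :: int)) = \<one>\<^bsub>G Mod H\<^esub>"
      using ab q_carr[OF g] by (simp add: c_def Q.int_pow_neg del: one_FactGroup mult_FactGroup)
    then have "c a = 0" using key[of "{a,b}" c] by auto
    then show False by (simp add: c_def)
  qed
  let ?A = "range (\<lambda>j. q (g j))"
  have "int_independent (G Mod H) ?A"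
    unfolding int_independent_def
  proof (intro conjI allI impI)
    show "?A \<subseteq> carrier (G Mod H)" using q_carr g by auto
    fix T c assume T: "finite T" "T \<subseteq> ?A"
      and eq: "(\<Otimes>\<^bsub>G Mod H\<^esub>x\<in>T. x [^]\<^bsub>G Mod H\<^esub> (c x :: int)) = \<one>\<^bsub>G Mod H\<^esub>"
    obtain J where J: "T = (\<lambda>j. q (g j)) ` J" "finite J"
      using T finite_subset_image by metis
    have "(\<Otimes>\<^bsub>G Mod H\<^esub>j\<in>J. q (g j) [^]\<^bsub>G Mod H\<^esub> (c (q (g j)))) = \<one>\<^bsub>G Mod H\<^esub>"
      using eq unfolding J(1)
      by (subst (asm) Q.finprod_reindex) (use q_carr g inj in \<open>auto intro: inj_on_subset\<close>)
    from key[OF J(2) this] show "\<forall>x\<in>T. c x = 0" using J by auto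
  qed
  moreover have "ecard ?A = \<infinity>" using inj by (simp add: ecard_def range_inj_infinite)
  ultimately have "\<infinity> \<le> group_rank (G Mod H)"
    unfolding group_rank_def by (intro Sup_upper) (metis (mono_tags, lifting) mem_Collect_eq)
  then show ?thesis by (simp add: H_def)
qed

section \<open>Orders at the two primes above a split prime\<close>

text \<open>Such an odd prime has two primes of \<open>\<rat>(\<surd>-m)\<close> above it, one
for each square root of \<open>-m\<close> modulo \<open>p\<close>.\<close>

definition split_prime :: "int \<Rightarrow> nat \<Rightarrow> bool" where
  "split_prime m p \<longleftrightarrow> prime p \<and> odd p \<and> \<not> int p dvd m \<and> (\<exists>t. int p dvd t\<^sup>2 + m)"

text \<open>Choosing a square root of \<open>-m\<close> modulo \<open>p\<close> selects one of the two primes above \<open>p\<close>.\<close>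

definition root_mod_prime :: "int \<Rightarrow> nat \<Rightarrow> int" where
  "root_mod_prime m p = (SOME t. int p dvd t\<^sup>2 + m)"

text \<open>The approximations modulo \<open>p\<^sup>k\<close> to a square root of \<open>-m\<close> in the \<open>p\<close>-adic integers.\<close>

definition root_mod_power :: "int \<Rightarrow> nat \<Rightarrow> nat \<Rightarrow> int" where
  "root_mod_power m p k = (SOME t. int p ^ k dvd t\<^sup>2 + m \<and> int p dvd t - root_mod_prime m p)"

lemma split_prime_not_dvd2:
  assumes "split_prime m p" shows "\<not> int p dvd 2"
proof
  assume "int p dvd 2"
  then have "int p dvd int 2" by simp
  then have "p dvd 2" by (simp only: int_dvd_int_iff)
  then show False using assms primes_dvd_imp_eq two_is_prime_nat unfolding split_prime_def by blast
qed

lemma root_mod_prime: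
  assumes "split_prime m p" shows "int p dvd (root_mod_prime m p)\<^sup>2 + m" "\<not> int p dvd root_mod_prime m p"
proof -
  show 1: "int p dvd (root_mod_prime m p)\<^sup>2 + m"
    unfolding root_mod_prime_def by (rule someI_ex) (use assms in \<open>simp add: split_prime_def\<close>)
  show "\<not> int p dvd root_mod_prime m p"
  proof
    assume "int p dvd root_mod_prime m p"
    then have "int p dvd (root_mod_prime m p)\<^sup>2" by (simp add: power2_eq_square)
    then have "int p dvd m" using 1 by (metis dvd_add_right_iff)
    then show False using assms by (simp add: split_prime_def)
  qed
qed

text \<open>Hensel's lemma: the root is simple because \<open>2t\<close> is a unit modulo \<open>p\<close>.\<close>

lemma root_lift:
  assumes "split_prime m p"
  shows "\<exists>t. int p ^ k dvd t\<^sup>2 + m \<and> int p dvd t - root_mod_prime m p"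
proof (induction k)
  case 0
  then show ?case by (intro exI[of _ "root_mod_prime m p"]) simp
next
  case (Suc k)
  show ?case
  proof (cases "k = 0")
    case True
    then show ?thesis using root_mod_prime[OF assms] by (intro exI[of _ "root_mod_prime m p"]) simp
  next
    case False
    obtain t where t: "int p ^ k dvd t\<^sup>2 + m" "int p dvd t - root_mod_prime m p" using Suc by blast
    obtain b where b: "t\<^sup>2 + m = int p ^ k * b" using t(1) by (elim dvdE)
    have "\<not> int p dvd t" using t(2) root_mod_prime(2)[OF assms] by (metis dvd_diff_commute dvd_diff_left_iff)
    then have "\<not> int p dvd 2 * t"
      using assms split_prime_not_dvd2[OF assms] by (simp add: split_prime_def prime_dvd_mult_iff)
    then have "coprime (2 * t) (int p)"
      using assms by (metis coprime_commute prime_imp_coprime prime_nat_int_transfer split_prime_def)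
    then obtain w where w: "[2 * t * w = 1] (mod int p)" using cong_solve_coprime_int by blast
    \<comment> \<open>The correction c solves b + 2tc = 0 modulo p.\<close>
    define c where "c = - b * w"
    have "int p dvd 2 * t * w - 1" using w by (simp add: cong_iff_dvd_diff)
    then have "int p dvd - b * (2 * t * w - 1)" by (rule dvd_mult)
    also have "- b * (2 * t * w - 1) = b + 2 * t * c" by (simp add: c_def algebra_simps)
    finally have d: "int p dvd b + 2 * t * c" .
    have "(t + c * int p ^ k)\<^sup>2 + m = int p ^ k * (b + 2 * t * c) + c\<^sup>2 * (int p ^ k * int p ^ k)"
      using b by (simp add: power2_eq_square algebra_simps)
    moreover have "int p ^ Suc k dvd int p ^ k * (b + 2 * t * c)"
      unfolding power_Suc2 using d by (rule mult_dvd_mono[OF dvd_refl])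
    moreover have "int p ^ Suc k dvd int p ^ k * int p ^ k"
      using False by (metis Suc_leI add_Suc_right add_le_cancel_left le_imp_power_dvd nat_arith.rule0 not_gr_zero power_add)
    then have "int p ^ Suc k dvd c\<^sup>2 * (int p ^ k * int p ^ k)" by (rule dvd_mult)
    ultimately have 1: "int p ^ Suc k dvd (t + c * int p ^ k)\<^sup>2 + m" by (simp only: dvd_add)
    have "int p dvd int p ^ k" using False by (simp add: dvd_power)
    then have "int p dvd c * int p ^ k" by (rule dvd_mult)
    then have "int p dvd (t - root_mod_prime m p) + c * int p ^ k" by (rule dvd_add[OF t(2)])
    then have 2: "int p dvd (t + c * int p ^ k) - root_mod_prime m p" by (simp add: algebra_simps)
    show ?thesis using 1 2 by blast
  qed
qed

lemma root_mod_power: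
  assumes "split_prime m p"
  shows "int p ^ k dvd (root_mod_power m p k)\<^sup>2 + m" "int p dvd root_mod_power m p k - root_mod_prime m p"
  using someI_ex[OF root_lift[OF assms, of k]] unfolding root_mod_power_def by auto

text \<open>The difference of the squares is divisible by \<open>p\<^sup>j\<close>, and the sum of the two roots is a unit, being twice
the common root modulo \<open>p\<close>.\<close>

lemma root_mod_power_coherent:
  assumes p: "split_prime m p" and j: "j \<le> k" "j \<le> l"
  shows "int p ^ j dvd root_mod_power m p k - root_mod_power m p l"
proof -
  let ?s = "root_mod_power m p k" and ?t = "root_mod_power m p l"
  have "int p ^ j dvd (?s\<^sup>2 + m) - (?t\<^sup>2 + m)"
    using root_mod_power(1)[OF p] j by (intro dvd_diff) (meson dvd_trans le_imp_power_dvd)+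
  also have "(?s\<^sup>2 + m) - (?t\<^sup>2 + m) = (?s + ?t) * (?s - ?t)" by (simp add: power2_eq_square algebra_simps)
  finally have d: "int p ^ j dvd (?s + ?t) * (?s - ?t)" .
  have "int p dvd (?s - root_mod_prime m p) + (?t - root_mod_prime m p)" by (rule dvd_add[OF root_mod_power(2)[OF p] root_mod_power(2)[OF p]])
  then have "int p dvd (?s + ?t) - 2 * root_mod_prime m p" by (simp add: algebra_simps)
  moreover have "\<not> int p dvd 2 * root_mod_prime m p"
    using p split_prime_not_dvd2[OF p] root_mod_prime(2)[OF p] by (simp add: split_prime_def prime_dvd_mult_iff)
  ultimately have "\<not> int p dvd ?s + ?t" by (metis dvd_diff_right_iff)
  then have "coprime (int p ^ j) (?s + ?t)"
    using p by (simp add: split_prime_def prime_imp_coprime)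
  then show ?thesis using d by (simp add: coprime_dvd_mult_right_iff)
qed

lemma multiplicity_cong_power:
  fixes a b :: int
  assumes "p > 1" "a \<noteq> 0" "int p ^ n dvd a - b" "multiplicity (int p) a < n"
  shows "multiplicity (int p) b = multiplicity (int p) a"
proof (rule multiplicity_eqI)
  have d: "int p ^ j dvd a \<longleftrightarrow> int p ^ j dvd b" if "j \<le> n" for j
  proof -
    have "int p ^ j dvd a - b" using assms(3) that by (meson dvd_trans le_imp_power_dvd)
    then show ?thesis by (metis dvd_diff_left_iff dvd_diff_right_iff)
  qed
  show "int p ^ multiplicity (int p) a dvd b" using d[of "multiplicity (int p) a"] assms by (simp add: multiplicity_dvd)
  have "\<not> int p ^ Suc (multiplicity (int p) a) dvd a"
    using assms by (subst power_dvd_iff_le_multiplicity) auto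
  then show "\<not> int p ^ Suc (multiplicity (int p) a) dvd b" using d[of "Suc (multiplicity (int p) a)"] assms by simp
qed

text \<open>The order at the selected prime above \<open>p\<close> is the multiplicity of \<open>p\<close> in the \<open>p\<close>-adic integer
\<open>x + y\<surd>-m\<close>.  The norm is far more precision than needed to read it off, and it avoids a limit in the
definition.\<close>

definition ord_at :: "int \<Rightarrow> nat \<Rightarrow> int \<Rightarrow> int \<Rightarrow> nat" where
  "ord_at m p x y = multiplicity (int p) (x + root_mod_power m p (nat (x\<^sup>2 + m * y\<^sup>2)) * y)"

lemma norm_pos: "m > 0 \<Longrightarrow> x \<noteq> 0 \<or> y \<noteq> 0 \<Longrightarrow> x\<^sup>2 + m * y\<^sup>2 > (0::int)"
  by (smt (verit) mult_pos_pos power2_less_eq_zero_iff zero_le_mult_iff zero_le_power2)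

text \<open>If \<open>p\<^sup>k\<close> divides \<open>x + ty\<close>, where \<open>t\<^sup>2\<close> is congruent to \<open>-m\<close> modulo \<open>p\<^sup>k\<close>, then it divides the norm of
\<open>x + y\<surd>-m\<close>.  So precision \<open>p\<^sup>k\<close> with \<open>k\<close> at least the norm always determines the order.\<close>

lemma ord_at_stable:
  assumes p: "split_prime m p" and m: "m > 0" and xy: "x \<noteq> 0 \<or> y \<noteq> 0"
    and k: "nat (x\<^sup>2 + m * y\<^sup>2) \<le> k"
  shows "multiplicity (int p) (x + root_mod_power m p k * y) = ord_at m p x y"
    and "ord_at m p x y < nat (x\<^sup>2 + m * y\<^sup>2)" and "x + root_mod_power m p k * y \<noteq> 0"
proof -
  define N where "N = nat (x\<^sup>2 + m * y\<^sup>2)"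
  have N: "x\<^sup>2 + m * y\<^sup>2 > 0" using norm_pos[OF m xy] .
  have p1: "p > 1" using p prime_gt_1_nat by (auto simp: split_prime_def)
  have nd: "\<not> int p ^ k dvd x + root_mod_power m p k * y" if "N \<le> k" for k
  proof
    let ?t = "root_mod_power m p k"
    assume "int p ^ k dvd x + ?t * y"
    then have "int p ^ k dvd (x - ?t * y) * (x + ?t * y) + (?t\<^sup>2 + m) * y\<^sup>2"
      using root_mod_power(1)[OF p, of k] by (intro dvd_add[OF dvd_mult dvd_mult2])
    also have "(x - ?t * y) * (x + ?t * y) + (?t\<^sup>2 + m) * y\<^sup>2 = x\<^sup>2 + m * y\<^sup>2"
      by (simp add: power2_eq_square algebra_simps)
    finally have "int p ^ k \<le> x\<^sup>2 + m * y\<^sup>2" using N by (rule zdvd_imp_le)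
    then have "int p ^ k \<le> int N" using N by (simp add: N_def)
    then have "p ^ k \<le> N" by (metis of_nat_le_iff of_nat_power)
    moreover have "k < p ^ k" by (rule order_less_le_trans[OF less_exp]) (use p1 in \<open>auto intro: power_mono\<close>)
    ultimately show False using that by simp
  qed
  show ne: "x + root_mod_power m p k * y \<noteq> 0" using nd[of k] k by (auto simp: N_def)
  have neN: "x + root_mod_power m p N * y \<noteq> 0" using nd[of N] by auto
  have lt: "multiplicity (int p) (x + root_mod_power m p N * y) < N"
    using nd[of N] neN p1 power_dvd_iff_le_multiplicity[of "x + root_mod_power m p N * y" "int p" N] by auto
  then show "ord_at m p x y < nat (x\<^sup>2 + m * y\<^sup>2)" by (simp add: ord_at_def N_def)
  have "int p ^ N dvd (root_mod_power m p N - root_mod_power m p k) * y"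
    using root_mod_power_coherent[OF p, of N N k] k by (simp add: N_def)
  also have "(root_mod_power m p N - root_mod_power m p k) * y = (x + root_mod_power m p N * y) - (x + root_mod_power m p k * y)"
    by (simp add: algebra_simps)
  finally show "multiplicity (int p) (x + root_mod_power m p k * y) = ord_at m p x y"
    unfolding ord_at_def N_def[symmetric] using multiplicity_cong_power[OF p1 neN _ lt] by blast
qed

lemma ord_at_mult:
  assumes p: "split_prime m p" and m: "m > 0" and xy: "x \<noteq> 0 \<or> y \<noteq> 0" "x' \<noteq> 0 \<or> y' \<noteq> 0"
  shows "ord_at m p (x * x' - m * y * y') (x * y' + y * x') = ord_at m p x y + ord_at m p x' y'"
    and "x * x' - m * y * y' \<noteq> 0 \<or> x * y' + y * x' \<noteq> 0"
proof -
  let ?X = "x * x' - m * y * y'" and ?Y = "x * y' + y * x'"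
  have p1: "p > 1" and pI: "prime (int p)" using p prime_gt_1_nat by (auto simp: split_prime_def)
  have N: "?X\<^sup>2 + m * ?Y\<^sup>2 = (x\<^sup>2 + m * y\<^sup>2) * (x'\<^sup>2 + m * y'\<^sup>2)" by (simp add: power2_eq_square algebra_simps)
  then have Npos: "?X\<^sup>2 + m * ?Y\<^sup>2 > 0" using norm_pos[OF m xy(1)] norm_pos[OF m xy(2)] by simp
  show sol: "?X \<noteq> 0 \<or> ?Y \<noteq> 0"
  proof (rule ccontr)
    assume "\<not> ?thesis"
    then have "?X = 0" "?Y = 0" by auto
    then show False using Npos by (simp only:) simp
  qed
  define k where "k = nat (x\<^sup>2 + m * y\<^sup>2) + nat (x'\<^sup>2 + m * y'\<^sup>2) + nat (?X\<^sup>2 + m * ?Y\<^sup>2)"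
  let ?t = "root_mod_power m p k"
  have k: "nat (x\<^sup>2 + m * y\<^sup>2) \<le> k" "nat (x'\<^sup>2 + m * y'\<^sup>2) \<le> k" "nat (?X\<^sup>2 + m * ?Y\<^sup>2) \<le> k"
    unfolding k_def by simp_all
  note s = ord_at_stable[OF p m xy(1) k(1)] and s' = ord_at_stable[OF p m xy(2) k(2)]
    and S = ord_at_stable[OF p m sol k(3)]
  have "multiplicity (int p) ((x + ?t * y) * (x' + ?t * y'))
      = multiplicity (int p) (x + ?t * y) + multiplicity (int p) (x' + ?t * y')"
    using s(3) s'(3) pI by (intro prime_elem_multiplicity_mult_distrib) simp_all
  then have mul: "multiplicity (int p) ((x + ?t * y) * (x' + ?t * y')) = ord_at m p x y + ord_at m p x' y'"
    by (simp only: s(1) s'(1))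
  have "int p ^ k dvd (?t\<^sup>2 + m) * (y * y')" using root_mod_power(1)[OF p] by (rule dvd_mult2)
  also have "(?t\<^sup>2 + m) * (y * y') = (x + ?t * y) * (x' + ?t * y') - (?X + ?t * ?Y)"
    by (simp add: power2_eq_square algebra_simps)
  finally have d: "int p ^ k dvd (x + ?t * y) * (x' + ?t * y') - (?X + ?t * ?Y)" .
  have ne: "(x + ?t * y) * (x' + ?t * y') \<noteq> 0" using s(3) s'(3) by (simp only: mult_eq_0_iff simp_thms)
  have "ord_at m p x y + ord_at m p x' y' < k" using s(2) s'(2) unfolding k_def by linarith
  then have "multiplicity (int p) (?X + ?t * ?Y) = multiplicity (int p) ((x + ?t * y) * (x' + ?t * y'))"
    by (intro multiplicity_cong_power[OF p1 ne d]) (simp only: mul)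
  then show "ord_at m p ?X ?Y = ord_at m p x y + ord_at m p x' y'" by (simp only: mul S(1))
qed

text \<open>The second order is the one at the other prime above \<open>p\<close>.  Rational numbers have the same order at
both, so the difference depends only on the class modulo \<open>\<rat>\<close>.\<close>

definition ord_diff :: "int \<Rightarrow> nat \<Rightarrow> int \<Rightarrow> int \<Rightarrow> int" where
  "ord_diff m p x y = (if split_prime m p then int (ord_at m p x y) - int (ord_at m p x (- y)) else 0)"

lemma ord_diff_mult:
  assumes m: "m > 0" and xy: "x \<noteq> 0 \<or> y \<noteq> 0" "x' \<noteq> 0 \<or> y' \<noteq> 0"
  shows "ord_diff m p (x * x' - m * y * y') (x * y' + y * x') = ord_diff m p x y + ord_diff m p x' y'"
proof (cases "split_prime m p")
  case True
  have "ord_at m p (x * x' - m * y * y') (- (x * y' + y * x')) = ord_at m p x (- y) + ord_at m p x' (- y')"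
    using ord_at_mult(1)[OF True m, of x "- y" x' "- y'"] xy by (simp add: algebra_simps)
  then show ?thesis using True ord_at_mult(1)[OF True m xy] by (simp add: ord_diff_def)
qed (simp add: ord_diff_def)

lemma ord_diff_scale:
  assumes m: "m > 0" and xy: "x \<noteq> 0 \<or> y \<noteq> 0" and d: "d \<noteq> 0"
  shows "ord_diff m p (d * x) (d * y) = ord_diff m p x y"
proof -
  have "ord_diff m p d 0 = 0" by (simp add: ord_diff_def)
  then show ?thesis using ord_diff_mult[OF m, of d 0 x y p] xy d by simp
qed

lemma ord_diff_uminus: "ord_diff m p x (- y) = - ord_diff m p x y"
  by (simp add: ord_diff_def)

lemma ord_at_pos_iff:
  assumes p: "split_prime m p" and m: "m > 0" and xy: "x \<noteq> 0 \<or> y \<noteq> 0"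
  shows "ord_at m p x y > 0 \<longleftrightarrow> int p dvd x + root_mod_prime m p * y"
proof -
  define k where "k = nat (x\<^sup>2 + m * y\<^sup>2)"
  have p1: "p > 1" using p prime_gt_1_nat by (auto simp: split_prime_def)
  have "ord_at m p x y > 0 \<longleftrightarrow> int p ^ 1 dvd x + root_mod_power m p k * y"
    using ord_at_stable[OF p m xy, of k] p1 by (subst power_dvd_iff_le_multiplicity) (auto simp: k_def)
  also have "x + root_mod_power m p k * y = (x + root_mod_prime m p * y) + (root_mod_power m p k - root_mod_prime m p) * y"
    by (simp add: algebra_simps)
  also have "int p ^ 1 dvd \<dots> \<longleftrightarrow> int p dvd x + root_mod_prime m p * y"
    using root_mod_power(2)[OF p, of k] by (simp add: dvd_add_left_iff)
  finally show ?thesis .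
qed

lemma ord_at_conj:
  assumes p: "split_prime m p" and m: "m > 0" and xy: "x \<noteq> 0 \<or> y \<noteq> 0"
  shows "ord_at m p x y + ord_at m p x (- y) = multiplicity (int p) (x\<^sup>2 + m * y\<^sup>2)"
  using ord_at_mult(1)[OF p m xy, of x "- y"] xy by (simp add: ord_at_def power2_eq_square mult.commute mult.left_commute)

lemma ord_diff_eq_0:
  assumes m: "m > 0" and "\<not> int p dvd x\<^sup>2 + m * y\<^sup>2"
  shows "ord_diff m p x y = 0"
proof (cases "split_prime m p")
  case True
  have xy: "x \<noteq> 0 \<or> y \<noteq> 0" using assms by auto
  have "multiplicity (int p) (x\<^sup>2 + m * y\<^sup>2) = 0" using assms by (simp add: not_dvd_imp_multiplicity_0)
  then show ?thesis using ord_at_conj[OF True m xy] by (simp add: ord_diff_def)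
qed (simp add: ord_diff_def)

text \<open>Only one of the two primes above \<open>p\<close> can contain \<open>x + y\<surd>-m\<close>, as otherwise \<open>p\<close> would divide \<open>2x\<close>; it
then accounts for the full power of \<open>p\<close> in the norm.\<close>

lemma ord_diff_value:
  assumes p: "split_prime m p" and m: "m > 0" and x: "\<not> int p dvd x"
  shows "ord_diff m p x y = (if int p dvd x + root_mod_prime m p * y then 1 else -1) * int (multiplicity (int p) (x\<^sup>2 + m * y\<^sup>2))"
proof -
  let ?t = "root_mod_prime m p"
  have x0: "x \<noteq> 0" using x by auto
  have pI: "prime (int p)" using p by (simp add: split_prime_def)
  note c = ord_at_conj[OF p m, of x y]
  note i = ord_at_pos_iff[OF p m, of x y] ord_at_pos_iff[OF p m, of x "- y"]
  show ?thesis
  proof (cases "int p dvd x + ?t * y")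
    case True
    have "\<not> int p dvd x + ?t * (- y)"
    proof
      assume "int p dvd x + ?t * (- y)"
      with True have "int p dvd (x + ?t * y) + (x + ?t * (- y))" by (rule dvd_add)
      then have "int p dvd 2 * x" by simp
      then show False using x split_prime_not_dvd2[OF p] pI by (simp add: prime_dvd_mult_iff)
    qed
    then have "ord_at m p x (- y) = 0" using i x0 by simp
    then show ?thesis using c x0 True p by (simp add: ord_diff_def)
  next
    case False
    then have "ord_at m p x y = 0" using i x0 by simp
    then show ?thesis using c x0 False p by (simp add: ord_diff_def)
  qed
qed

section \<open>The functionals on the group of triples\<close>

lemma csqrt_neg:
  assumes "m > 0"
  shows "Re (csqrt (- of_int m)) = 0" "Im (csqrt (- of_int m)) \<noteq> 0" "csqrt (- of_int m) * csqrt (- of_int m) = - of_int m"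
proof -
  let ?s = "csqrt (- of_int m)"
  show sq: "?s * ?s = - of_int m" using power2_csqrt[of "- of_int m"] by (simp add: power2_eq_square)
  have "Re (?s * ?s) = - of_int m" "Im (?s * ?s) = 0" by (simp_all add: sq)
  then have r: "Re ?s * Re ?s - Im ?s * Im ?s = - of_int m" "Re ?s * Im ?s = 0" by simp_all
  show i: "Im ?s \<noteq> 0"
  proof
    assume "Im ?s = 0"
    then have "Re ?s * Re ?s = - of_int m" using r by simp
    moreover have "Re ?s * Re ?s \<ge> 0" "real_of_int m > 0" using assms by simp_all
    ultimately show False by linarith
  qed
  then show "Re ?s = 0" using r by simp
qed

lemma of_rat_complex: "(of_rat a :: complex) = of_real (of_rat a)"
  by (cases a) (simp add: of_rat_rat)

lemma quad_elem_eq_iff: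
  assumes "m > 0"
  shows "quad_elem m a b = quad_elem m a' b' \<longleftrightarrow> a = a' \<and> b = b'"
proof
  assume "quad_elem m a b = quad_elem m a' b'"
  then have "Re (quad_elem m a b) = Re (quad_elem m a' b')" "Im (quad_elem m a b) = Im (quad_elem m a' b')" by auto
  then show "a = a' \<and> b = b'" using csqrt_neg[OF assms] by (simp add: quad_elem_def of_rat_complex)
qed simp

lemma quad_elem_eq_0_iff: "m > 0 \<Longrightarrow> quad_elem m a b = 0 \<longleftrightarrow> a = 0 \<and> b = 0"
  using quad_elem_eq_iff[of m a b 0 0] by (simp add: quad_elem_def)

lemma quad_elem_mult:
  assumes "m > 0"
  shows "quad_elem m a b * quad_elem m a' b' = quad_elem m (a * a' - of_int m * b * b') (a * b' + b * a')"
proof -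
  let ?s = "csqrt (- of_int m)"
  have "quad_elem m a b * quad_elem m a' b' = of_rat a * of_rat a' + of_rat b * of_rat b' * (?s * ?s)
      + (of_rat a * of_rat b' + of_rat b * of_rat a') * ?s"
    by (simp add: quad_elem_def algebra_simps)
  then show ?thesis
    unfolding csqrt_neg(3)[OF assms] by (simp add: quad_elem_def of_rat_add of_rat_diff of_rat_mult algebra_simps)
qed

lemma quad_elem_rat_mult: "of_rat q * quad_elem m a b = quad_elem m (q * a) (q * b)"
  by (simp add: quad_elem_def of_rat_mult algebra_simps)

lemma carrier_S_I:
  assumes "m > 0" "a \<noteq> 0 \<or> b \<noteq> 0" "a\<^sup>2 + of_int m * b\<^sup>2 = c\<^sup>2"
  shows "quad_elem m a b \<in> carrier (S_group m)"
  using assms quad_elem_eq_0_iff[of m a b] by (auto simp: S_group_def)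

lemma carrier_S_E:
  assumes "z \<in> carrier (S_group m)"
  obtains a b c where "z = quad_elem m a b" "z \<noteq> 0" "a\<^sup>2 + of_int m * b\<^sup>2 = c\<^sup>2"
  using assms by (auto simp: S_group_def)

lemma S_simps [simp]: "x \<otimes>\<^bsub>S_group m\<^esub> y = x * y" "\<one>\<^bsub>S_group m\<^esub> = 1"
  by (simp_all add: S_group_def)

lemma S_comm_group:
  assumes m: "m > 0" shows "comm_group (S_group m)"
proof (rule comm_groupI)
  fix x y assume "x \<in> carrier (S_group m)" "y \<in> carrier (S_group m)"
  then obtain a b c a' b' c' where x: "x = quad_elem m a b" "x \<noteq> 0" "a\<^sup>2 + of_int m * b\<^sup>2 = c\<^sup>2"
    and y: "y = quad_elem m a' b'" "y \<noteq> 0" "a'\<^sup>2 + of_int m * b'\<^sup>2 = c'\<^sup>2"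
    by (metis carrier_S_E)
  have "(a * a' - of_int m * b * b')\<^sup>2 + of_int m * (a * b' + b * a')\<^sup>2
      = (a\<^sup>2 + of_int m * b\<^sup>2) * (a'\<^sup>2 + of_int m * b'\<^sup>2)" by (simp add: power2_eq_square algebra_simps)
  also have "\<dots> = (c * c')\<^sup>2" by (simp add: x y power_mult_distrib)
  finally have n: "(a * a' - of_int m * b * b')\<^sup>2 + of_int m * (a * b' + b * a')\<^sup>2 = (c * c')\<^sup>2" .
  have "x * y \<noteq> 0" using x y by simp
  then show "x \<otimes>\<^bsub>S_group m\<^esub> y \<in> carrier (S_group m)"
    using n by (auto simp: x(1) y(1) quad_elem_mult[OF m] S_group_def)
next
  have "quad_elem m 1 0 \<in> carrier (S_group m)" by (rule carrier_S_I[OF m, where c = 1]) auto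
  then show "\<one>\<^bsub>S_group m\<^esub> \<in> carrier (S_group m)" by (simp add: quad_elem_def)
next
  fix x assume "x \<in> carrier (S_group m)"
  then obtain a b c where x: "x = quad_elem m a b" "x \<noteq> 0" "a\<^sup>2 + of_int m * b\<^sup>2 = c\<^sup>2"
    by (metis carrier_S_E)
  \<comment> \<open>The inverse is the conjugate divided by the norm.\<close>
  define n where "n = a\<^sup>2 + of_int m * b\<^sup>2"
  have ab: "a \<noteq> 0 \<or> b \<noteq> 0" using x quad_elem_eq_0_iff[OF m] by blast
  have n0: "n \<noteq> 0"
  proof -
    have "a\<^sup>2 \<ge> 0" "of_int m * b\<^sup>2 \<ge> 0" using m by auto
    moreover have "a\<^sup>2 > 0 \<or> of_int m * b\<^sup>2 > 0" using ab m by auto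
    ultimately have "n > 0" unfolding n_def by linarith
    then show ?thesis by simp
  qed
  have "quad_elem m (a / n) (- b / n) \<in> carrier (S_group m)"
  proof (rule carrier_S_I[OF m, where c = "c / n"])
    show "a / n \<noteq> 0 \<or> - b / n \<noteq> 0" using ab n0 by auto
    have "(a / n)\<^sup>2 + of_int m * (- b / n)\<^sup>2 = (a\<^sup>2 + of_int m * b\<^sup>2) / n\<^sup>2"
      by (simp add: power_divide add_divide_distrib)
    then show "(a / n)\<^sup>2 + of_int m * (- b / n)\<^sup>2 = (c / n)\<^sup>2" using x(3) by (simp add: power_divide)
  qed
  moreover have "quad_elem m (a / n) (- b / n) * x = 1"
  proof -
    have "a / n * a - of_int m * (- b / n) * b = 1"
      using n0 by (simp add: field_simps) (simp add: n_def power2_eq_square algebra_simps)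
    then show ?thesis unfolding x(1) quad_elem_mult[OF m] by (simp add: quad_elem_def)
  qed
  ultimately show "\<exists>y\<in>carrier (S_group m). y \<otimes>\<^bsub>S_group m\<^esub> x = \<one>\<^bsub>S_group m\<^esub>" by auto
qed (auto simp: mult_ac)

lemma Rats_subgroup:
  assumes m: "m > 0" shows "subgroup (\<rat> - {0}) (S_group m)"
proof -
  interpret S: comm_group "S_group m" by (rule S_comm_group[OF m])
  have sub: "\<rat> - {0} \<subseteq> carrier (S_group m)"
  proof
    fix z :: complex assume "z \<in> \<rat> - {0}"
    then obtain q where q: "z = of_rat q" "q \<noteq> 0" by (auto elim: Rats_cases)
    have "quad_elem m q 0 \<in> carrier (S_group m)" by (rule carrier_S_I[OF m, where c = q]) (use q in auto)
    then show "z \<in> carrier (S_group m)" by (simp add: q quad_elem_def)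
  qed
  show ?thesis
  proof (rule S.subgroupI)
    fix a assume a: "a \<in> \<rat> - {0 :: complex}"
    then have "inverse a \<in> \<rat> - {0}" by simp
    then have "inv\<^bsub>S_group m\<^esub> a = inverse a" using a sub by (intro S.inv_equality) auto
    then show "inv\<^bsub>S_group m\<^esub> a \<in> \<rat> - {0}" using \<open>inverse a \<in> _\<close> by simp
  qed (use sub in \<open>auto intro!: exI[of _ 1]\<close>)
qed

lemma G_comm_group: "m > 0 \<Longrightarrow> comm_group (G_group m)"
  unfolding G_group_def by (rule comm_group.abelian_FactGroup[OF S_comm_group Rats_subgroup])

definition int_class :: "int \<Rightarrow> int \<Rightarrow> int \<Rightarrow> complex set" where
  "int_class m x y = (\<rat> - {0}) #>\<^bsub>S_group m\<^esub> quad_elem m (of_int x) (of_int y)"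

lemma coset_mem_iff: "w \<in> (\<rat> - {0}) #>\<^bsub>S_group m\<^esub> z \<longleftrightarrow> (\<exists>q. q \<noteq> 0 \<and> w = of_rat q * z)"
  by (auto simp: r_coset_def elim!: Rats_cases)

text \<open>Clearing denominators does not change the class.\<close>

lemma G_rep:
  assumes m: "m > 0" and g: "g \<in> carrier (G_group m)"
  obtains x y where "x \<noteq> 0 \<or> y \<noteq> 0" "quad_elem m (of_int x) (of_int y) \<in> g"
proof -
  obtain z where z: "z \<in> carrier (S_group m)" "g = (\<rat> - {0}) #>\<^bsub>S_group m\<^esub> z"
    using g by (auto simp: G_group_def carrier_FactGroup)
  obtain a b where ab: "z = quad_elem m a b" "z \<noteq> 0" using carrier_S_E[OF z(1)] by metis
  obtain n1 d1 where 1: "a = of_int n1 / of_int d1" "d1 > 0" by (metis quotient_of_div quotient_of_denom_pos surj_pair)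
  obtain n2 d2 where 2: "b = of_int n2 / of_int d2" "d2 > 0" by (metis quotient_of_div quotient_of_denom_pos surj_pair)
  have e: "quad_elem m (of_int (n1 * d2)) (of_int (n2 * d1)) = of_rat (of_int (d1 * d2)) * z"
    unfolding ab quad_elem_rat_mult using 1 2 by (simp add: mult.commute)
  have "quad_elem m (of_int (n1 * d2)) (of_int (n2 * d1)) \<in> g"
    unfolding z(2) coset_mem_iff using e 1 2 by (intro exI[of _ "of_int (d1 * d2)"]) auto
  moreover have "n1 * d2 \<noteq> 0 \<or> n2 * d1 \<noteq> 0"
  proof (rule ccontr)
    assume "\<not> ?thesis"
    then have "a = 0" "b = 0" using 1 2 by auto
    then show False using ab by (simp add: quad_elem_def)
  qed
  ultimately show ?thesis using that by blast
qed

text \<open>The choice of the integral representative is immaterial, because two of them differ by a rational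
factor and \<open>ord_diff\<close> is invariant under scaling.\<close>

definition ord_diff_class :: "int \<Rightarrow> nat \<Rightarrow> complex set \<Rightarrow> int" where
  "ord_diff_class m p g = (let (x, y) = (SOME (x, y). (x \<noteq> 0 \<or> y \<noteq> 0) \<and> quad_elem m (of_int x) (of_int y) \<in> g) in ord_diff m p x y)"

lemma ord_diff_class_eq:
  assumes m: "m > 0" and g: "g \<in> carrier (G_group m)"
    and xy: "x \<noteq> 0 \<or> y \<noteq> 0" "quad_elem m (of_int x) (of_int y) \<in> g"
  shows "ord_diff_class m p g = ord_diff m p x y"
proof -
  let ?P = "\<lambda>(x, y). (x \<noteq> 0 \<or> y \<noteq> 0) \<and> quad_elem m (of_int x) (of_int y) \<in> g"
  obtain x' y' where e: "(SOME v. ?P v) = (x', y')" by fastforce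
  have "?P (x, y)" using xy by simp
  then have "?P (SOME v. ?P v)" by (rule someI)
  then have xy': "x' \<noteq> 0 \<or> y' \<noteq> 0" "quad_elem m (of_int x') (of_int y') \<in> g" unfolding e by auto
  obtain z where z: "g = (\<rat> - {0}) #>\<^bsub>S_group m\<^esub> z"
    using g by (auto simp: G_group_def carrier_FactGroup)
  obtain q where q: "q \<noteq> 0" "quad_elem m (of_int x) (of_int y) = of_rat q * z" using xy(2) unfolding z coset_mem_iff by blast
  obtain q' where q': "q' \<noteq> 0" "quad_elem m (of_int x') (of_int y') = of_rat q' * z" using xy'(2) unfolding z coset_mem_iff by blast
  define r where "r = q' / q"
  have "quad_elem m (of_int x') (of_int y') = of_rat r * quad_elem m (of_int x) (of_int y)"
    unfolding q q' using q(1) by (simp add: r_def of_rat_divide)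
  then have "of_int x' = r * of_int x" "of_int y' = r * of_int y"
    unfolding quad_elem_rat_mult quad_elem_eq_iff[OF m] by auto
  moreover obtain n d where nd: "r = of_int n / of_int d" "d > 0" by (metis quotient_of_div quotient_of_denom_pos surj_pair)
  ultimately have "rat_of_int (d * x') = of_int (n * x)" "rat_of_int (d * y') = of_int (n * y)" by (auto simp: field_simps)
  then have dn: "d * x' = n * x" "d * y' = n * y" by (simp_all only: of_int_eq_iff)
  have "n \<noteq> 0" using nd q q' by (auto simp: r_def)
  then have "ord_diff m p x' y' = ord_diff m p x y" using ord_diff_scale[OF m xy'(1), of d p] ord_diff_scale[OF m xy(1), of n p] nd dn by simp
  then show ?thesis unfolding ord_diff_class_def e by simp
qed

lemma ord_diff_class_mult:
  assumes m: "m > 0" and g: "g \<in> carrier (G_group m)" "h \<in> carrier (G_group m)"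
  shows "ord_diff_class m p (g \<otimes>\<^bsub>G_group m\<^esub> h) = ord_diff_class m p g + ord_diff_class m p h"
proof -
  interpret G: comm_group "G_group m" by (rule G_comm_group[OF m])
  obtain x y where 1: "x \<noteq> 0 \<or> y \<noteq> 0" "quad_elem m (of_int x) (of_int y) \<in> g" by (rule G_rep[OF m g(1)])
  obtain x' y' where 2: "x' \<noteq> 0 \<or> y' \<noteq> 0" "quad_elem m (of_int x') (of_int y') \<in> h" by (rule G_rep[OF m g(2)])
  let ?X = "x * x' - m * y * y'" and ?Y = "x * y' + y * x'"
  have "quad_elem m (of_int x) (of_int y) * quad_elem m (of_int x') (of_int y') \<in> g \<otimes>\<^bsub>G_group m\<^esub> h"
    using 1 2 by (auto simp: G_group_def set_mult_def)
  then have 3: "quad_elem m (of_int ?X) (of_int ?Y) \<in> g \<otimes>\<^bsub>G_group m\<^esub> h"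
    unfolding quad_elem_mult[OF m] by simp
  have 4: "?X \<noteq> 0 \<or> ?Y \<noteq> 0"
  proof (rule ccontr)
    assume "\<not> ?thesis"
    then have sol: "?X = 0" "?Y = 0" by auto
    have "quad_elem m (of_int x) (of_int y) * quad_elem m (of_int x') (of_int y') = quad_elem m (of_int ?X) (of_int ?Y)"
      unfolding quad_elem_mult[OF m] by simp
    then have "quad_elem m (of_int x) (of_int y) * quad_elem m (of_int x') (of_int y') = 0"
      unfolding sol by (simp add: quad_elem_def)
    then show False using 1 2 by (auto simp: quad_elem_eq_0_iff[OF m])
  qed
  have gh: "g \<otimes>\<^bsub>G_group m\<^esub> h \<in> carrier (G_group m)" using g by (rule G.m_closed)
  show ?thesis
    unfolding ord_diff_class_eq[OF m g(1) 1] ord_diff_class_eq[OF m g(2) 2] ord_diff_class_eq[OF m gh 4 3]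
    by (rule ord_diff_mult[OF m 1(1) 2(1)])
qed

lemma int_class:
  assumes m: "m > 0" and xy: "x \<noteq> 0 \<or> y \<noteq> 0" and n: "x\<^sup>2 + m * y\<^sup>2 = z\<^sup>2"
  shows "int_class m x y \<in> carrier (G_group m)" "ord_diff_class m p (int_class m x y) = ord_diff m p x y"
proof -
  have "rat_of_int (x\<^sup>2 + m * y\<^sup>2) = of_int (z\<^sup>2)" by (simp only: n)
  then have "(rat_of_int x)\<^sup>2 + of_int m * (of_int y)\<^sup>2 = (of_int z)\<^sup>2" by simp
  then have "quad_elem m (of_int x) (of_int y) \<in> carrier (S_group m)"
    using xy by (intro carrier_S_I[OF m]) auto
  then show c: "int_class m x y \<in> carrier (G_group m)"
    by (auto simp: int_class_def G_group_def carrier_FactGroup)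
  show "ord_diff_class m p (int_class m x y) = ord_diff m p x y"
    by (rule ord_diff_class_eq[OF m c xy]) (auto simp: int_class_def coset_mem_iff intro!: exI[of _ 1])
qed

text \<open>For \<open>p \<in> Q\<close> there is \<open>t\<close> with \<open>2t < p\<close> and \<open>p\<close> dividing \<open>t\<^sup>2 + m\<close>.  Since \<open>t\<^sup>2 + m < p\<^sup>2\<close>, no prime above
\<open>p\<close> divides it, so the functionals at larger primes vanish at the class of \<open>(t + \<surd>-m)\<^sup>2\<close>, whose norm is a
square; the functional at \<open>p\<close> does not.  In a relation between such classes the largest prime \<open>p\<close> that
occurs contradicts \<open>indep\<close>.\<close>

theorem rank_criterion:
  fixes m :: int and V :: "(nat \<Rightarrow> int) set" and Q :: "nat set"
  assumes m: "m > 0"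
    and V0: "(\<lambda>p. 0) \<in> V"
    and V_add: "\<And>f f'. f \<in> V \<Longrightarrow> f' \<in> V \<Longrightarrow> (\<lambda>p. f p + f' p) \<in> V"
    and V_minus: "\<And>f. f \<in> V \<Longrightarrow> (\<lambda>p. - f p) \<in> V"
    and V_gens: "\<And>u v. u\<^sup>2 - m * v\<^sup>2 = 1 \<Longrightarrow> u > 0 \<Longrightarrow> (\<lambda>p. ord_diff m p 1 v) \<in> V"
    and Q: "infinite Q" "\<And>p. p \<in> Q \<Longrightarrow> split_prime m p \<and> int p > m"
    and indep: "\<And>f p. f \<in> V \<Longrightarrow> p \<in> Q \<Longrightarrow> f p \<noteq> 0 \<Longrightarrow> \<exists>P>p. split_prime m P \<and> f P \<noteq> 0"
  shows "group_rank (G_group m Mod P_subgroup m) = \<infinity>"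
proof -
  have "\<exists>t. 0 \<le> t \<and> 2 * t < int p \<and> int p dvd t\<^sup>2 + m" if p: "p \<in> Q" for p
  proof -
    have sp: "split_prime m p" using Q p by blast
    then obtain t1 where t1: "int p dvd t1\<^sup>2 + m" by (auto simp: split_prime_def)
    have p0: "int p > 0" "odd (int p)" using sp prime_gt_0_nat by (auto simp: split_prime_def)
    define t where "t = t1 mod int p"
    have "int p dvd t1 - t" by (simp add: t_def minus_mod_eq_mult_div)
    then have "int p dvd (t1 - t) * (t1 + t)" by (rule dvd_mult2)
    then have "int p dvd (t1\<^sup>2 + m) - (t1 - t) * (t1 + t)" by (rule dvd_diff[OF t1])
    then have t: "int p dvd t\<^sup>2 + m" by (simp add: power2_eq_square algebra_simps)
    have tb: "0 \<le> t" "t < int p" using p0 by (auto simp: t_def)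
    show ?thesis
    proof (cases "2 * t < int p")
      case False
      have "int p dvd int p * (int p - 2 * t) + (t\<^sup>2 + m)" by (rule dvd_add[OF dvd_triv_left t])
      also have "int p * (int p - 2 * t) + (t\<^sup>2 + m) = (int p - t)\<^sup>2 + m" by (simp add: power2_eq_square algebra_simps)
      finally have "int p dvd (int p - t)\<^sup>2 + m" .
      moreover have "2 * t \<noteq> int p" using p0(2) by (metis dvd_triv_left)
      ultimately show ?thesis using False tb by (intro exI[of _ "int p - t"]) auto
    qed (use tb t in auto)
  qed
  then obtain t where t: "\<And>p. p \<in> Q \<Longrightarrow> 0 \<le> t p \<and> 2 * t p < int p \<and> int p dvd (t p)\<^sup>2 + m" by metis
  define e where "e = enumerate Q"
  have eQ: "e j \<in> Q" for j unfolding e_def by (rule enumerate_in_set[OF Q(1)])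
  have e_mono: "e i < e j" if "i < j" for i j unfolding e_def by (rule enumerate_mono[OF that Q(1)])
  define g where "g j = int_class m ((t (e j))\<^sup>2 - m) (2 * t (e j))" for j
  have tm: "(t p)\<^sup>2 - m \<noteq> 0 \<or> 2 * t p \<noteq> 0" for p using m by auto
  have nn: "((t p)\<^sup>2 - m)\<^sup>2 + m * (2 * t p)\<^sup>2 = ((t p)\<^sup>2 + m)\<^sup>2" for p
    by (simp add: power2_eq_square algebra_simps)
  have gc: "g j \<in> carrier (G_group m)" for j
    unfolding g_def by (rule int_class(1)[OF m tm nn])
  have ord_g: "ord_diff_class m P (g j) = 2 * ord_diff m P (t (e j)) 1" for P j
  proof -
    have "ord_diff_class m P (g j) = ord_diff m P ((t (e j))\<^sup>2 - m) (2 * t (e j))"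
      unfolding g_def by (rule int_class(2)[OF m tm nn])
    also have "(t (e j))\<^sup>2 - m = t (e j) * t (e j) - m * 1 * 1" by (simp add: power2_eq_square)
    also have "2 * t (e j) = t (e j) * 1 + 1 * t (e j)" by simp
    also have "ord_diff m P (t (e j) * t (e j) - m * 1 * 1) (t (e j) * 1 + 1 * t (e j))
        = ord_diff m P (t (e j)) 1 + ord_diff m P (t (e j)) 1" by (rule ord_diff_mult[OF m]) simp_all
    finally show ?thesis by simp
  qed
  have big: "ord_diff m P (t p) 1 = 0" if "p \<in> Q" "P > p" for p P
  proof (cases "split_prime m P")
    case True
    have "\<not> int P dvd (t p)\<^sup>2 + m"
    proof
      assume "int P dvd (t p)\<^sup>2 + m"
      moreover have "int p dvd (t p)\<^sup>2 + m" using t that by blast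
      moreover have "coprime (int p) (int P)"
        using True Q(2)[OF that(1)] that(2) by (simp add: split_prime_def primes_coprime)
      ultimately have "int p * int P dvd (t p)\<^sup>2 + m" by (intro divides_mult)
      moreover have "(t p)\<^sup>2 + m > 0" using m by (simp add: add_nonneg_pos)
      ultimately have "int p * int P \<le> (t p)\<^sup>2 + m" by (rule zdvd_imp_le)
      moreover have "int p * (int p + 1) \<le> int p * int P" using that by (intro mult_left_mono) auto
      moreover have "(t p)\<^sup>2 \<le> int p * int p"
        unfolding power2_eq_square using t[OF that(1)] by (intro mult_mono) auto
      moreover have "m < int p" using Q that by blast
      ultimately show False by (simp add: algebra_simps)
    qed
    then show ?thesis using ord_diff_eq_0[OF m, of P "t p" 1] by simp
  qed (simp add: ord_diff_def)
  have nz: "ord_diff m p (t p) 1 \<noteq> 0" if "p \<in> Q" for p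
  proof -
    have sp: "split_prime m p" using Q that by blast
    have d: "int p dvd (t p)\<^sup>2 + m" using t that by blast
    have nt: "\<not> int p dvd t p"
    proof
      assume "int p dvd t p"
      then have "int p dvd (t p)\<^sup>2" by (simp add: power2_eq_square)
      then have "int p dvd m" using d by (metis dvd_add_right_iff)
      then show False using sp by (simp add: split_prime_def)
    qed
    have "(t p)\<^sup>2 + m \<noteq> 0" using m by (metis add_nonneg_pos less_irrefl zero_le_power2)
    then have "multiplicity (int p) ((t p)\<^sup>2 + m) \<noteq> 0"
      using d sp by (subst multiplicity_eq_zero_iff) (auto simp: split_prime_def)
    then show ?thesis unfolding ord_diff_value[OF sp m nt] by (simp split: if_splits)
  qed
  define gens where "gens = {triple_class m (1, v, u) | u v. (int u)\<^sup>2 - m * v\<^sup>2 = 1}"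
  have gens: "x \<in> carrier (G_group m) \<and> (\<lambda>p. ord_diff_class m p x) \<in> V" if x: "x \<in> gens" for x
  proof -
    obtain u v where uv: "x = triple_class m (1, v, u)" "(int u)\<^sup>2 - m * v\<^sup>2 = 1"
      using x by (auto simp: gens_def)
    have n: "1\<^sup>2 + m * v\<^sup>2 = (int u)\<^sup>2" using uv(2) by simp
    have xc: "x = int_class m 1 v" by (simp add: uv(1) triple_class_def int_class_def)
    have "u \<noteq> 0"
    proof
      assume "u = 0"
      then have "m * v\<^sup>2 = -1" using uv(2) by simp
      moreover have "m * v\<^sup>2 \<ge> 0" using m by simp
      ultimately show False by simp
    qed
    then show ?thesis using V_gens[OF uv(2)] int_class[OF m _ n] by (simp add: xc)
  qed
  show ?thesis
    unfolding P_subgroup_def gens_def[symmetric]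
  proof (rule group_rank_quotient_infinite[where h = "ord_diff_class m" and V = V and g = g])
    show "comm_group (G_group m)" by (rule G_comm_group[OF m])
    fix N :: nat and c :: "nat \<Rightarrow> int"
    assume V: "(\<lambda>p. \<Sum>j<N. c j * ord_diff_class m p (g j)) \<in> V"
    show "\<forall>j<N. c j = 0"
    proof (rule ccontr)
      assume "\<not> ?thesis"
      then have ne: "{j. j < N \<and> c j \<noteq> 0} \<noteq> {}" by auto
      define i where "i = Max {j. j < N \<and> c j \<noteq> 0}"
      have i: "i < N" "c i \<noteq> 0" using Max_in[OF _ ne] by (auto simp: i_def)
      have above: "c j = 0" if "i < j" "j < N" for j
      proof (rule ccontr)
        assume "c j \<noteq> 0"
        then have "j \<le> i" using that unfolding i_def by (intro Max_ge) auto
        then show False using that by simp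
      qed
      have val: "(\<Sum>j<N. c j * ord_diff_class m P (g j)) = c i * ord_diff_class m P (g i)" if "P \<ge> e i" for P
      proof (rule sum.remove[OF finite_lessThan, of i N "\<lambda>j. c j * ord_diff_class m P (g j)", THEN trans])
        show "i \<in> {..<N}" using i by simp
        have "(\<Sum>j\<in>{..<N} - {i}. c j * ord_diff_class m P (g j)) = 0"
        proof (rule sum.neutral, rule ballI)
          fix j assume j: "j \<in> {..<N} - {i}"
          show "c j * ord_diff_class m P (g j) = 0"
          proof (cases "i < j")
            case False
            then have "e j < e i" using j e_mono by simp
            then show ?thesis using big[OF eQ, of j P] that by (simp add: ord_g)
          qed (use above j in simp)
        qed
        then show "c i * ord_diff_class m P (g i) + (\<Sum>j\<in>{..<N} - {i}. c j * ord_diff_class m P (g j)) = c i * ord_diff_class m P (g i)"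
          by simp
      qed
      have "(\<Sum>j<N. c j * ord_diff_class m (e i) (g j)) \<noteq> 0"
        using val[of "e i"] i nz[OF eQ] by (simp add: ord_g)
      then obtain P where P: "P > e i" "(\<Sum>j<N. c j * ord_diff_class m P (g j)) \<noteq> 0"
        using indep[OF V eQ, of i] by blast
      then show False using val[of P] big[OF eQ, of i P] by (simp add: ord_g)
    qed
  qed (use gens gc V0 V_add V_minus ord_diff_class_mult[OF m] in auto)
qed

section \<open>Dirichlet series with nonnegative coefficients\<close>

lemma powr_diff_bound:
  fixes s :: complex and b c :: real
  assumes b: "1 \<le> k" "k \<le> b" "b \<le> c" and s: "0 < \<sigma>" "\<sigma> \<le> Re s"
  shows "norm (of_real c powr (-s) - of_real b powr (-s)) \<le> norm s * k powr (-\<sigma> - 1) * (c - b)"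
proof -
  have "norm (of_real c powr (-s) - of_real b powr (-s)) \<le> norm s * k powr (-\<sigma> - 1) * norm (of_real c - of_real b :: complex)"
  proof (rule field_differentiable_bound[where S = "of_real ` {b..c}" and f' = "\<lambda>z. -s * z powr (-s - 1)"])
    show "convex (of_real ` {b..c} :: complex set)"
      by (intro convex_linear_image linear_of_real) simp
  next
    fix z :: complex assume "z \<in> of_real ` {b..c}"
    then obtain t where t: "z = of_real t" "b \<le> t" "t \<le> c" by auto
    have "z \<notin> \<real>\<^sub>\<le>\<^sub>0" using t b by (simp add: complex_nonpos_Reals_iff)
    then show "((\<lambda>z. z powr (-s)) has_field_derivative -s * z powr (-s - 1)) (at z within of_real ` {b..c})"
      by (rule has_field_derivative_at_within[OF has_field_derivative_powr])
    have t1: "t \<ge> 1" using t b by simp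
    have "norm (z powr (-s - 1)) = t powr (- Re s - 1)"
      using t1 unfolding t(1) by (subst norm_powr_real_powr) auto
    also have "\<dots> \<le> t powr (-\<sigma> - 1)" using t1 s by (intro powr_mono) auto
    also have "\<dots> \<le> k powr (-\<sigma> - 1)" using t1 t b s by (intro powr_mono2') auto
    finally show "norm (-s * z powr (-s - 1)) \<le> norm s * k powr (-\<sigma> - 1)"
      by (simp add: norm_mult mult_left_mono)
  qed (use b in auto)
  also have "of_real c - of_real b = (of_real (c - b) :: complex)" by simp
  also have "norm \<dots> = c - b" using b by (simp only: norm_of_real)
  finally show ?thesis .
qed

text \<open>The series is grouped into blocks of length \<open>q\<close>.  As \<open>f\<close> has mean zero over a period, a constant may be
subtracted from the powers inside a block, which makes the \<open>k\<close>-th block \<open>O(k\<^bsup>-\<sigma>-1\<^esup>)\<close> for \<open>Re s \<ge> \<sigma>\<close>.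
So the grouped series converges locally uniformly in the half-plane \<open>Re s > 0\<close>.\<close>

lemma Dirichlet_L_continuation:
  fixes f :: "nat \<Rightarrow> real"
  assumes q: "q > 0" and per: "\<And>n. f (n + q) = f n" and bd: "\<And>n. \<bar>f n\<bar> \<le> 1"
    and zero: "(\<Sum>r<q. f r) = 0"
  obtains L where "L holomorphic_on {s. Re s > 0}"
    "\<And>s. Re s > 1 \<Longrightarrow> ((\<lambda>n. of_real (f n) * of_nat n powr (-s)) has_sum L s) {1..}"
proof -
  have per': "f (k * q + r) = f r" for k r
  proof (induction k)
    case (Suc k)
    have "Suc k * q + r = (k * q + r) + q" by simp
    then show ?case using per[of "k * q + r"] Suc by (simp only:)
  qed simp
  define block :: "nat \<Rightarrow> complex \<Rightarrow> complex" where
    "block k s = (\<Sum>r<q. of_real (f r) * of_nat (k * q + r) powr (-s))" for k s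
  define L where "L s = suminf (\<lambda>k. block k s)" for s
  have zero': "(\<Sum>r<q. of_real (f r) * z) = 0" for z :: complex
    using zero by (simp flip: sum_distrib_right of_real_sum)
  have block_bound: "norm (block k s) \<le> q * (R * real k powr (-\<sigma> - 1) * q)"
    if k: "k \<ge> 1" and s: "0 < \<sigma>" "\<sigma> \<le> Re s" "norm s \<le> R" for k s \<sigma> R
  proof -
    have "block k s = (\<Sum>r<q. of_real (f r) * (of_nat (k * q + r) powr (-s) - of_nat (k * q) powr (-s)))"
      unfolding right_diff_distrib sum_subtractf zero' block_def by simp
    also have "norm \<dots> \<le> (\<Sum>r<q. R * real k powr (-\<sigma> - 1) * q)"
    proof (rule sum_norm_le)
      fix r assume r: "r \<in> {..<q}"
      have kq: "real k \<le> real (k * q)" using q by (simp add: mult_le_cancel_left1)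
      have "norm (of_real (real (k * q + r)) powr (-s) - of_real (real (k * q)) powr (-s))
          \<le> norm s * real k powr (-\<sigma> - 1) * (real (k * q + r) - real (k * q))"
        using k kq s by (intro powr_diff_bound) auto
      also have "\<dots> \<le> R * real k powr (-\<sigma> - 1) * q" 
      proof -
        have "R \<ge> 0" using s(3) norm_ge_zero[of s] by linarith
        then show ?thesis using s r by (intro mult_mono) auto
      qed
      finally have "norm (of_nat (k * q + r) powr (-s) - of_nat (k * q) powr (-s) :: complex) \<le> R * real k powr (-\<sigma> - 1) * q"
        by simp
      then have "\<bar>f r\<bar> * norm (of_nat (k * q + r) powr (-s) - of_nat (k * q) powr (-s) :: complex) \<le> 1 * (R * real k powr (-\<sigma> - 1) * q)"
        using bd by (intro mult_mono) auto
      then show "norm (of_real (f r) * (of_nat (k * q + r) powr (-s) - of_nat (k * q) powr (-s) :: complex)) \<le> R * real k powr (-\<sigma> - 1) * q"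
        unfolding norm_mult by simp
    qed
    finally show ?thesis by simp
  qed
  have "L holomorphic_on {s. Re s > 0}"
  proof (rule holomorphic_uniform_sequence[where f = "\<lambda>N s. \<Sum>k<N. block k s"])
    show "open {s :: complex. Re s > 0}" by (rule open_halfspace_Re_gt)
    show "(\<lambda>s. \<Sum>k<N. block k s) holomorphic_on {s. Re s > 0}" for N
    proof -
      have "(\<lambda>s. of_nat n powr (-s) :: complex) holomorphic_on A" for n A
        by (cases "n = 0") (auto intro!: holomorphic_intros)
      then show ?thesis unfolding block_def by (intro holomorphic_on_sum holomorphic_on_mult holomorphic_on_const)
    qed
  next
    fix z :: complex assume "z \<in> {s. Re s > 0}"
    then have z: "Re z > 0" by simp
    define d where "d = Re z / 2"
    have near: "Re s \<ge> d" "norm s \<le> norm z + d" if "s \<in> cball z d" for s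
    proof -
      have "norm (z - s) \<le> d" using that by (simp add: dist_norm)
      moreover have "\<bar>Re (z - s)\<bar> \<le> norm (z - s)" by (rule abs_Re_le_cmod)
      ultimately have "Re z - Re s \<le> d" by simp
      then show "Re s \<ge> d" by (simp add: d_def)
      show "norm s \<le> norm z + d" using \<open>norm (z - s) \<le> d\<close> norm_triangle_ineq2[of s z] by (simp add: norm_minus_commute)
    qed
    have "uniform_limit (cball z d) (\<lambda>N s. \<Sum>k<N. block k s) (\<lambda>s. suminf (\<lambda>k. block k s)) sequentially"
    proof (rule Weierstrass_m_test_ev)
      show "\<forall>\<^sub>F k in sequentially. \<forall>s\<in>cball z d. norm (block k s) \<le> q * ((norm z + d) * real k powr (-d - 1) * q)"
        using eventually_ge_at_top[of 1]
        by eventually_elim (use near z in \<open>auto intro!: block_bound simp: d_def\<close>)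
      have "summable (\<lambda>k. real k powr (-d - 1))" using z by (simp add: summable_real_powr_iff d_def)
      then show "summable (\<lambda>k. q * ((norm z + d) * real k powr (-d - 1) * q))"
        by (intro summable_mult summable_mult2)
    qed
    then have "uniform_limit (cball z d) (\<lambda>N s. \<Sum>k<N. block k s) L sequentially" by (simp add: L_def[abs_def])
    moreover have "cball z d \<subseteq> {s. Re s > 0}" using near(1) z by (force simp: d_def)
    ultimately show "\<exists>d>0. cball z d \<subseteq> {s. Re s > 0} \<and> uniform_limit (cball z d) (\<lambda>N s. \<Sum>k<N. block k s) L sequentially"
      using z by (intro exI[of _ d]) (simp add: d_def)
  qed
  moreover have "((\<lambda>n. of_real (f n) * of_nat n powr (-s)) has_sum L s) {1..}" if s: "Re s > 1" for s
  proof -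
    let ?a = "\<lambda>n. of_real (f n) * of_nat n powr (-s) :: complex"
    have le: "norm (?a n) \<le> real n powr (- Re s)" for n
    proof -
      have "norm (of_nat n powr (-s) :: complex) = real n powr (- Re s)"
        by (subst norm_powr_real_powr) auto
      then show ?thesis using bd[of n] by (simp add: norm_mult mult_left_le_one_le)
    qed
    have sn: "summable (\<lambda>n. norm (?a n))"
    proof (rule summable_comparison_test'[where N = 0])
      show "summable (\<lambda>n. real n powr (- Re s))" using s by (simp add: summable_real_powr_iff)
      show "norm (norm (?a n)) \<le> real n powr (- Re s)" for n using le[of n] by (simp only: real_norm_def abs_norm_cancel)
    qed
    define S where "S = suminf ?a"
    have sums: "?a sums S" unfolding S_def by (rule summable_sums[OF summable_norm_cancel[OF sn]])
    have "(\<lambda>k. sum ?a {k * q..<k * q + q}) sums S" by (rule sums_group[OF sums q])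
    also have "(\<lambda>k. sum ?a {k * q..<k * q + q}) = (\<lambda>k. block k s)"
    proof
      fix k
      have "sum ?a {k * q..<k * q + q} = (\<Sum>r<q. ?a (k * q + r))"
        by (rule sum.reindex_bij_witness[of _ "\<lambda>r. k * q + r" "\<lambda>n. n - k * q"]) auto
      then show "sum ?a {k * q..<k * q + q} = block k s" by (simp add: block_def per')
    qed
    finally have "L s = S" unfolding L_def by (rule sums_unique[symmetric])
    moreover have "(?a has_sum S) UNIV" by (rule norm_summable_imp_has_sum[OF sn sums])
    then have "(?a has_sum S) {1..}" 
    proof (rule iffD1[OF has_sum_cong_neutral, rotated -1])
      show "?a n = 0" if "n \<in> UNIV - {1..}" for n using that by simp
    qed auto
    ultimately show ?thesis by simp
  qed
  ultimately show ?thesis using that by blast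
qed

text \<open>Around \<open>s = 2\<close> the Dirichlet series becomes a power series in \<open>w = 2 - s\<close>, whose coefficients \<open>c k\<close> are
nonnegative because \<open>H n\<close> and \<open>ln n\<close> are.  By uniqueness it is the Taylor series of \<open>\<Phi>\<close>, which converges in
the disc of radius \<open>2\<close> since \<open>\<Phi>\<close> is holomorphic there.  At a point \<open>w = t\<close> of the interval \<open>(0, 2)\<close> all
terms of the double series are nonnegative, so it may be summed in the original order again.\<close>

lemma Landau_nonneg_summable:
  fixes H :: "nat \<Rightarrow> real" and \<Phi> :: "complex \<Rightarrow> complex"
  assumes H: "\<And>n. n \<ge> 1 \<Longrightarrow> H n \<ge> 0" and hol: "\<Phi> holomorphic_on {s. Re s > 0}"
    and sum: "\<And>s. Re s > 1 \<Longrightarrow> ((\<lambda>n. of_real (H n) * of_nat n powr (-s)) has_sum \<Phi> s) {1..}"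
    and t: "0 < t" "t < 2"
  shows "(\<lambda>n. H n * real n powr (t - 2)) summable_on {1..}"
proof -
  define a where "a n = H n * real n powr (-2)" for n
  define l where "l n = ln (real n)" for n
  have a0: "a n \<ge> 0" and l0: "l n \<ge> 0" if "n \<ge> 1" for n using that H by (auto simp: a_def l_def)
  have term_r: "a n * exp (w * l n) = H n * real n powr (w - 2)" if "n \<ge> 1" for n w
  proof -
    have "real n powr (w - 2) = real n powr (-2) * real n powr w" using that by (simp flip: powr_add)
    also have "real n powr w = exp (w * l n)" using that by (simp add: powr_def l_def)
    finally show ?thesis by (simp add: a_def)
  qed
  have term_c: "of_real (a n) * exp (w * of_real (l n)) = of_real (H n) * of_nat n powr (-(2 - w))" if "n \<ge> 1" for n and w :: complex
  proof -
    have "(of_nat n :: complex) powr (-(2 - w)) = of_nat n powr (-2) * of_nat n powr w"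
      by (simp flip: powr_add)
    also have "(of_nat n :: complex) powr w = exp (w * of_real (l n))"
      using that by (simp add: powr_def l_def Ln_of_nat)
    also have "(of_nat n :: complex) powr (-2) = of_real (real n powr (-2))"
      using that powr_of_real[of "real n" "-2"] by simp
    finally show ?thesis by (simp add: a_def)
  qed
  have exp_sum: "((\<lambda>k. a n * l n ^ k / fact k * w ^ k) has_sum a n * exp (w * l n)) UNIV"
    if "n \<ge> 1" "w \<ge> 0" for n w
  proof -
    have "(\<lambda>k. (w * l n) ^ k /\<^sub>R fact k) sums exp (w * l n)" by (rule exp_converges)
    then have s: "(\<lambda>k. a n * ((w * l n) ^ k /\<^sub>R fact k)) sums (a n * exp (w * l n))" by (rule sums_mult)
    have e: "(\<lambda>k. a n * ((w * l n) ^ k /\<^sub>R fact k)) = (\<lambda>k. a n * l n ^ k / fact k * w ^ k)"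
      by (auto simp: fun_eq_iff power_mult_distrib divide_inverse)
    have s': "(\<lambda>k. a n * l n ^ k / fact k * w ^ k) sums (a n * exp (w * l n))" using s unfolding e .
    moreover have "summable (\<lambda>k. norm (a n * l n ^ k / fact k * w ^ k))"
      using s' a0[OF that(1)] l0[OF that(1)] that(2) by (simp add: sums_iff)
    ultimately show ?thesis by (intro norm_summable_imp_has_sum)
  qed
  have outer: "(\<lambda>n. a n * exp (w * l n)) summable_on {1..}" if "0 \<le> w" "w < 1" for w
  proof -
    have "(\<lambda>n. of_real (H n) * of_nat n powr (-(2 - of_real w)) :: complex) summable_on {1..}"
      using sum[of "2 - of_real w"] that by (auto simp: summable_on_def)
    then have "(\<lambda>n. Re (of_real (H n) * of_nat n powr (-(2 - of_real w)))) summable_on {1..}" by (rule summable_on_Re)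
    also have "?this \<longleftrightarrow> ?thesis"
    proof (rule summable_on_cong)
      fix n :: nat assume "n \<in> {1..}"
      then have "of_real (a n) * exp (of_real w * of_real (l n)) = of_real (H n) * of_nat n powr (-(2 - of_real w :: complex))"
        using term_c[of n "of_real w"] by simp
      then have "of_real (H n) * of_nat n powr (-(2 - of_real w :: complex)) = of_real (a n * exp (w * l n))"
        by (simp flip: exp_of_real)
      then show "Re (of_real (H n) * of_nat n powr (-(2 - of_real w))) = a n * exp (w * l n)" by (simp only: Re_complex_of_real)
    qed
    finally show ?thesis .
  qed
  define G where "G w n k = a n * l n ^ k / fact k * w ^ k" for w :: real and n k :: nat
  have G0: "G w n k \<ge> 0" if "n \<ge> 1" "w \<ge> 0" for w n k using a0 l0 that by (simp add: G_def)
  have G_sum: "(\<lambda>(n, k). G w n k) summable_on {1..} \<times> UNIV" if "0 \<le> w" "w < 1" for w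
  proof (rule summable_on_SigmaI)
    show "((\<lambda>k. case (n, k) of (n, k) \<Rightarrow> G w n k) has_sum a n * exp (w * l n)) UNIV" if "n \<in> {1..}" for n
      using exp_sum[of n w] that \<open>0 \<le> w\<close> by (simp add: G_def)
    show "(\<lambda>n. a n * exp (w * l n)) summable_on {1..}" by (rule outer[OF that])
  qed (use G0 that in auto)
  define c where "c k = (\<Sum>\<^sub>\<infinity>n\<in>{1..}. a n * l n ^ k / fact k)" for k
  have c_sum: "((\<lambda>n. a n * l n ^ k / fact k) has_sum c k) {1..}" for k
  proof -
    have "(\<lambda>(k, n). G (1/2) n k) summable_on UNIV \<times> {1..}"
      using iffD1[OF summable_on_swap G_sum[of "1/2"]] by simp
    then have "(\<lambda>n. G (1/2) n k) summable_on {1..}" by (rule summable_on_SigmaD1) simp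
    then have "(\<lambda>n. G (1/2) n k * 2 ^ k) summable_on {1..}" by (rule summable_on_cmult_left)
    also have "(\<lambda>n. G (1/2) n k * 2 ^ k) = (\<lambda>n. a n * l n ^ k / fact k)"
      by (simp add: G_def power_divide fun_eq_iff)
    finally show ?thesis unfolding c_def by (rule has_sum_infsum)
  qed
  have powser: "(\<lambda>k. of_real (c k) * w ^ k) sums \<Phi> (2 - w)" if w: "norm w < 1" for w :: complex
  proof -
    define F where "F n k = of_real (a n * l n ^ k / fact k) * w ^ k" for n k
    have "(\<lambda>x. norm (case x of (n, k) \<Rightarrow> F n k)) summable_on {1..} \<times> UNIV"
    proof (subst summable_on_cong)
      show "(\<lambda>(n, k). G (norm w) n k) summable_on {1..} \<times> UNIV" by (rule G_sum) (use w in auto)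
      show "norm (case x of (n, k) \<Rightarrow> F n k) = (case x of (n, k) \<Rightarrow> G (norm w) n k)" if "x \<in> {1..} \<times> UNIV" for x
      proof -
        obtain n k where x: "x = (n, k)" by (cases x)
        then have n: "n \<ge> 1" using that by auto
        have "norm (F n k) = \<bar>a n * l n ^ k / fact k\<bar> * norm w ^ k"
          unfolding F_def norm_mult norm_power norm_of_real ..
        also have "\<bar>a n * l n ^ k / fact k\<bar> = a n * l n ^ k / fact k" using a0[OF n] l0[OF n] by simp
        finally show ?thesis by (simp add: x G_def)
      qed
    qed
    then have "(\<lambda>(n, k). F n k) summable_on {1..} \<times> UNIV" by (rule abs_summable_summable)
    then obtain T where T: "((\<lambda>(n, k). F n k) has_sum T) ({1..} \<times> UNIV)" by (auto simp: summable_on_def)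
    have inner: "((\<lambda>k. F n k) has_sum of_real (H n) * of_nat n powr (-(2 - w))) UNIV" if "n \<ge> 1" for n
    proof -
      have "(\<lambda>k. (w * of_real (l n)) ^ k /\<^sub>R fact k) sums exp (w * of_real (l n))" by (rule exp_converges)
      then have s: "(\<lambda>k. of_real (a n) * ((w * of_real (l n)) ^ k /\<^sub>R fact k)) sums (of_real (a n) * exp (w * of_real (l n)))"
        by (rule sums_mult)
      have e: "(\<lambda>k. of_real (a n) * ((w * of_real (l n)) ^ k /\<^sub>R fact k)) = F n"
        by (auto simp: fun_eq_iff F_def power_mult_distrib divide_inverse scaleR_conv_of_real)
      have "summable (\<lambda>k. norm (F n k))"
      proof -
        have "norm (F n k) = a n * l n ^ k / fact k * norm w ^ k" for k
          using a0[OF that] l0[OF that] by (simp add: F_def norm_mult norm_power norm_divide)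
        moreover have "summable (\<lambda>k. a n * l n ^ k / fact k * norm w ^ k)"
          using exp_sum[OF that norm_ge_zero[of w]] has_sum_imp_sums sums_summable by blast
        ultimately show ?thesis by simp
      qed
      then show ?thesis using s unfolding e term_c[OF that] by (intro norm_summable_imp_has_sum)
    qed
    have "((\<lambda>n. of_real (H n) * of_nat n powr (-(2 - w))) has_sum T) {1..}"
      by (rule has_sum_SigmaD[OF T]) (use inner in auto)
    moreover have "Re (2 - w) > 1" using w abs_Re_le_cmod[of w] by simp
    ultimately have T': "T = \<Phi> (2 - w)" using sum has_sum_unique by blast
    have "((\<lambda>(k, n). F n k) has_sum T) (UNIV \<times> {1..})"
      using iffD1[OF has_sum_swap T] by simp
    then have "((\<lambda>k. of_real (c k) * w ^ k) has_sum T) UNIV"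
    proof (rule has_sum_SigmaD)
      fix k :: nat
      have "((\<lambda>n. of_real (a n * l n ^ k / fact k) * w ^ k) has_sum of_real (c k) * w ^ k) {1..}"
        by (intro has_sum_cmult_left has_sum_of_real c_sum)
      then show "((\<lambda>n. case (k, n) of (k, n) \<Rightarrow> F n k) has_sum of_real (c k) * w ^ k) {1..}" by (simp add: F_def)
    qed
    then show ?thesis unfolding T' by (rule has_sum_imp_sums)
  qed
  \<comment> \<open>So far the power series is known to converge only for arguments of modulus below 1; Taylor expansion of g gives radius 2.\<close>
  define C where "C = Abs_fps (\<lambda>k. complex_of_real (c k))"
  define g where "g w = \<Phi> (2 - w)" for w
  have rad: "fps_conv_radius C \<ge> 1"
    unfolding fps_conv_radius_def
  proof (rule conv_radius_geI_ex')
    fix r :: real assume "0 < r" "ereal r < 1"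
    then have "norm (of_real r :: complex) < 1" by simp
    from powser[OF this] show "summable (\<lambda>n. fps_nth C n * of_real r ^ n)" by (simp add: C_def sums_iff)
  qed
  have "g has_fps_expansion C"
    unfolding has_fps_expansion_def
  proof (intro conjI)
    show "fps_conv_radius C > 0" using rad by (rule less_le_trans[rotated]) simp
    have "eventually (\<lambda>w. w \<in> ball 0 1) (nhds (0 :: complex))" by (intro eventually_nhds_in_open) auto
    then show "eventually (\<lambda>w. eval_fps C w = g w) (nhds 0)"
      by eventually_elim (use powser in \<open>auto simp: eval_fps_def C_def g_def sums_iff\<close>)
  qed
  have hol_g: "g holomorphic_on ball 0 2"
  proof -
    have sub: "(\<lambda>w. 2 - w) ` ball 0 2 \<subseteq> {s :: complex. Re s > 0}"
    proof (clarsimp)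
      fix w :: complex assume "norm w < 2"
      then show "Re w < 2" using complex_Re_le_cmod[of w] by linarith
    qed
    show ?thesis unfolding g_def
      using holomorphic_on_compose_gen[OF _ hol sub] by (simp add: o_def holomorphic_intros)
  qed
  then have "g has_fps_expansion fps_expansion g 0"
    by (intro has_fps_expansion_fps_expansion[of "ball 0 2"]) auto
  then have "C = fps_expansion g 0" using \<open>g has_fps_expansion C\<close> fps_expansion_unique_complex by blast
  moreover have "fps_conv_radius (fps_expansion g 0) \<ge> ereal 2"
    by (rule conv_radius_fps_expansion) (use hol_g in simp)
  ultimately have rad2: "fps_conv_radius C \<ge> ereal 2" by simp
  have c0: "c k \<ge> 0" for k unfolding c_def using a0 l0 by (intro infsum_nonneg) auto
  have "summable (\<lambda>k. norm (fps_nth C k * of_real t ^ k))"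
  proof (rule norm_summable_fps)
    have "ereal t < ereal 2" using t by simp
    then have "ereal t < fps_conv_radius C" using rad2 by (rule less_le_trans)
    then show "ereal (norm (complex_of_real t)) < fps_conv_radius C" using t by simp
  qed
  then have "summable (\<lambda>k. norm (c k * t ^ k))" by (simp add: C_def norm_mult norm_power abs_mult power_abs)
  then have "(\<lambda>k. c k * t ^ k) summable_on UNIV" by (rule norm_summable_imp_summable_on)
  then have "(\<lambda>(k, n). G t n k) summable_on UNIV \<times> {1..}"
  proof (rule summable_on_SigmaI[rotated])
    show "((\<lambda>n. case (k, n) of (k, n) \<Rightarrow> G t n k) has_sum c k * t ^ k) {1..}" for k
      unfolding G_def prod.case by (intro has_sum_cmult_left c_sum)
  qed (use G0 t in auto)
  then have "(\<lambda>(n, k). G t n k) summable_on {1..} \<times> UNIV"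
    by (subst summable_on_swap) simp
  then obtain T where "((\<lambda>(n, k). G t n k) has_sum T) ({1..} \<times> UNIV)" by (auto simp: summable_on_def)
  then have "((\<lambda>n. a n * exp (t * l n)) has_sum T) {1..}"
    by (rule has_sum_SigmaD) (use exp_sum t in \<open>auto simp: G_def\<close>)
  then have "(\<lambda>n. a n * exp (t * l n)) summable_on {1..}" by (auto simp: summable_on_def)
  also have "?this \<longleftrightarrow> ?thesis" by (rule summable_on_cong) (use term_r in auto)
  finally show ?thesis .
qed

section \<open>Dirichlet convolution\<close>

definition dirichlet_conv :: "(nat \<Rightarrow> real) \<Rightarrow> (nat \<Rightarrow> real) \<Rightarrow> nat \<Rightarrow> real" where
  "dirichlet_conv f g n = (\<Sum>d | d dvd n. f d * g (n div d))"

definition multiplicative_fun :: "(nat \<Rightarrow> real) \<Rightarrow> bool" where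
  "multiplicative_fun f \<longleftrightarrow> f 1 = 1 \<and> (\<forall>a b. a > 0 \<longrightarrow> b > 0 \<longrightarrow> coprime a b \<longrightarrow> f (a * b) = f a * f b)"

lemma multiplicative_dirichlet_conv:
  assumes f: "multiplicative_fun f" and g: "multiplicative_fun g"
  shows "multiplicative_fun (dirichlet_conv f g)"
  unfolding multiplicative_fun_def
proof (intro conjI allI impI)
  have "{d. d dvd (1::nat)} = {1}" by auto
  then show "dirichlet_conv f g 1 = 1" using f g by (simp add: dirichlet_conv_def multiplicative_fun_def)
next
  fix a b :: nat assume ab: "a > 0" "b > 0" "coprime a b"
  let ?D = "\<lambda>n :: nat. {d. d dvd n}"
  have gcds: "gcd (d * e) a = d" "gcd (d * e) b = e" if "d dvd a" "e dvd b" for d e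
  proof -
    have c: "coprime a e" "coprime b d"
      using coprime_divisors[OF dvd_refl that(2) ab(3)] coprime_divisors[OF that(1) dvd_refl ab(3)]
      by (simp_all add: coprime_commute)
    show "gcd (d * e) a = d" unfolding gcd_mult_left_right_cancel[OF c(1)] using that(1) by (rule gcd_nat.absorb1)
    show "gcd (d * e) b = e" unfolding gcd_mult_left_left_cancel[OF c(2)] using that(2) by (rule gcd_nat.absorb1)
  qed
  have inj: "inj_on (\<lambda>(d, e). d * e) (?D a \<times> ?D b)"
  proof (rule inj_onI)
    fix x y :: "nat \<times> nat"
    assume xy: "x \<in> ?D a \<times> ?D b" "y \<in> ?D a \<times> ?D b" and eq: "(\<lambda>(d, e). d * e) x = (\<lambda>(d, e). d * e) y"
    obtain d e d' e' where p: "x = (d, e)" "y = (d', e')" by (cases x, cases y)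
    have dv: "d dvd a" "e dvd b" "d' dvd a" "e' dvd b" and eq': "d * e = d' * e'" using xy eq by (auto simp: p)
    have "d = d'" "e = e'" using gcds[OF dv(1,2)] gcds[OF dv(3,4)] unfolding eq' by simp_all
    then show "x = y" by (simp add: p)
  qed
  have img: "?D (a * b) = (\<lambda>(d, e). d * e) ` (?D a \<times> ?D b)"
  proof
    show "?D (a * b) \<subseteq> (\<lambda>(d, e). d * e) ` (?D a \<times> ?D b)"
    proof
      fix d assume "d \<in> ?D (a * b)"
      then have "\<exists>u v. d = u * v \<and> u dvd a \<and> v dvd b" using division_decomp by blast
      then show "d \<in> (\<lambda>(d, e). d * e) ` (?D a \<times> ?D b)" by (auto intro!: rev_image_eqI)
    qed
  qed (auto intro: mult_dvd_mono)
  have "dirichlet_conv f g (a * b) = (\<Sum>(d, e)\<in>?D a \<times> ?D b. f (d * e) * g (a * b div (d * e)))"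
    unfolding dirichlet_conv_def img by (subst sum.reindex[OF inj]) (simp add: case_prod_unfold)
  also have "\<dots> = (\<Sum>(d, e)\<in>?D a \<times> ?D b. (f d * g (a div d)) * (f e * g (b div e)))"
  proof (rule sum.cong[OF refl], clarify)
    fix d e assume "d dvd a" "e dvd b"
    then obtain u v where uv: "a = d * u" "b = e * v" by (elim dvdE)
    have pos: "d > 0" "e > 0" "u > 0" "v > 0" using ab uv by (auto intro!: Nat.gr0I)
    have cop: "coprime d e" "coprime u v" using ab(3) unfolding uv by (simp_all add: coprime_mult_left_iff coprime_mult_right_iff)
    have "a * b = (d * e) * (u * v)" by (simp add: uv)
    then have q: "a * b div (d * e) = u * v" "a div d = u" "b div e = v"
      using pos by (simp_all add: uv(1,2) del: nonzero_mult_div_cancel_left)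
    show "f (d * e) * g (a * b div (d * e)) = (f d * g (a div d)) * (f e * g (b div e))"
      unfolding q using f g pos cop by (simp add: multiplicative_fun_def)
  qed
  also have "\<dots> = dirichlet_conv f g a * dirichlet_conv f g b"
    by (simp add: dirichlet_conv_def sum_product sum.cartesian_product)
  finally show "dirichlet_conv f g (a * b) = dirichlet_conv f g a * dirichlet_conv f g b" .
qed

text \<open>The Euler factor at \<open>p\<close> as a formal power series in \<open>p\<^bsup>-s\<^esup>\<close>.\<close>

definition euler_fps :: "(nat \<Rightarrow> real) \<Rightarrow> nat \<Rightarrow> real fps" where
  "euler_fps f p = Abs_fps (\<lambda>k. f (p ^ k))"

lemma euler_fps_dirichlet_conv:
  assumes p: "prime p"
  shows "euler_fps (dirichlet_conv f g) p = euler_fps f p * euler_fps g p"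
proof (rule fps_ext)
  fix k
  have p1: "p > 1" using p prime_gt_1_nat by blast
  have D: "{d. d dvd p ^ k} = (\<lambda>i. p ^ i) ` {0..k}" using divides_primepow_nat[OF p] by auto
  have "dirichlet_conv f g (p ^ k) = (\<Sum>i=0..k. f (p ^ i) * g (p ^ k div p ^ i))"
    unfolding dirichlet_conv_def D using p1 by (subst sum.reindex) (auto simp: inj_on_def)
  also have "\<dots> = (\<Sum>i=0..k. f (p ^ i) * g (p ^ (k - i)))"
    using p1 by (intro sum.cong) (auto simp: power_diff)
  finally show "euler_fps (dirichlet_conv f g) p $ k = (euler_fps f p * euler_fps g p) $ k"
    by (simp add: euler_fps_def fps_mult_nth)
qed

text \<open>A lower bound at the prime powers dividing \<open>n\<close> passes to the product if \<open>c\<close> is idempotent, that is,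
\<open>0\<close> or \<open>1\<close>.  The predicate \<open>P\<close> restricts the exponents for which the bound must be known; for a square
\<open>n\<close> it is evenness.\<close>

lemma multiplicative_fun_ge:
  assumes f: "multiplicative_fun f" and c: "c \<ge> (0::real)" "c \<le> 1"
    and pp: "\<And>p k. prime p \<Longrightarrow> p dvd n \<Longrightarrow> k > 0 \<Longrightarrow> P k \<Longrightarrow> f (p ^ k) \<ge> c"
    and P: "\<And>p. prime p \<Longrightarrow> p dvd n \<Longrightarrow> P (multiplicity p n)" and cc: "c * c = c"
  shows "n > 0 \<Longrightarrow> f n \<ge> c"
  using pp P
proof (induction n rule: less_induct)
  case (less n)
  show ?case
  proof (cases "n = 1")
    case True
    then show ?thesis using f c by (simp add: multiplicative_fun_def)
  next
    case False
    obtain p where p: "prime p" "p dvd n" using prime_factor_nat[OF False] by blast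
    define k where "k = multiplicity p n"
    obtain b where b: "n = p ^ k * b" "\<not> p dvd b"
      using multiplicity_decompose'[of n p] less.prems(1) p unfolding k_def by (metis less_irrefl not_prime_unit)
    have k: "k > 0" using p b by (intro Nat.gr0I) auto
    have b0: "b > 0" using less.prems(1) b by (auto intro!: Nat.gr0I)
    have pk: "p ^ k > 1" using prime_gt_1_nat[OF p(1)] k by (rule one_less_power)
    have "f n = f (p ^ k) * f b"
      using f b p b0 unfolding b(1) multiplicative_fun_def by (simp add: prime_imp_coprime prime_gt_0_nat)
    moreover have "f (p ^ k) \<ge> c" using less.prems p k by (simp add: k_def)
    moreover have "f b \<ge> c"
    proof (rule less.IH)
      show "b < n" using pk b0 b(1) by simp
      show "c \<le> f (p' ^ k')" if "prime p'" "p' dvd b" "0 < k'" "P k'" for p' k'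
        using less.prems(2)[of p' k'] that b(1) by simp
      show "P (multiplicity p' b)" if "prime p'" "p' dvd b" for p'
      proof -
        have "\<not> p' dvd p ^ k" using that b(2) p by (metis prime_dvd_power primes_dvd_imp_eq)
        then have "multiplicity p' n = multiplicity p' b"
          unfolding b(1) using that p b0 pk
          by (subst prime_elem_multiplicity_mult_distrib) (auto simp: not_dvd_imp_multiplicity_0)
        then show ?thesis using less.prems(3)[of p'] that b(1) by simp
      qed
    qed (use b0 in auto)
    ultimately have "f n \<ge> c * c" using c by (simp add: mult_mono)
    then show ?thesis by (simp add: cc)
  qed
qed

lemma dirichlet_conv_has_sum:
  fixes f g :: "nat \<Rightarrow> real" and s :: complex
  assumes f: "((\<lambda>n. of_real (f n) * of_nat n powr (-s)) has_sum F) {1..}"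
    and g: "((\<lambda>n. of_real (g n) * of_nat n powr (-s)) has_sum G) {1..}"
  shows "((\<lambda>n. of_real (dirichlet_conv f g n) * of_nat n powr (-s)) has_sum F * G) {1..}"
proof -
  let ?a = "\<lambda>n. of_real (f n) * of_nat n powr (-s) :: complex" and ?b = "\<lambda>n. of_real (g n) * of_nat n powr (-s) :: complex"
  have "?a summable_on {1..}" "?b summable_on {1..}" using f g by (auto simp: summable_on_def)
  then have abs: "(\<lambda>n. norm (?a n)) summable_on {1..}" "(\<lambda>n. norm (?b n)) summable_on {1..}"
    by (simp_all only: summable_on_iff_abs_summable_on_complex)
  have "(\<lambda>(d, e). norm (?a d) * norm (?b e)) summable_on {1..} \<times> {1..}"
  proof (rule summable_on_SigmaI)
    show "((\<lambda>e. case (d, e) of (d, e) \<Rightarrow> norm (?a d) * norm (?b e)) has_sum norm (?a d) * (\<Sum>\<^sub>\<infinity>e\<in>{1..}. norm (?b e))) {1..}" for d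
      unfolding prod.case by (intro has_sum_cmult_right has_sum_infsum abs)
    show "(\<lambda>d. norm (?a d) * (\<Sum>\<^sub>\<infinity>e\<in>{1..}. norm (?b e))) summable_on {1..}"
      by (intro summable_on_cmult_left abs)
  qed auto
  then have "(\<lambda>x. norm (case x of (d, e) \<Rightarrow> ?a d * ?b e)) summable_on {1..} \<times> {1..}"
    by (simp add: case_prod_unfold norm_mult)
  then have "(\<lambda>(d, e). ?a d * ?b e) summable_on {1..} \<times> {1..}" by (rule abs_summable_summable)
  then obtain T where T: "((\<lambda>(d, e). ?a d * ?b e) has_sum T) ({1..} \<times> {1..})" by (auto simp: summable_on_def)
  have "((\<lambda>d. ?a d * G) has_sum T) {1..}"
    by (rule has_sum_SigmaD[OF T]) (unfold prod.case, rule has_sum_cmult_right[OF g])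
  moreover have "((\<lambda>d. ?a d * G) has_sum F * G) {1..}" by (rule has_sum_cmult_left[OF f])
  ultimately have T': "T = F * G" by (rule has_sum_unique)
  have "((\<lambda>(d, e). ?a d * ?b e) has_sum T) ({1..} \<times> {1..}) \<longleftrightarrow>
     ((\<lambda>(n, d). of_real (f d * g (n div d)) * of_nat n powr (-s)) has_sum T) (SIGMA n:{1..}. {d. d dvd n})"
  proof (rule has_sum_reindex_bij_witness[of _ "\<lambda>(n, d). (d, n div d)" "\<lambda>(d, e). (d * e, d)"])
    fix x :: "nat \<times> nat" assume "x \<in> {1..} \<times> {1..}"
    then obtain d e where x: "x = (d, e)" "d \<ge> 1" "e \<ge> 1" by auto
    show "(case case x of (d, e) \<Rightarrow> (d * e, d) of (n, d) \<Rightarrow> (d, n div d)) = x" using x by simp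
    show "(case x of (d, e) \<Rightarrow> (d * e, d)) \<in> (SIGMA n:{1..}. {d. d dvd n})"
      using x by (simp add: Suc_le_eq)
    have "(of_nat (d * e) :: complex) powr (-s) = of_nat d powr (-s) * of_nat e powr (-s)"
      using powr_times_real[of "of_nat d" "of_nat e" "-s"] by simp
    then show "(case case x of (d, e) \<Rightarrow> (d * e, d) of (n, d) \<Rightarrow> of_real (f d * g (n div d)) * of_nat n powr (-s)) = (case x of (d, e) \<Rightarrow> ?a d * ?b e)"
      using x by (simp add: mult_ac)
  next
    fix x :: "nat \<times> nat" assume "x \<in> (SIGMA n:{1..}. {d. d dvd n})"
    then obtain n d where x: "x = (n, d)" "n \<ge> 1" "d dvd n" by auto
    have d0: "d > 0" using x by (intro Nat.gr0I) auto
    show "(case case x of (n, d) \<Rightarrow> (d, n div d) of (d, e) \<Rightarrow> (d * e, d)) = x" using x by simp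
    have "n div d > 0" using x d0 by (simp add: div_greater_zero_iff dvd_imp_le)
    then show "(case x of (n, d) \<Rightarrow> (d, n div d)) \<in> {1..} \<times> {1..}" using x d0 by simp
  qed (rule refl)
  from iffD1[OF this T] show ?thesis unfolding T'
  proof (rule has_sum_SigmaD)
    fix n :: nat assume "n \<in> {1..}"
    then have "finite {d. d dvd n}" by simp
    then have "((\<lambda>d. of_real (f d * g (n div d)) * of_nat n powr (-s)) has_sum (\<Sum>d | d dvd n. of_real (f d * g (n div d)) * of_nat n powr (-s))) {d. d dvd n}"
      by (rule has_sum_finite)
    also have "(\<Sum>d | d dvd n. of_real (f d * g (n div d)) * of_nat n powr (-s)) = of_real (dirichlet_conv f g n) * of_nat n powr (-s)"
      by (simp add: dirichlet_conv_def sum_distrib_right)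
    finally show "((\<lambda>d. case (n, d) of (n, d) \<Rightarrow> of_real (f d * g (n div d)) * of_nat n powr (-s)) has_sum of_real (dirichlet_conv f g n) * of_nat n powr (-s)) {d. d dvd n}"
      unfolding prod.case .
  qed
qed

section \<open>Four real characters\<close>

text \<open>The common shape of the Euler factors \<open>1/(1 - x)\<^sup>4\<close> and \<open>1/(1 - x\<^sup>2)\<^sup>2\<close>; it is stable under products.\<close>

definition good_fps :: "real fps \<Rightarrow> bool" where
  "good_fps A \<longleftrightarrow> (\<forall>k. A $ k \<ge> 0) \<and> (\<forall>k. even k \<longrightarrow> A $ k \<ge> 1)"

lemma good_fps_mult:
  assumes "good_fps A" "good_fps B" shows "good_fps (A * B)"
proof -
  have nn: "A $ i * B $ j \<ge> 0" for i j using assms by (simp add: good_fps_def)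
  have "(A * B) $ k \<ge> 1" if "even k" for k
  proof -
    have "1 * 1 \<le> A $ k * B $ 0" using assms that by (intro mult_mono) (auto simp: good_fps_def)
    also have "\<dots> = (\<Sum>i\<in>{k}. A $ i * B $ (k - i))" by simp
    also have "\<dots> \<le> (\<Sum>i=0..k. A $ i * B $ (k - i))" using nn by (intro sum_mono2) auto
    finally show ?thesis by (simp add: fps_mult_nth)
  qed
  then show ?thesis using nn by (auto simp: good_fps_def fps_mult_nth intro!: sum_nonneg)
qed

definition geometric :: "real \<Rightarrow> real fps" where "geometric a = Abs_fps (\<lambda>k. a ^ k)"

lemma good_geometric: "good_fps (geometric 1)" "good_fps (geometric 1 * geometric (-1))"
proof -
  show "good_fps (geometric 1)" by (simp add: good_fps_def geometric_def)
  have "(\<Sum>i=0..k. (-1 :: real) ^ (k - i)) = (if even k then 1 else 0)" for k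
  proof -
    have "(\<Sum>i=0..k. (-1 :: real) ^ (k - i)) = (\<Sum>i=0..k. (-1) ^ i)"
      by (rule sum.reindex_bij_witness[of _ "\<lambda>i. k - i" "\<lambda>i. k - i"]) auto
    also have "\<dots> = (if even k then 1 else 0)" by (induction k) auto
    finally show ?thesis .
  qed
  then show "good_fps (geometric 1 * geometric (-1))" by (simp add: good_fps_def geometric_def fps_mult_nth)
qed

lemma geometric_0: "geometric 0 = 1" by (simp add: geometric_def fps_eq_iff power_0_left)

text \<open>These are real Dirichlet characters other than the principal ones.\<close>

definition zero_mean_char :: "(nat \<Rightarrow> real) \<Rightarrow> bool" where
  "zero_mean_char f \<longleftrightarrow> f 1 = 1 \<and> (\<forall>a b. f (a * b) = f a * f b) \<and> (\<forall>n. \<bar>f n\<bar> \<le> 1) \<and>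
     (\<exists>q>0. (\<forall>n. f (n + q) = f n) \<and> (\<Sum>r<q. f r) = 0)"

lemma zero_mean_char_multiplicative: "zero_mean_char f \<Longrightarrow> multiplicative_fun f"
  by (simp add: zero_mean_char_def multiplicative_fun_def)

lemma zero_mean_char_euler:
  assumes "zero_mean_char f" shows "euler_fps f p = geometric (f p)"
proof -
  have "f (p ^ k) = f p ^ k" for k
    by (induction k) (use assms in \<open>simp_all add: zero_mean_char_def\<close>)
  then show ?thesis by (simp add: euler_fps_def geometric_def)
qed

text \<open>At a prime not dividing \<open>B\<close> the values of the characters are four times \<open>1\<close>, or twice \<open>1\<close> and twice
\<open>-1\<close>, so the Euler factor of the product of the four \<open>L\<close>-functions is \<open>1/(1 - x)\<^sup>4\<close> or
\<open>1/(1 - x\<^sup>2)\<^sup>2\<close>.  Hence the coefficients \<open>H n\<close> of the product are nonnegative, and at least \<open>1\<close> at the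
squares prime to \<open>B\<close>.  The product is holomorphic for \<open>Re s > 0\<close>, so \<open>\<Sum> H(n) n\<^bsup>-1/2\<^esup>\<close> converges; but
its terms with \<open>n = (1 + Bi)\<^sup>2\<close> already sum to infinity.\<close>

lemma four_characters_impossible:
  assumes f: "zero_mean_char f1" "zero_mean_char f2" "zero_mean_char f3" "zero_mean_char f4"
    and B: "B > 0"
    and bad: "\<And>p. prime p \<Longrightarrow> p dvd B \<Longrightarrow> f1 p = 0 \<and> f2 p = 0 \<and> f3 p = 0 \<and> f4 p = 0"
    and good: "\<And>p. prime p \<Longrightarrow> \<not> p dvd B \<Longrightarrow> {f1 p, f2 p, f3 p, f4 p} \<subseteq> {1, -1} \<and>
      f1 p * f2 p * f3 p * f4 p = 1 \<and> (f1 p = 1 \<or> f2 p = 1 \<or> f3 p = 1 \<or> f4 p = 1)"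
  shows False
proof -
  define H where "H = dirichlet_conv (dirichlet_conv f1 f2) (dirichlet_conv f3 f4)"
  have H: "multiplicative_fun H" unfolding H_def by (intro multiplicative_dirichlet_conv zero_mean_char_multiplicative f)
  have euler: "euler_fps H p = geometric (f1 p) * geometric (f2 p) * (geometric (f3 p) * geometric (f4 p))" if "prime p" for p
    unfolding H_def using that f by (simp add: euler_fps_dirichlet_conv zero_mean_char_euler)
  have Hpk: "H (p ^ k) = euler_fps H p $ k" for p k by (simp add: euler_fps_def)
  have good_H: "good_fps (euler_fps H p)" if p: "prime p" "\<not> p dvd B" for p
  proof -
    have G: "good_fps (geometric 1 * geometric 1)" "good_fps (geometric (-1) * geometric 1)"
      using good_fps_mult[OF good_geometric(1) good_geometric(1)] good_geometric(2) by (simp_all add: mult.commute)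
    have re: "a * a * (b * b) = (a * b) * (a * b)" "b * b * (a * a) = (a * b) * (a * b)" for a b :: "real fps"
      by (simp_all only: mult_ac)
    note g = good[OF p]
    have "x \<in> {1, -1}" if "x \<in> {f1 p, f2 p, f3 p, f4 p}" for x by (rule subsetD[OF conjunct1[OF g] that])
    then have "x = 1 \<or> x = -1" if "x \<in> {f1 p, f2 p, f3 p, f4 p}" for x using that by fast
    then have m1: "f1 p = 1 \<or> f1 p = -1" "f2 p = 1 \<or> f2 p = -1" "f3 p = 1 \<or> f3 p = -1" "f4 p = 1 \<or> f4 p = -1"
      by simp_all
    note m2 = conjunct1[OF conjunct2[OF g]] conjunct2[OF conjunct2[OF g]]
    note re1 = re(1)[of "geometric 1" "geometric (-1)"] re(2)[of "geometric (-1)" "geometric 1"]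
    have G4: "good_fps (geometric 1 * geometric 1 * (geometric 1 * geometric 1))" "good_fps (geometric 1 * geometric (-1) * (geometric 1 * geometric (-1)))"
      using G good_geometric by (auto intro: good_fps_mult)
    \<comment> \<open>Power series commute, so the factors can be paired as (1, -1), (1, -1) whenever two values are -1.\<close>
    show ?thesis
    proof (cases "f1 p = f2 p")
      case True
      then have "f3 p = f4 p" using m1 m2(1) by auto
      then show ?thesis unfolding euler[OF p(1)] using True m1 m2(2) G4 by (auto simp: re1)
    next
      case False
      then have "f2 p = - f1 p" "f4 p = - f3 p" using m1 m2(1) by auto
      then show ?thesis unfolding euler[OF p(1)] using m1(1,3) G4 by (auto simp: mult.commute)
    qed
  qed
  have H0: "H n \<ge> 0" if "n > 0" for n
  proof (rule multiplicative_fun_ge[OF H, where P = "\<lambda>_. True"])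
    fix p k :: nat assume p: "prime p" "k > 0"
    show "0 \<le> H (p ^ k)"
    proof (cases "p dvd B")
      case True
      have e: "euler_fps H p = 1" unfolding euler[OF p(1)] using bad[OF p(1) True]
        by (simp add: geometric_0)
      show ?thesis unfolding Hpk e by simp
    next
      case False
      then show ?thesis using good_H[OF p(1)] by (simp add: Hpk good_fps_def)
    qed
  qed (use that in auto)
  have H1: "H (j\<^sup>2) \<ge> 1" if j: "j > 0" "coprime j B" for j
  proof (rule multiplicative_fun_ge[OF H, where P = even])
    fix p k :: nat assume p: "prime p" "p dvd j\<^sup>2" "even k"
    have "p dvd j" using p prime_dvd_power by blast
    then have "\<not> p dvd B" using j p by (metis coprime_common_divisor_nat not_prime_1)
    then show "1 \<le> H (p ^ k)" using good_H[OF p(1)] p(3) by (simp add: Hpk good_fps_def)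
  next
    fix p :: nat assume "prime p"
    then show "even (multiplicity p (j\<^sup>2))" using j by (subst prime_elem_multiplicity_power_distrib) auto
  qed (use j in auto)
  have "\<exists>L. L holomorphic_on {s. Re s > 0} \<and> (\<forall>s. Re s > 1 \<longrightarrow> ((\<lambda>n. of_real (g n) * of_nat n powr (-s)) has_sum L s) {1..})"
    if g: "zero_mean_char g" for g
  proof -
    obtain q where q: "q > 0" "\<And>n. g (n + q) = g n" "(\<Sum>r<q. g r) = 0" using g by (auto simp: zero_mean_char_def)
    show ?thesis
      by (rule Dirichlet_L_continuation[of q g]) (use q g in \<open>auto simp: zero_mean_char_def\<close>)
  qed
  then obtain L where L: "\<And>g. zero_mean_char g \<Longrightarrow> L g holomorphic_on {s. Re s > 0}"
    "\<And>g s. zero_mean_char g \<Longrightarrow> Re s > 1 \<Longrightarrow> ((\<lambda>n. of_real (g n) * of_nat n powr (-s)) has_sum L g s) {1..}"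
    by metis
  define \<Phi> where "\<Phi> s = (L f1 s * L f2 s) * (L f3 s * L f4 s)" for s
  have "(\<lambda>n. H n * real n powr (3 / 2 - 2)) summable_on {1..}"
  proof (rule Landau_nonneg_summable[where \<Phi> = \<Phi>])
    show "\<Phi> holomorphic_on {s. Re s > 0}"
      unfolding \<Phi>_def by (intro holomorphic_on_mult L f)
    show "((\<lambda>n. of_real (H n) * of_nat n powr (-s)) has_sum \<Phi> s) {1..}" if "Re s > 1" for s
      unfolding \<Phi>_def H_def by (intro dirichlet_conv_has_sum L f that)
  qed (use H0 in auto)
  then have sm: "(\<lambda>n. H n * real n powr (-1/2)) summable_on {1..}" by simp
  define j where "j i = 1 + B * i" for i
  have j: "j i > 0" "coprime (j i) B" for i
  proof -
    show "coprime (j i) B" unfolding j_def by (rule coprimeI) (metis dvd_add_left_iff dvd_mult2)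
  qed (simp add: j_def)
  have inj: "inj (\<lambda>i. (j i)\<^sup>2)"
    by (rule injI) (use B in \<open>simp add: j_def power2_eq_iff_nonneg\<close>)
  have "(\<lambda>n. H n * real n powr (-1/2)) summable_on range (\<lambda>i. (j i)\<^sup>2)"
    by (rule summable_on_subset_banach[OF sm]) (use j in \<open>auto simp: Suc_le_eq\<close>)
  then have "(\<lambda>i. H ((j i)\<^sup>2) * real ((j i)\<^sup>2) powr (-1/2)) summable_on UNIV"
    by (subst (asm) summable_on_reindex[OF inj]) (simp add: o_def)
  then have s2: "summable (\<lambda>i. H ((j i)\<^sup>2) * real ((j i)\<^sup>2) powr (-1/2))" by (rule summable_on_imp_summable)
  have "summable (\<lambda>i. inverse (real (B + 1)) * inverse (real (Suc i)))"
  proof (rule summable_comparison_test'[OF s2, where N = 0])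
    fix i
    have "real ((j i)\<^sup>2) powr (-1/2) = inverse (real (j i))"
    proof -
      have "real ((j i)\<^sup>2) powr (-1/2) = (real (j i) powr 2) powr (-1/2)" using j(1)[of i] by simp
      also have "\<dots> = real (j i) powr (-1)" unfolding powr_powr by simp
      also have "\<dots> = inverse (real (j i))" using j(1)[of i] by (simp add: powr_minus)
      finally show ?thesis .
    qed
    moreover have "inverse (real (B + 1)) * inverse (real (Suc i)) \<le> inverse (real (j i))"
    proof -
      have "j i \<le> (B + 1) * Suc i" by (simp add: j_def)
      then have "real (j i) \<le> real (B + 1) * real (Suc i)" by (metis of_nat_le_iff of_nat_mult)
      then have "inverse (real (B + 1) * real (Suc i)) \<le> inverse (real (j i))"
        using j(1)[of i] by (intro le_imp_inverse_le) auto
      then show ?thesis by (simp only: inverse_mult_distrib)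
    qed
    moreover have "1 * inverse (real (j i)) \<le> H ((j i)\<^sup>2) * inverse (real (j i))"
      using H1[OF j, of i] by (intro mult_right_mono) auto
    ultimately show "norm (inverse (real (B + 1)) * inverse (real (Suc i))) \<le> H ((j i)\<^sup>2) * real ((j i)\<^sup>2) powr (-1/2)"
      by simp
  qed
  then have "summable (\<lambda>i. inverse (real (Suc i)))"
    by (subst (asm) summable_cmult_iff) simp
  then have "summable (\<lambda>n. inverse (real n))" using summable_Suc_iff[of "\<lambda>n. inverse (real n)"] by blast
  then show False using not_summable_harmonic[where 'a = real] by simp
qed

section \<open>Quadratic characters\<close>

lemma Legendre_cong: "[a = b] (mod p) \<Longrightarrow> Legendre a p = Legendre b p"
proof -
  assume ab: "[a = b] (mod p)"
  have "[a = 0] (mod p) \<longleftrightarrow> [b = 0] (mod p)" using ab by (meson cong_sym cong_trans)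
  moreover have "QuadRes p a \<longleftrightarrow> QuadRes p b" unfolding QuadRes_def using ab by (meson cong_sym cong_trans)
  ultimately show ?thesis by (simp add: Legendre_def)
qed

lemma Legendre_values: "Legendre a p \<in> {-1, 0, 1}" by (simp add: Legendre_def)

lemma Legendre_eq_0_iff: "Legendre a p = 0 \<longleftrightarrow> p dvd a"
  by (simp add: Legendre_def cong_0_iff)

lemma sign_eqI:
  fixes x y :: int
  assumes "x \<in> {-1, 0, 1}" "y \<in> {-1, 0, 1}" "[x = y] (mod int p)" "p > 2"
  shows "x = y"
proof (rule ccontr)
  assume "x \<noteq> y"
  have "int p dvd x - y" using assms(3) by (simp add: cong_iff_dvd_diff)
  moreover have "x - y \<noteq> 0" using \<open>x \<noteq> y\<close> by simp
  ultimately have "\<bar>int p\<bar> \<le> \<bar>x - y\<bar>" by (intro dvd_imp_le_int)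
  then show False using assms by auto
qed

lemma Legendre_mult:
  assumes "prime p" "p > 2"
  shows "Legendre (a * b) (int p) = Legendre a p * Legendre b p"
proof (rule sign_eqI)
  have "[Legendre (a * b) p = (a * b) ^ ((p - 1) div 2)] (mod p)" by (rule euler_criterion[OF assms])
  also have "(a * b) ^ ((p - 1) div 2) = a ^ ((p - 1) div 2) * b ^ ((p - 1) div 2)" by (rule power_mult_distrib)
  also have "[\<dots> = Legendre a p * Legendre b p] (mod p)"
    by (intro cong_mult cong_sym[OF euler_criterion[OF assms]])
  finally show "[Legendre (a * b) p = Legendre a p * Legendre b p] (mod p)" .
  show "Legendre a p * Legendre b p \<in> {-1, 0, 1}"
    using Legendre_values[of a p] Legendre_values[of b p] by auto
qed (use assms Legendre_values in auto)

definition chi4 :: "nat \<Rightarrow> int" where "chi4 n = (if n mod 4 = 1 then 1 else -1)"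
definition chi8 :: "nat \<Rightarrow> int" where "chi8 n = (if n mod 8 = 1 \<or> n mod 8 = 7 then 1 else -1)"

lemma chi4_mult: "odd a \<Longrightarrow> odd b \<Longrightarrow> chi4 (a * b) = chi4 a * chi4 b"
proof -
  assume "odd a" "odd b"
  then have "a mod 4 = 1 \<or> a mod 4 = 3" "b mod 4 = 1 \<or> b mod 4 = 3" by presburger+
  moreover have "(a * b) mod 4 = ((a mod 4) * (b mod 4)) mod 4" by (simp add: mod_mult_eq)
  ultimately show ?thesis by (elim disjE) (simp_all add: chi4_def)
qed

lemma chi8_mult: "odd a \<Longrightarrow> odd b \<Longrightarrow> chi8 (a * b) = chi8 a * chi8 b"
proof -
  assume "odd a" "odd b"
  then have "a mod 8 = 1 \<or> a mod 8 = 3 \<or> a mod 8 = 5 \<or> a mod 8 = 7"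
    "b mod 8 = 1 \<or> b mod 8 = 3 \<or> b mod 8 = 5 \<or> b mod 8 = 7" by presburger+
  moreover have "(a * b) mod 8 = ((a mod 8) * (b mod 8)) mod 8" by (simp add: mod_mult_eq)
  ultimately show ?thesis by (elim disjE) (simp_all add: chi8_def)
qed

lemma chi4_power: "odd p \<Longrightarrow> chi4 p = (-1) ^ ((p - 1) div 2)"
proof -
  assume "odd p"
  then have "p mod 4 = 1 \<or> p mod 4 = 3" by presburger
  then show ?thesis
  proof
    assume "p mod 4 = 1"
    then have "even ((p - 1) div 2)" by presburger
    then show ?thesis using \<open>p mod 4 = 1\<close> by (simp add: chi4_def)
  next
    assume "p mod 4 = 3"
    then have "odd ((p - 1) div 2)" by presburger
    then show ?thesis using \<open>p mod 4 = 3\<close> by (simp add: chi4_def)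
  qed
qed

lemma Legendre_minus_1:
  assumes "prime p" "p > 2" shows "Legendre (-1) (int p) = chi4 p"
proof (rule sign_eqI)
  have "odd p" using assms prime_odd_nat by simp
  then show "[Legendre (-1) p = chi4 p] (mod p)"
    using euler_criterion[OF assms, of "-1"] by (simp add: chi4_power)
qed (use assms Legendre_values in \<open>auto simp: chi4_def\<close>)

text \<open>By Gauss's lemma the symbol is \<open>(-1)\<^sup>k\<close>, where \<open>k\<close> counts the multiples \<open>2x\<close> with \<open>1 \<le> x \<le> h\<close> that exceed
\<open>h = (p - 1)/2\<close>; these are the \<open>x\<close> above \<open>h/2\<close>.\<close>

lemma Legendre_2:
  assumes "prime p" "p > 2" shows "Legendre 2 (int p) = chi8 p"
proof -
  have odd: "odd p" using assms prime_odd_nat by simp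
  have n0: "\<not> int p dvd 2" using assms(2) by (auto dest: zdvd_imp_le)
  interpret GAUSS p 2
    by unfold_locales (use assms n0 in \<open>auto simp: cong_0_iff\<close>)
  define h where "h = (int p - 1) div 2"
  have h: "int p = 2 * h + 1" unfolding h_def using odd by presburger
  have E: "E = (\<lambda>x. x * 2) ` {(h div 2)<..h}"
  proof -
    have "C = (\<lambda>x. x * 2) ` {0<..h}"
      unfolding C_def B_def A_def h_def[symmetric] image_image by (rule image_cong) (use h in auto)
    then show ?thesis unfolding E_def h_def[symmetric] using assms(2) h by (auto simp: image_iff)
  qed
  have "card E = card {(h div 2)<..h}" unfolding E by (rule card_image) (simp add: inj_on_def)
  then have card: "card E = nat (h - h div 2)" by simp
  have L: "Legendre 2 p = (-1) ^ nat (h - h div 2)" using gauss_lemma card by simp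
  have "p mod 8 = 1 \<or> p mod 8 = 3 \<or> p mod 8 = 5 \<or> p mod 8 = 7" using odd by presburger
  moreover have "h = int ((p - 1) div 2)" using h odd by (simp add: zdiv_int of_nat_diff)
  moreover have "nat (int k - int k div 2) = k - k div 2" for k by (simp add: zdiv_int flip: of_nat_diff)
  ultimately have L': "Legendre 2 p = (-1) ^ ((p - 1) div 2 - (p - 1) div 2 div 2)" using L by simp
  have "even ((p - 1) div 2 - (p - 1) div 2 div 2) \<longleftrightarrow> p mod 8 = 1 \<or> p mod 8 = 7" using odd by presburger
  then show ?thesis unfolding L' chi8_def by (simp add: minus_one_power_iff)
qed

text \<open>Quadratic reciprocity turns the symbol of \<open>q\<close> modulo \<open>n\<close> into this function of \<open>n\<close>, whose periodicity
is visible.\<close>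

definition chi_prime :: "nat \<Rightarrow> nat \<Rightarrow> int" where
  "chi_prime q n = (if q mod 4 = 1 then 1 else chi4 n) * Legendre (int n) (int q)"

lemma Legendre_prime:
  assumes "prime p" "p > 2" "prime q" "q > 2" "p \<noteq> q"
  shows "Legendre (int q) (int p) = chi_prime q p"
proof -
  have odd: "odd p" "odd q" using assms prime_odd_nat by simp_all
  have rec: "Legendre p q * Legendre q p = (-1::int) ^ ((p - 1) div 2 * ((q - 1) div 2))"
    by (rule Quadratic_Reciprocity[OF assms])
  have "\<not> int q dvd int p" using assms by (simp add: primes_dvd_imp_eq) (metis primes_dvd_imp_eq)
  then have v: "Legendre p q = 1 \<or> Legendre p q = -1"
    using Legendre_values[of p q] Legendre_eq_0_iff[of p q] by auto
  have "(-1::int) ^ ((p - 1) div 2 * ((q - 1) div 2)) = (if q mod 4 = 1 then 1 else chi4 p)"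
  proof (cases "q mod 4 = 1")
    case True
    then have "even ((q - 1) div 2)" by presburger
    then show ?thesis using True by simp
  next
    case False
    then have "odd ((q - 1) div 2)" using odd by presburger
    then show ?thesis using False by (simp add: chi4_power[OF odd(1)] power_mult minus_one_power_iff)
  qed
  then show ?thesis using rec v unfolding chi_prime_def by auto
qed

text \<open>The function \<open>n \<mapsto> (D/n)\<close> of Kronecker, described by its properties at the \<open>n\<close> prime to \<open>2D\<close>.  Leaving the
other values open allows the explicit functions for the prime factors of \<open>D\<close> to be multiplied.\<close>

definition quad_char :: "int \<Rightarrow> (nat \<Rightarrow> int) \<Rightarrow> bool" where
  "quad_char D g \<longleftrightarrow>
     (\<forall>a b. coprime (int a) (2 * D) \<longrightarrow> coprime (int b) (2 * D) \<longrightarrow> g (a * b) = g a * g b) \<and>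
     (\<forall>a. coprime (int a) (2 * D) \<longrightarrow> g a = 1 \<or> g a = -1) \<and>
     (\<forall>a b. [int a = int b] (mod (8 * D)) \<longrightarrow> g a = g b) \<and>
     (\<forall>p. prime p \<longrightarrow> coprime (int p) (2 * D) \<longrightarrow> g p = Legendre D (int p))"

lemma coprime_2_iff: "coprime (int a) (2 * D) \<longleftrightarrow> odd a \<and> coprime (int a) D"
  by (simp add: coprime_mult_right_iff coprime_right_2_iff_odd)

lemma prime_gt2: "prime (p :: nat) \<Longrightarrow> odd p \<Longrightarrow> p > 2"
  by (metis even_numeral le_neq_implies_less prime_ge_2_nat)

lemma cong_mod_nat: "[int a = int b] (mod D) \<Longrightarrow> int k dvd D \<Longrightarrow> a mod k = b mod k"
  by (metis cong_dvd_modulus cong_int_iff unique_euclidean_semiring_class.cong_def)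

lemma quad_char_mult:
  assumes g: "quad_char D g" and h: "quad_char E h"
  shows "quad_char (D * E) (\<lambda>n. g n * h n)"
  unfolding quad_char_def
proof (intro conjI allI impI)
  have cop: "coprime (int a) (2 * D)" "coprime (int a) (2 * E)" if "coprime (int a) (2 * (D * E))" for a
    using that by (simp_all add: coprime_2_iff coprime_mult_right_iff)
  show "g (a * b) * h (a * b) = g a * h a * (g b * h b)"
    if "coprime (int a) (2 * (D * E))" "coprime (int b) (2 * (D * E))" for a b
    using g h cop[OF that(1)] cop[OF that(2)] by (simp add: quad_char_def)
  show "g a * h a = 1 \<or> g a * h a = -1" if "coprime (int a) (2 * (D * E))" for a
  proof -
    have "g a = 1 \<or> g a = -1" "h a = 1 \<or> h a = -1" using g h cop[OF that] by (auto simp: quad_char_def)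
    then show ?thesis by auto
  qed
  show "g a * h a = g b * h b" if "[int a = int b] (mod (8 * (D * E)))" for a b
  proof -
    have "[int a = int b] (mod (8 * D))" "[int a = int b] (mod (8 * E))"
      using that by (auto intro: cong_dvd_modulus)
    then have "g a = g b" "h a = h b" using g h unfolding quad_char_def by blast+
    then show ?thesis by simp
  qed
  show "g p * h p = Legendre (D * E) (int p)" if p: "prime p" "coprime (int p) (2 * (D * E))" for p
  proof -
    have "g p = Legendre D p" "h p = Legendre E p" using g h p(1) cop[OF p(2)] unfolding quad_char_def by blast+
    moreover have "p > 2" using p prime_gt2 by (simp add: coprime_2_iff)
    ultimately show ?thesis using Legendre_mult[OF p(1)] by simp
  qed
qed

lemma quad_char_1: "quad_char 1 (\<lambda>_. 1)"
proof -
  have "Legendre 1 (int p) = 1" if "prime p" for p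
    using that unfolding Legendre_def QuadRes_def by (auto simp: cong_0_iff intro: exI[of _ 1])
  then show ?thesis by (simp add: quad_char_def)
qed

lemma quad_char_minus_1: "quad_char (-1) chi4"
  unfolding quad_char_def
proof (intro conjI allI impI)
  show "chi4 a = chi4 b" if "[int a = int b] (mod (8 * -1))" for a b
  proof -
    have "a mod 4 = b mod 4" using that by (rule cong_mod_nat) simp
    then show ?thesis by (simp add: chi4_def)
  qed
  show "chi4 p = Legendre (-1) (int p)" if "prime p" "coprime (int p) (2 * -1)" for p
    using that Legendre_minus_1[of p] prime_gt2[of p] by (simp add: coprime_2_iff)
  show "chi4 (a * b) = chi4 a * chi4 b" if "coprime (int a) (2 * -1)" "coprime (int b) (2 * -1)" for a b
    using chi4_mult that unfolding coprime_2_iff by blast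
qed (simp add: chi4_def)

lemma quad_char_2: "quad_char 2 chi8"
  unfolding quad_char_def
proof (intro conjI allI impI)
  show "chi8 a = chi8 b" if "[int a = int b] (mod (8 * 2))" for a b
  proof -
    have "a mod 8 = b mod 8" using that by (rule cong_mod_nat) simp
    then show ?thesis by (simp add: chi8_def)
  qed
  show "chi8 p = Legendre 2 (int p)" if "prime p" "coprime (int p) (2 * 2)" for p
    using Legendre_2[of p] prime_gt2[of p] that unfolding coprime_2_iff by simp
  show "chi8 (a * b) = chi8 a * chi8 b" if "coprime (int a) (2 * 2)" "coprime (int b) (2 * 2)" for a b
    using chi8_mult that unfolding coprime_2_iff by blast
qed (simp add: chi8_def)

lemma quad_char_prime:
  assumes q: "prime q" "q > 2" shows "quad_char (int q) (chi_prime q)"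
  unfolding quad_char_def
proof (intro conjI allI impI)
  show "chi_prime q (a * b) = chi_prime q a * chi_prime q b" if "coprime (int a) (2 * int q)" "coprime (int b) (2 * int q)" for a b
    using that Legendre_mult[OF q, of "int a" "int b"] by (simp add: chi_prime_def coprime_2_iff chi4_mult)
  show "chi_prime q a = 1 \<or> chi_prime q a = -1" if "coprime (int a) (2 * int q)" for a
  proof -
    have "\<not> int q dvd int a" using that q by (metis coprime_2_iff coprime_absorb_right coprime_commute not_prime_unit prime_nat_int_transfer)
    then have "Legendre (int a) (int q) = 1 \<or> Legendre (int a) (int q) = -1"
      using Legendre_values[of a q] Legendre_eq_0_iff[of a q] by auto
    then show ?thesis by (auto simp: chi_prime_def chi4_def)
  qed
  show "chi_prime q a = chi_prime q b" if "[int a = int b] (mod (8 * int q))" for a b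
  proof -
    have "a mod 4 = b mod 4" using that by (rule cong_mod_nat) (simp add: dvd_mult2)
    moreover have "[int a = int b] (mod (int q))" using that by (rule cong_dvd_modulus) simp
    ultimately show ?thesis using Legendre_cong by (simp add: chi_prime_def chi4_def)
  qed
  show "chi_prime q p = Legendre (int q) (int p)" if "prime p" "coprime (int p) (2 * int q)" for p
  proof -
    have "p \<noteq> q" using that q by (auto simp: coprime_2_iff)
    then show ?thesis using Legendre_prime[of p q] that q prime_gt2[of p] by (simp add: coprime_2_iff)
  qed
qed

lemma quad_char_exists: "D \<noteq> 0 \<Longrightarrow> \<exists>g. quad_char D g"
proof (induction D rule: prime_divisors_induct)
  case (unit x)
  then have "x = 1 \<or> x = -1" by auto
  then show ?case using quad_char_1 quad_char_minus_1 by auto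
next
  case (factor p x)
  then obtain g where g: "quad_char x g" by auto
  obtain q where q: "p = int q" using factor.hyps(1) by (metis nonneg_int_cases prime_ge_0_int)
  have pq: "prime q" using factor.hyps q by simp
  have "\<exists>h. quad_char p h"
  proof (cases "q = 2")
    case False
    then have "q > 2" using pq prime_ge_2_nat[of q] by simp
    then show ?thesis using quad_char_prime[OF pq] q by auto
  qed (use quad_char_2 q in auto)
  then show ?case using quad_char_mult g by blast
qed simp


text \<open>Completely multiplicative functions that agree at primes agree; this makes explicit formulas available for any \<open>g\<close>.\<close>

lemma quad_char_agree:
  assumes g: "quad_char D g" and h: "quad_char E h"
    and L: "\<And>p. prime p \<Longrightarrow> coprime (int p) (2 * D) \<Longrightarrow> coprime (int p) (2 * E) \<Longrightarrow> Legendre D (int p) = Legendre E (int p)"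
  shows "n > 0 \<Longrightarrow> coprime (int n) (2 * D) \<Longrightarrow> coprime (int n) (2 * E) \<Longrightarrow> g n = h n"
proof (induction n rule: prime_divisors_induct)
  case (unit n)
  have "g (1 * 1) = g 1 * g 1" "h (1 * 1) = h 1 * h 1" "g 1 = 1 \<or> g 1 = -1" "h 1 = 1 \<or> h 1 = -1"
    using g h unfolding quad_char_def by (metis coprime_1_left of_nat_1)+
  then have "g 1 = 1" "h 1 = 1" by auto
  then show ?case using unit by simp
next
  case (factor p n)
  then have "n > 0" by simp
  have c: "coprime (int p) (2 * D)" "coprime (int n) (2 * D)" "coprime (int p) (2 * E)" "coprime (int n) (2 * E)"
    using factor.prems by (simp_all add: coprime_mult_left_iff)
  have "g (p * n) = g p * g n" "h (p * n) = h p * h n" using g h c unfolding quad_char_def by blast+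
  moreover have "g p = h p" using g h c L factor.hyps(1) unfolding quad_char_def by metis
  ultimately show ?case using factor.IH \<open>n > 0\<close> c by simp
qed simp

text \<open>Squaring identifies \<open>1\<close> and \<open>q - 1\<close>, so it is not injective and hence misses a nonzero residue.\<close>

lemma nonresidue_exists:
  assumes q: "prime q" "q > 2"
  obtains r where "Legendre (int r) (int q) = -1"
proof -
  let ?A = "{1..<q}" and ?f = "\<lambda>r. r * r mod q"
  have q1: "q > 1" using q by simp
  have sub: "?f ` ?A \<subseteq> ?A"
  proof
    fix y assume "y \<in> ?f ` ?A"
    then obtain r where r: "r \<in> ?A" "y = r * r mod q" by auto
    have "\<not> q dvd r" using r by (auto dest: dvd_imp_le)
    then have "\<not> q dvd r * r" using q by (simp add: prime_dvd_mult_iff)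
    then have "y \<noteq> 0" using r by (simp add: dvd_eq_mod_eq_0)
    moreover have "y < q" using r q1 by simp
    ultimately show "y \<in> ?A" by simp
  qed
  have "?f ` ?A \<noteq> ?A"
  proof
    assume "?f ` ?A = ?A"
    then have inj: "inj_on ?f ?A" by (intro eq_card_imp_inj_on) auto
    have "?f 1 = ?f (q - 1)"
    proof -
      define k where "k = q - 3"
      have k: "q = k + 3" using q(2) by (simp add: k_def)
      have "(q - 1) * (q - 1) = 1 + q * (q - 2)" by (simp add: k algebra_simps)
      then have "?f (q - 1) = 1 mod q" by (simp only: mod_mult_self2)
      then show ?thesis by simp
    qed
    then have "1 = q - 1" by (rule inj_onD[OF inj]) (use q(2) in simp_all)
    then show False using q by simp
  qed
  then obtain r where r: "r \<in> ?A" "r \<notin> ?f ` ?A" using sub by blast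
  have nd: "\<not> int q dvd int r"
    using r(1) by (auto dest: dvd_imp_le)
  have "\<not> QuadRes (int q) (int r)"
  proof
    assume "QuadRes (int q) (int r)"
    then obtain y where y: "[y\<^sup>2 = int r] (mod int q)" by (auto simp: QuadRes_def)
    define x where "x = nat (y mod int q)"
    have x: "int x = y mod int q" using q1 by (simp add: x_def)
    have "[int (x * x) = y\<^sup>2] (mod int q)" unfolding of_nat_mult x power2_eq_square cong_def by (rule mod_mult_eq)
    then have "[int (x * x) = int r] (mod int q)" using y cong_trans by blast
    then have "[x * x = r] (mod q)" by (simp only: cong_int_iff)
    then have e: "x * x mod q = r" using r(1) by (simp add: cong_def)
    have "x < q"
    proof -
      have "int x < int q" unfolding x using q1 by simp
      then show ?thesis by simp
    qed
    moreover have "x \<noteq> 0" using e r(1) by (intro notI) simp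
    ultimately have "x \<in> ?A" by simp
    then have "r \<in> ?f ` ?A" using e by (intro image_eqI[where x = x]) simp_all
    then show False using r(2) by blast
  qed
  then have "Legendre (int r) (int q) = -1" using nd by (simp add: Legendre_def cong_0_iff)
  then show ?thesis using that by blast
qed

lemma coprime_one_mod: "[n = 1] (mod (M :: nat)) \<Longrightarrow> coprime n M"
  using cong_imp_coprime[OF cong_sym, of n 1 M] by simp

text \<open>If an odd prime \<open>q\<close> divides \<open>E\<close>, the Chinese remainder theorem gives an \<open>n\<close> that is a nonresidue modulo
\<open>q\<close> and \<open>1\<close> modulo the rest, so that only the factor of \<open>q\<close> contributes.  Otherwise \<open>E\<close> is \<open>-1\<close>, \<open>2\<close> or
\<open>-2\<close>, and the residue of \<open>n\<close> modulo \<open>8\<close> decides.\<close>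

lemma quad_char_takes_minus_1:
  assumes E: "squarefree E" "E \<noteq> 1" and g: "quad_char E g" and B: "B > 0" "8 * E dvd int B"
  obtains n where "n > 0" "coprime n B" "g n = -1"
proof -
  have E0: "E \<noteq> 0"
  proof
    assume "E = 0"
    then have "2\<^sup>2 dvd E" by simp
    then have "is_unit (2 :: int)" using E(1) unfolding squarefree_def by blast
    then show False by simp
  qed
  have copE: "coprime (int n) (2 * E)" if "coprime n B" for n
  proof -
    have "2 * E dvd 8 * E" by (rule dvdI[of _ _ 4]) simp
    then have "2 * E dvd int B" using B(2) by (rule dvd_trans)
    then show ?thesis using that by (metis coprime_divisors coprime_int_iff dvd_refl)
  qed
  show ?thesis
  proof (cases "\<exists>q. prime q \<and> q > 2 \<and> int q dvd E")
    case True
    then obtain q where "prime q" "q > 2" "int q dvd E" by blast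
    then obtain D where q: "prime q" "q > 2" "E = int q * D" by (elim dvdE)
    have D0: "D \<noteq> 0" using E0 q by auto
    have qD: "\<not> int q dvd D"
    proof
      assume "int q dvd D"
      then have "(int q)\<^sup>2 dvd E" unfolding q(3) power2_eq_square by (rule mult_dvd_mono[OF dvd_refl])
      then have "is_unit (int q)" using E(1) unfolding squarefree_def by blast
      then show False using q by simp
    qed
    obtain h where h: "quad_char D h" using quad_char_exists[OF D0] by blast
    have qh: "quad_char E (\<lambda>n. chi_prime q n * h n)" unfolding q(3) by (rule quad_char_mult[OF quad_char_prime[OF q(1,2)] h])
    obtain r where r: "Legendre (int r) (int q) = -1" by (rule nonresidue_exists[OF q(1,2)])
    obtain B1 where B1: "B = q ^ multiplicity q B * B1" "\<not> q dvd B1"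
      using multiplicity_decompose'[of B q] B(1) q(1) by (metis less_irrefl not_prime_unit)
    define M where "M = 8 * nat \<bar>D\<bar> * B1"
    have "\<not> q dvd M"
    proof -
      have "\<not> q dvd 8"
      proof
        assume "q dvd 8"
        then have "q dvd 2 ^ 3" by simp
        then have "q dvd 2" using q(1) prime_dvd_power by blast
        then show False using q by (auto dest: dvd_imp_le)
      qed
      moreover have "\<not> q dvd nat \<bar>D\<bar>" using qD by (simp add: nat_abs_dvd_iff int_dvd_int_iff flip: dvd_nat_abs_iff)
      ultimately show ?thesis using q(1) B1(2) by (simp add: M_def prime_dvd_mult_iff)
    qed
    then have "coprime M q" using q(1) by (metis coprime_commute prime_imp_coprime)
    then obtain n where n: "[n = 1] (mod M)" "[n = r] (mod q)" using binary_chinese_remainder_nat by blast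
    have nr: "[int n = int r] (mod int q)" using n(2) by (simp add: cong_int_iff)
    have Ln: "Legendre (int n) (int q) = -1" using Legendre_cong[OF nr] r by simp
    have "\<not> q dvd n" using Ln Legendre_eq_0_iff[of "int n" "int q"] by auto
    then have "coprime n q" using q(1) by (metis coprime_commute prime_imp_coprime)
    moreover have "coprime n B1" using coprime_one_mod[OF n(1)] by (simp add: M_def)
    ultimately have cB: "coprime n B" by (subst B1(1)) simp
    have n0: "n > 0" using \<open>\<not> q dvd n\<close> by (intro Nat.gr0I) auto
    have "[n = 1] (mod 4)" using n(1) by (rule cong_dvd_modulus_nat) (simp add: M_def mult.assoc dvd_mult2)
    then have "chi4 n = 1" by (simp add: chi4_def cong_def)
    then have "chi_prime q n = -1" using Ln by (simp add: chi_prime_def)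
    moreover have "h n = 1"
    proof -
      have "[int n = int 1] (mod int M)" using n(1) by (simp only: cong_int_iff)
      then have "[int n = int 1] (mod (8 * D))" by (rule cong_dvd_modulus) (simp add: M_def mult.assoc dvd_mult2)
      then have "h n = h 1" using h unfolding quad_char_def by blast
      moreover have "h (1 * 1) = h 1 * h 1" "h 1 = 1 \<or> h 1 = -1"
        using h unfolding quad_char_def by (metis coprime_1_left of_nat_1)+
      ultimately show ?thesis by auto
    qed
    moreover have "g n = chi_prime q n * h n" by (rule quad_char_agree[OF g qh refl n0 copE[OF cB] copE[OF cB]])
    ultimately show ?thesis using that n0 cB by simp
  next
    case False
    define N where "N = nat \<bar>E\<bar>"
    have NE: "int N = \<bar>E\<bar>" by (simp add: N_def)
    have only2: "p = 2" if "prime p" "p dvd N" for p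
    proof -
      have "int p dvd int N" using that(2) by (simp only: int_dvd_int_iff)
      then have "int p dvd E" unfolding NE by simp
      then have "\<not> p > 2" using False that(1) by blast
      then show ?thesis using prime_ge_2_nat[OF that(1)] by simp
    qed
    have N12: "N = 1 \<or> N = 2"
    proof (rule ccontr)
      assume n12: "\<not> ?thesis"
      then obtain p where p: "prime p" "p dvd N" using prime_factor_nat by blast
      then have "2 dvd N" using only2 by blast
      then obtain N' where N': "N = 2 * N'" by (elim dvdE)
      then obtain p' where p': "prime p'" "p' dvd N'" using n12 prime_factor_nat[of N'] by auto
      then have "p' = 2" using only2 N' by auto
      then have "2 * 2 dvd N" unfolding N' using p' by (intro mult_dvd_mono) auto
      then have "int (2 * 2) dvd int N" by (simp only: int_dvd_int_iff)
      then have "(2::int)\<^sup>2 dvd E" unfolding NE by simp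
      then have "is_unit (2 :: int)" using E(1) unfolding squarefree_def by blast
      then show False by simp
    qed
    define r :: nat where "r = (if E = -1 then 3 else 5)"
    obtain B1 where B1: "B = 2 ^ multiplicity 2 B * B1" "\<not> 2 dvd B1"
      using multiplicity_decompose'[of B 2] B(1) by (metis less_irrefl not_prime_unit two_is_prime_nat)
    have "coprime 2 B1" using B1(2) by (simp only: coprime_left_2_iff_odd not_False_eq_True)
    then have "coprime (2 * (2 * 2)) B1" by (simp only: coprime_mult_left_iff simp_thms)
    then have "coprime 8 B1" by simp
    then obtain n where n: "[n = r] (mod 8)" "[n = 1] (mod B1)" using binary_chinese_remainder_nat by blast
    have n8: "n mod 8 = r" using n(1) by (auto simp: cong_def r_def)
    then have odd: "odd n" by (auto simp: r_def split: if_splits) presburger+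
    then have "coprime n (2 ^ multiplicity 2 B)" by (simp add: coprime_right_2_iff_odd)
    then have cB: "coprime n B" using coprime_one_mod[OF n(2)] by (subst B1(1)) simp
    have n0: "n > 0" using odd by (intro Nat.gr0I) auto
    note agree = quad_char_agree[OF g _ refl n0 copE[OF cB] copE[OF cB]]
    have "E = -1 \<or> E = 2 \<or> E = -2" using N12 NE E(2) by auto
    then show ?thesis
    proof (elim disjE)
      assume e: "E = -1"
      have "n mod 4 = 3" using n8 e unfolding r_def by presburger
      then have "g n = -1" using agree[of chi4] quad_char_minus_1 e by (simp add: chi4_def)
      then show ?thesis using that n0 cB by blast
    next
      assume e: "E = 2"
      then have "g n = -1" using agree[of chi8] quad_char_2 n8 by (simp add: chi8_def r_def)
      then show ?thesis using that n0 cB by blast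
    next
      assume e: "E = -2"
      have "n mod 4 = 1" using n8 e unfolding r_def by presburger
      then have "chi4 n = 1" by (simp add: chi4_def)
      moreover have "chi8 n = -1" using n8 e by (simp add: chi8_def r_def)
      moreover have "quad_char E (\<lambda>n. chi4 n * chi8 n)" using quad_char_mult[OF quad_char_minus_1 quad_char_2] e by simp
      ultimately have "g n = -1" using agree[of "\<lambda>n. chi4 n * chi8 n"] by simp
      then show ?thesis using that n0 cB by blast
    qed
  qed
qed

text \<open>Up to a square factor \<open>D\<close> is squarefree and different from \<open>1\<close>.  The character of the squarefree part,
cut off to the \<open>n\<close> prime to \<open>B\<close>, takes the value \<open>-1\<close> at some \<open>n0\<close>.  Multiplication by \<open>n0\<close> permutes the
residues modulo \<open>B\<close> and changes the sign of the sum over them, which therefore is zero.\<close>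

lemma zero_mean_char_exists:
  assumes D: "\<And>k. D \<noteq> k\<^sup>2" and B: "B > 0" "8 * D dvd int B"
  obtains f where "zero_mean_char f" "\<And>n. \<not> coprime n B \<Longrightarrow> f n = 0"
    "\<And>p. prime p \<Longrightarrow> \<not> p dvd B \<Longrightarrow> f p = of_int (Legendre D (int p))"
proof -
  have D0: "D \<noteq> 0" using D[of 0] by simp
  define E :: int where "E = squarefree_part D"
  define k :: int where "k = square_part D"
  have DE: "D = E * k\<^sup>2" unfolding E_def k_def by (rule squarefree_decompose)
  have E: "squarefree E" unfolding E_def by (rule squarefree_squarefree_part)
  have E1: "E \<noteq> 1" using D[of k] DE by auto
  have E0: "E \<noteq> 0" using DE D0 by auto
  have "8 * E dvd 8 * D" unfolding DE by simp
  then have EB: "8 * E dvd int B" using B(2) by (rule dvd_trans)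
  obtain g where g: "quad_char E g" using quad_char_exists[OF E0] by blast
  obtain n0 where n0: "n0 > 0" "coprime n0 B" "g n0 = -1" by (rule quad_char_takes_minus_1[OF E E1 g B(1) EB])
  have "2 * E dvd 8 * E" by (rule dvdI[of _ _ 4]) simp
  then have "2 * E dvd int B" using EB by (rule dvd_trans)
  then have cop: "coprime (int n) (2 * E)" if "coprime n B" for n
    using that by (metis coprime_divisors coprime_int_iff dvd_refl)
  have g_mult: "g (a * b) = g a * g b" if "coprime a B" "coprime b B" for a b
    using g cop[OF that(1)] cop[OF that(2)] unfolding quad_char_def by blast
  have g_val: "g a = 1 \<or> g a = -1" if "coprime a B" for a
    using g cop[OF that] unfolding quad_char_def by blast
  have g_per: "g a = g b" if "[a = b] (mod B)" for a b
  proof -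
    have "[int a = int b] (mod int B)" using that by (simp add: cong_int_iff)
    then have "[int a = int b] (mod (8 * E))" using EB by (rule cong_dvd_modulus)
    then show ?thesis using g unfolding quad_char_def by blast
  qed
  define f :: "nat \<Rightarrow> real" where "f n = (if coprime n B then of_int (g n) else 0)" for n
  have f_per: "f a = f b" if "[a = b] (mod B)" for a b
    using g_per[OF that] cong_imp_coprime[OF that] cong_imp_coprime[OF cong_sym[OF that]] by (auto simp: f_def)
  have f_mult: "f (a * b) = f a * f b" for a b
    by (auto simp: f_def g_mult coprime_mult_left_iff)
  have "zero_mean_char f"
    unfolding zero_mean_char_def
  proof (intro conjI allI exI[of _ B])
    have "g (1 * 1) = g 1 * g 1" "g 1 = 1 \<or> g 1 = -1" using g_mult[of 1 1] g_val[of 1] by simp_all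
    then show "f 1 = 1" by (auto simp: f_def)
    show "f (a * b) = f a * f b" for a b by (rule f_mult)
    show "\<bar>f n\<bar> \<le> 1" for n using g_val[of n] by (auto simp: f_def)
    show "B > 0" by (rule B(1))
    show "f (n + B) = f n" for n by (rule f_per) (simp add: cong_def)
    have inj: "inj_on (\<lambda>r. n0 * r mod B) {..<B}"
    proof (rule inj_onI)
      fix x y assume xy: "x \<in> {..<B}" "y \<in> {..<B}" "n0 * x mod B = n0 * y mod B"
      then have "[n0 * x = n0 * y] (mod B)" by (simp add: cong_def)
      then have "[x = y] (mod B)" using n0(2) by (simp add: cong_mult_lcancel_nat)
      then show "x = y" using xy by (simp add: cong_def)
    qed
    have "(\<lambda>r. n0 * r mod B) ` {..<B} = {..<B}"
      by (rule endo_inj_surj[OF _ _ inj]) (use B(1) in auto)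
    then have "(\<Sum>r<B. f r) = (\<Sum>r\<in>(\<lambda>r. n0 * r mod B) ` {..<B}. f r)" by simp
    also have "\<dots> = (\<Sum>r<B. f (n0 * r mod B))" by (simp add: sum.reindex[OF inj] o_def)
    also have "\<dots> = (\<Sum>r<B. - f r)"
    proof (rule sum.cong[OF refl])
      fix r
      have "f (n0 * r mod B) = f (n0 * r)" by (rule f_per) (simp add: cong_def)
      also have "\<dots> = - f r" using n0 by (simp add: f_mult) (simp add: f_def)
      finally show "f (n0 * r mod B) = - f r" .
    qed
    finally show "(\<Sum>r<B. f r) = 0" by (simp add: sum_negf)
  qed
  moreover have "f n = 0" if "\<not> coprime n B" for n using that by (simp add: f_def)
  moreover have "f p = of_int (Legendre D (int p))" if p: "prime p" "\<not> p dvd B" for p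
  proof -
    have cB: "coprime p B" using p by (simp add: prime_imp_coprime)
    have "p > 2" using p(1) cop[OF cB] prime_gt2 by (simp add: coprime_2_iff)
    have pk: "\<not> int p dvd k"
    proof
      assume "int p dvd k"
      then have "int p dvd 8 * D" unfolding DE by (simp add: power2_eq_square)
      then have "int p dvd int B" using B(2) dvd_trans by blast
      then show False using p(2) by (simp only: int_dvd_int_iff)
    qed
    have "Legendre (k\<^sup>2) (int p) = Legendre k p * Legendre k p"
      using Legendre_mult[OF p(1) \<open>p > 2\<close>] by (simp add: power2_eq_square)
    also have "\<dots> = 1" using Legendre_values[of k p] Legendre_eq_0_iff[of k p] pk by auto
    finally have "Legendre D (int p) = Legendre E (int p)"
      unfolding DE using Legendre_mult[OF p(1) \<open>p > 2\<close>] by simp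
    then show ?thesis using g p(1) cop[OF cB] cB unfolding quad_char_def f_def by auto
  qed
  ultimately show ?thesis using that by blast
qed

section \<open>Primes that divide no solution\<close>

lemma two_not_square: "2 \<noteq> (k :: int)\<^sup>2"
proof
  assume k: "2 = k\<^sup>2"
  then have "even (k\<^sup>2)" by presburger
  then have "2 * 2 dvd k * k" by (intro mult_dvd_mono) simp_all
  then show False using k by (simp add: power2_eq_square)
qed

text \<open>If only finitely many primes had these symbols, they could be absorbed into \<open>B\<close> together with the
primes dividing \<open>2cm\<close> and those up to \<open>m\<close>.  With \<open>x\<close>, \<open>y\<close>, \<open>z\<close> for the symbols of \<open>2\<close>, \<open>c\<close>, \<open>-m\<close> at another
prime, the four numbers \<open>x\<close>, \<open>y\<close>, \<open>xz\<close>, \<open>yz\<close> have product \<open>1\<close>, and they are all \<open>-1\<close> only for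
\<open>x = y = -1\<close>, \<open>z = 1\<close>, which is excluded.  The four characters exist because \<open>2\<close>, \<open>c\<close> and the negative
numbers \<open>-2m\<close>, \<open>-cm\<close> are not squares.\<close>

lemma infinitely_many_primes_with_symbols:
  assumes m: "m > 0" and c: "c > 0" "\<And>k. c \<noteq> k\<^sup>2"
  shows "infinite {p. split_prime m p \<and> int p > m \<and> Legendre 2 (int p) = -1 \<and> Legendre c (int p) = -1}"
    (is "infinite ?T")
proof
  assume fin: "finite ?T"
  define B where "B = 8 * nat (2 * c * m) * fact (nat m) * \<Prod>?T"
  have T0: "p > 0" if "p \<in> ?T" for p using that by (auto simp: split_prime_def prime_gt_0_nat)
  have cm: "2 * c * m > 0" using m c by simp
  have B0: "B > 0" unfolding B_def using fin T0 cm by (auto intro!: prod_pos)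
  have intB: "int B = 8 * (2 * c * m) * (fact (nat m) * int (\<Prod>?T))"
    using cm by (simp add: B_def)
  have neg: "D \<noteq> k\<^sup>2" if "D < 0" for D k :: int using that zero_le_power2[of k] by linarith
  have d: "8 * D dvd int B" if "D dvd 2 * c * m" for D
    unfolding intB by (rule dvd_mult2[OF mult_dvd_mono[OF dvd_refl that]])
  obtain f1 where f1: "zero_mean_char f1" "\<And>n. \<not> coprime n B \<Longrightarrow> f1 n = 0"
    "\<And>p. prime p \<Longrightarrow> \<not> p dvd B \<Longrightarrow> f1 p = of_int (Legendre 2 (int p))"
    by (rule zero_mean_char_exists[OF two_not_square B0 d]) simp_all
  obtain f2 where f2: "zero_mean_char f2" "\<And>n. \<not> coprime n B \<Longrightarrow> f2 n = 0"
    "\<And>p. prime p \<Longrightarrow> \<not> p dvd B \<Longrightarrow> f2 p = of_int (Legendre c (int p))"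
    by (rule zero_mean_char_exists[OF c(2) B0 d]) simp_all
  obtain f3 where f3: "zero_mean_char f3" "\<And>n. \<not> coprime n B \<Longrightarrow> f3 n = 0"
    "\<And>p. prime p \<Longrightarrow> \<not> p dvd B \<Longrightarrow> f3 p = of_int (Legendre (2 * (- m)) (int p))"
  proof (rule zero_mean_char_exists[OF neg B0 d])
    show "2 * (- m) < 0" using m by simp
    show "2 * (- m) dvd 2 * c * m" by simp
  qed blast
  obtain f4 where f4: "zero_mean_char f4" "\<And>n. \<not> coprime n B \<Longrightarrow> f4 n = 0"
    "\<And>p. prime p \<Longrightarrow> \<not> p dvd B \<Longrightarrow> f4 p = of_int (Legendre (c * (- m)) (int p))"
  proof (rule zero_mean_char_exists[OF neg B0 d])
    show "c * (- m) < 0" using m c by simp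
    show "c * (- m) dvd 2 * c * m" by simp
  qed blast
  show False
  proof (rule four_characters_impossible[OF f1(1) f2(1) f3(1) f4(1) B0])
    fix p :: nat assume p: "prime p" "p dvd B"
    have "\<not> coprime p B" using p by (metis coprime_absorb_left not_prime_unit)
    then show "f1 p = 0 \<and> f2 p = 0 \<and> f3 p = 0 \<and> f4 p = 0" using f1(2) f2(2) f3(2) f4(2) by blast
  next
    fix p :: nat assume p: "prime p" "\<not> p dvd B"
    have nd: "\<not> int p dvd 2 * c * m"
    proof
      assume "int p dvd 2 * c * m"
      then have "int p dvd int B" unfolding intB by (rule dvd_mult2[OF dvd_mult])
      then show False using p(2) by (simp only: int_dvd_int_iff)
    qed
    then have nd': "\<not> int p dvd 2" "\<not> int p dvd c" "\<not> int p dvd m" by auto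
    have p2: "p > 2"
    proof -
      have "p \<noteq> 2" using nd'(1) by auto
      then show ?thesis using prime_ge_2_nat[OF p(1)] by simp
    qed
    define x y z where "x = Legendre 2 (int p)" and "y = Legendre c (int p)" and "z = Legendre (-m) (int p)"
    have pm: "w = 1 \<or> w = -1" if "w = Legendre a (int p)" "\<not> int p dvd a" for w a
      using Legendre_values[of a p] Legendre_eq_0_iff[of a p] that by auto
    have x: "x = 1 \<or> x = -1" and y: "y = 1 \<or> y = -1" and z: "z = 1 \<or> z = -1"
      using pm[OF x_def] pm[OF y_def] pm[OF z_def] nd' by simp_all
    have f: "f1 p = of_int x" "f2 p = of_int y" "f3 p = of_int (x * z)" "f4 p = of_int (y * z)"
      using f1(3)[OF p] f2(3)[OF p] f3(3)[OF p] f4(3)[OF p]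
      unfolding Legendre_mult[OF p(1) p2] x_def y_def z_def by simp_all
    have "\<not> (x = -1 \<and> y = -1 \<and> z = 1)"
    proof
      assume xyz: "x = -1 \<and> y = -1 \<and> z = 1"
      then have "QuadRes (int p) (-m)" unfolding z_def Legendre_def by (auto split: if_splits)
      then obtain t where "[t\<^sup>2 = - m] (mod int p)" by (auto simp: QuadRes_def)
      then have "int p dvd t\<^sup>2 + m" by (simp add: cong_iff_dvd_diff)
      moreover have "odd p" using p(1) p2 prime_odd_nat by simp
      ultimately have sp: "split_prime m p" using p(1) nd'(3) by (auto simp: split_prime_def)
      have "int p > m"
      proof (rule ccontr)
        assume "\<not> int p > m"
        then have "p dvd fact (nat m)" using prime_gt_0_nat[OF p(1)] by (intro dvd_fact) auto
        then have "p dvd B" unfolding B_def by (rule dvd_mult2[OF dvd_mult])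
        then show False using p(2) by blast
      qed
      then have "p \<in> ?T" using sp xyz by (simp add: x_def y_def)
      then have "p dvd \<Prod>?T" using fin by (rule dvd_prodI[rotated, of _ _ "\<lambda>x. x", simplified])
      then have "p dvd B" unfolding B_def by (rule dvd_mult)
      then show False using p(2) by blast
    qed
    then show "{f1 p, f2 p, f3 p, f4 p} \<subseteq> {1, -1} \<and> f1 p * f2 p * f3 p * f4 p = 1 \<and>
        (f1 p = 1 \<or> f2 p = 1 \<or> f3 p = 1 \<or> f4 p = 1)"
      unfolding f using x y z by (elim disjE) simp_all
  qed
qed

text \<open>Each alternative for \<open>u\<close> makes \<open>2\<close> or \<open>c\<close> a square modulo any prime divisor of \<open>u\<close>.  So the primes modulo
which both are nonresidues divide no \<open>u\<close>, and their functionals vanish on \<open>P\<^sub>m\<close>.\<close>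

lemma rank_infinite_if_nonsquare:
  assumes m: "m > 0" and c: "c > 0" "\<And>k. c \<noteq> k\<^sup>2"
    and sol: "\<And>u v. u > 0 \<Longrightarrow> u\<^sup>2 - m * v\<^sup>2 = 1 \<Longrightarrow> (\<exists>w. u = 2 * w\<^sup>2 - 1) \<or> (\<exists>w. (u + 1) * c = w\<^sup>2)"
  shows "group_rank (G_group m Mod P_subgroup m) = \<infinity>"
proof -
  define T where "T = {p. split_prime m p \<and> int p > m \<and> Legendre 2 (int p) = -1 \<and> Legendre c (int p) = -1}"
  have nonres: "\<not> QuadRes (int p) a" if "Legendre a (int p) = -1" for a p
    using that by (auto simp: Legendre_def split: if_splits)
  have never: "ord_diff m p 1 v = 0" if p: "p \<in> T" and uv: "u > 0" "u\<^sup>2 - m * v\<^sup>2 = 1" for p u v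
  proof (rule ord_diff_eq_0[OF m])
    have pI: "prime (int p)" using p by (simp add: T_def split_prime_def)
    have L: "\<not> QuadRes (int p) 2" "\<not> QuadRes (int p) c" using nonres p by (auto simp: T_def)
    have "\<not> int p dvd u"
    proof
      assume u: "int p dvd u"
      from sol[OF uv] show False
      proof
        assume "\<exists>w. u = 2 * w\<^sup>2 - 1"
        then obtain w where w: "u = 2 * w\<^sup>2 - 1" by blast
        have "(2 * w)\<^sup>2 - 2 = 2 * u" by (simp add: w power2_eq_square)
        then have "int p dvd (2 * w)\<^sup>2 - 2" using u by simp
        then have "[(2 * w)\<^sup>2 = 2] (mod int p)" by (simp add: cong_iff_dvd_diff)
        then show False using L(1) unfolding QuadRes_def by blast
      next
        assume "\<exists>w. (u + 1) * c = w\<^sup>2"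
        then obtain w where w: "(u + 1) * c = w\<^sup>2" by blast
        have "w\<^sup>2 - c = u * c" unfolding w[symmetric] by (simp add: algebra_simps)
        then have "int p dvd w\<^sup>2 - c" using u by simp
        then have "[w\<^sup>2 = c] (mod int p)" by (simp add: cong_iff_dvd_diff)
        then show False using L(2) unfolding QuadRes_def by blast
      qed
    qed
    then have "\<not> int p dvd u\<^sup>2" using pI by (simp add: prime_dvd_power_iff)
    then show "\<not> int p dvd 1\<^sup>2 + m * v\<^sup>2" using uv(2) by (simp add: algebra_simps)
  qed
  show ?thesis
  proof (rule rank_criterion[OF m, where Q = T and V = "{f. \<forall>p\<in>T. f p = 0}"])
    show "infinite T" unfolding T_def by (rule infinitely_many_primes_with_symbols[OF m c])
  qed (use never in \<open>auto simp: T_def\<close>)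
qed

section \<open>Powers of the fundamental solution of Pell's equation\<close>

locale pell =
  fixes m x1 y1 :: int
  assumes m_pos: "m > 0" and x1_pos: "x1 > 0" and y1_pos: "y1 > 0"
    and fund: "x1\<^sup>2 - m * y1\<^sup>2 = 1"
begin

text \<open>The pair \<open>sol n\<close> consists of the coordinates of \<open>(x1 + y1\<surd>m)\<^sup>n\<close>.\<close>

primrec sol :: "nat \<Rightarrow> int \<times> int" where
  "sol 0 = (1, 0)"
| "sol (Suc n) = (x1 * fst (sol n) + m * y1 * snd (sol n), x1 * snd (sol n) + y1 * fst (sol n))"

definition sol_x :: "nat \<Rightarrow> int" where "sol_x n = fst (sol n)"
definition sol_y :: "nat \<Rightarrow> int" where "sol_y n = snd (sol n)"

lemma sol_0 [simp]: "sol_x 0 = 1" "sol_y 0 = 0" by (simp_all add: sol_x_def sol_y_def)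
lemma sol_x_Suc: "sol_x (Suc n) = x1 * sol_x n + m * y1 * sol_y n" by (simp add: sol_x_def sol_y_def)
lemma sol_y_Suc: "sol_y (Suc n) = x1 * sol_y n + y1 * sol_x n" by (simp add: sol_x_def sol_y_def)
lemma sol_1 [simp]: "sol_x (Suc 0) = x1" "sol_y (Suc 0) = y1" by (simp_all add: sol_x_Suc sol_y_Suc)

lemma sol_add: "sol_x (a + b) = sol_x a * sol_x b + m * sol_y a * sol_y b" "sol_y (a + b) = sol_x a * sol_y b + sol_y a * sol_x b"
proof -
  have "sol_x (a + b) = sol_x a * sol_x b + m * sol_y a * sol_y b \<and> sol_y (a + b) = sol_x a * sol_y b + sol_y a * sol_x b"
    by (induction a) (auto simp: sol_x_Suc sol_y_Suc algebra_simps)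
  then show "sol_x (a + b) = sol_x a * sol_x b + m * sol_y a * sol_y b" "sol_y (a + b) = sol_x a * sol_y b + sol_y a * sol_x b" by auto
qed

lemma sol_norm: "(sol_x n)\<^sup>2 - m * (sol_y n)\<^sup>2 = 1"
proof (induction n)
  case (Suc n)
  have "(sol_x (Suc n))\<^sup>2 - m * (sol_y (Suc n))\<^sup>2 = (x1\<^sup>2 - m * y1\<^sup>2) * ((sol_x n)\<^sup>2 - m * (sol_y n)\<^sup>2)"
    unfolding sol_x_Suc sol_y_Suc by (simp add: power2_eq_square algebra_simps)
  then show ?case using Suc fund by simp
qed simp

lemma m_sol_y_squared: "m * sol_y n * sol_y n = sol_x n * sol_x n - 1"
  using sol_norm[of n] by (simp add: power2_eq_square algebra_simps)

lemma x1_ge2: "x1 \<ge> 2"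
proof (rule ccontr)
  assume "\<not> ?thesis"
  then have "x1 = 1" using x1_pos by linarith
  then have "m * y1\<^sup>2 = 0" using fund by simp
  then show False using m_pos y1_pos by simp
qed

lemma sol_pos: "sol_x n \<ge> 1" "sol_y n \<ge> 0"
proof -
  have "sol_x n \<ge> 1 \<and> sol_y n \<ge> 0"
  proof (induction n)
    case (Suc n)
    have "x1 * sol_x n \<ge> 1 * 1" using Suc x1_pos by (intro mult_mono) auto
    moreover have "m * y1 * sol_y n \<ge> 0" "x1 * sol_y n \<ge> 0" "y1 * sol_x n \<ge> 0"
      using Suc x1_pos m_pos y1_pos by auto
    ultimately show ?case by (auto simp: sol_x_Suc sol_y_Suc)
  qed simp
  then show "sol_x n \<ge> 1" "sol_y n \<ge> 0" by auto
qed

lemma sol_x_mult_le: "sol_x a * sol_x b \<le> sol_x (a + b)"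
  using sol_pos[of a] sol_pos[of b] m_pos by (simp add: sol_add)

lemma sol_x_ge_pow2: "sol_x n \<ge> 2 ^ n"
proof (induction n)
  case (Suc n)
  have "2 * 2 ^ n \<le> x1 * sol_x n" using Suc x1_ge2 by (intro mult_mono) auto
  also have "\<dots> \<le> sol_x (Suc n)" using sol_x_mult_le[of 1 n] by simp
  finally show ?case by simp
qed simp

lemma sol_x_prod_le: "finite S \<Longrightarrow> (\<Prod>q\<in>S. sol_x (f q)) \<le> sol_x (\<Sum>q\<in>S. f q)"
proof (induction S rule: finite_induct)
  case (insert q S)
  have "(\<Prod>q\<in>insert q S. sol_x (f q)) \<le> sol_x (f q) * sol_x (\<Sum>q\<in>S. f q)"
    using insert sol_pos(1)[of "f q"] by (simp add: mult_left_mono)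
  also have "\<dots> \<le> sol_x (f q + (\<Sum>q\<in>S. f q))" by (rule sol_x_mult_le)
  finally show ?case using insert by simp
qed simp

lemma sol_double: "sol_x (2 * n) = 2 * (sol_x n)\<^sup>2 - 1" "sol_y (2 * n) = 2 * sol_x n * sol_y n"
proof -
  have n2: "2 * n = n + n" by simp
  show "sol_x (2 * n) = 2 * (sol_x n)\<^sup>2 - 1" unfolding n2 sol_add m_sol_y_squared by (simp add: power2_eq_square)
  show "sol_y (2 * n) = 2 * sol_x n * sol_y n" unfolding n2 sol_add by simp
qed

lemma sol_x_triple: "sol_x (3 * n) = 4 * sol_x n ^ 3 - 3 * sol_x n"
proof -
  have "sol_x (3 * n) = sol_x (2 * n) * sol_x n + m * sol_y (2 * n) * sol_y n"
    using sol_add(1)[of "2 * n" n] by (simp add: algebra_simps)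
  also have "m * sol_y (2 * n) * sol_y n = 2 * sol_x n * (m * sol_y n * sol_y n)" by (simp add: sol_double)
  also have "sol_x (2 * n) * sol_x n + 2 * sol_x n * (m * sol_y n * sol_y n) = 4 * sol_x n ^ 3 - 3 * sol_x n"
    unfolding m_sol_y_squared sol_double by (simp add: power2_eq_square power3_eq_cube algebra_simps)
  finally show ?thesis .
qed

lemma sol_x_odd: "(sol_x (2 * k + 1) + 1) * (x1 + 1) = (sol_x (k + 1) + sol_x k)\<^sup>2"
proof -
  have "sol_x (2 * k + 1) = sol_x k * sol_x (k + 1) + m * sol_y k * sol_y (k + 1)"
    using sol_add(1)[of k "k + 1"] by (simp flip: mult_2)
  then have e: "sol_x (2 * k + 1) = sol_x k * (x1 * sol_x k + m * y1 * sol_y k) + m * sol_y k * (x1 * sol_y k + y1 * sol_x k)"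
    by (simp add: sol_x_Suc sol_y_Suc)
  define a b where "a = sol_x k" and "b = sol_y k"
  have ab: "m * b * b = a * a - 1" using m_sol_y_squared[of k] by (simp add: a_def b_def)
  have f: "m * y1 * y1 = x1 * x1 - 1" using fund by (simp add: power2_eq_square)
  have "(x1 * a + m * y1 * b + a)\<^sup>2 = (x1 + 1) * ((x1 + 1) * a * a + 2 * m * y1 * a * b) + (m * y1 * y1) * (m * b * b)"
    by (simp add: power2_eq_square algebra_simps)
  also have "\<dots> = (x1 * a * a + 2 * m * y1 * a * b + x1 * (m * b * b) + 1) * (x1 + 1)"
    unfolding ab f by (simp add: algebra_simps)
  also have "\<dots> = (a * (x1 * a + m * y1 * b) + m * b * (x1 * b + y1 * a) + 1) * (x1 + 1)"
    by (simp add: algebra_simps)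
  finally have "(sol_x k * (x1 * sol_x k + m * y1 * sol_y k) + m * sol_y k * (x1 * sol_y k + y1 * sol_x k) + 1) * (x1 + 1)
      = (x1 * sol_x k + m * y1 * sol_y k + sol_x k)\<^sup>2" by (simp add: a_def b_def)
  then show ?thesis using e by (simp add: sol_x_Suc)
qed

lemma sol_x_step2: "sol_x (n + 2 * d) - sol_x n = 2 * m * sol_y (n + d) * sol_y d"
proof -
  have "sol_x (n + 2 * d) = sol_x n * sol_x (2 * d) + m * sol_y n * sol_y (2 * d)" by (rule sol_add)
  also have "\<dots> - sol_x n = 2 * sol_x n * (sol_x d * sol_x d - 1) + 2 * m * sol_y n * sol_x d * sol_y d"
    unfolding sol_double by (simp add: power2_eq_square algebra_simps)
  also have "\<dots> = 2 * m * sol_y (n + d) * sol_y d"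
    unfolding m_sol_y_squared[symmetric] sol_add(2)[of n d] by (simp add: algebra_simps)
  finally show ?thesis .
qed

text \<open>Dividing a solution by the fundamental one gives a solution with a smaller second coordinate.\<close>

lemma sol_complete:
  assumes least: "\<And>u v. u > 0 \<Longrightarrow> v > 0 \<Longrightarrow> u\<^sup>2 - m * v\<^sup>2 = 1 \<Longrightarrow> y1 \<le> v"
  shows "u > 0 \<Longrightarrow> v \<ge> 0 \<Longrightarrow> u\<^sup>2 - m * v\<^sup>2 = 1 \<Longrightarrow> \<exists>n. u = sol_x n \<and> v = sol_y n"
proof (induction "nat v" arbitrary: u v rule: less_induct)
  case less
  show ?case
  proof (cases "v = 0")
    case True
    then have "u = 1" using less.prems by (simp add: power2_eq_1_iff)
    then show ?thesis using True by (intro exI[of _ 0]) simp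
  next
    case False
    then have v: "v > 0" using less.prems by simp
    then have yv: "y1 \<le> v" using least less.prems by blast
    have sq: "x1\<^sup>2 = 1 + m * y1\<^sup>2" "u\<^sup>2 = 1 + m * v\<^sup>2" using fund less.prems(3) by auto
    define u' v' where "u' = u * x1 - m * v * y1" and "v' = v * x1 - u * y1"
    have n': "u'\<^sup>2 - m * v'\<^sup>2 = 1"
    proof -
      have "u'\<^sup>2 - m * v'\<^sup>2 = (x1\<^sup>2 - m * y1\<^sup>2) * (u\<^sup>2 - m * v\<^sup>2)"
        unfolding u'_def v'_def by (simp add: power2_eq_square algebra_simps)
      then show ?thesis using fund less.prems by simp
    qed
    have "(u * y1)\<^sup>2 \<le> (v * x1)\<^sup>2"
    proof -
      have "(v * x1)\<^sup>2 - (u * y1)\<^sup>2 = v\<^sup>2 - y1\<^sup>2"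
        unfolding power_mult_distrib sq by (simp add: algebra_simps)
      moreover have "y1\<^sup>2 \<le> v\<^sup>2" using yv y1_pos by (intro power_mono) auto
      ultimately show ?thesis by linarith
    qed
    then have "u * y1 \<le> v * x1" by (rule power2_le_imp_le) (use v x1_pos in simp)
    then have v'0: "v' \<ge> 0" by (simp add: v'_def)
    have "(v * (x1 - 1))\<^sup>2 < (u * y1)\<^sup>2"
    proof -
      have "(u * y1)\<^sup>2 - (v * (x1 - 1))\<^sup>2 = y1\<^sup>2 + 2 * v\<^sup>2 * (x1 - 1)"
        unfolding power_mult_distrib power2_diff sq by (simp add: algebra_simps)
      moreover have "y1\<^sup>2 > 0" "2 * v\<^sup>2 * (x1 - 1) \<ge> 0" using y1_pos x1_pos by auto
      ultimately show ?thesis by linarith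
    qed
    then have "v * (x1 - 1) < u * y1" by (rule power2_less_imp_less) (use less.prems y1_pos in simp)
    then have v'v: "v' < v" by (simp add: v'_def algebra_simps)
    have "(m * v * y1)\<^sup>2 < (u * x1)\<^sup>2"
    proof -
      have "(u * x1)\<^sup>2 - (m * v * y1)\<^sup>2 = 1 + m * y1\<^sup>2 + m * v\<^sup>2"
        unfolding power_mult_distrib sq by (simp add: algebra_simps power2_eq_square)
      moreover have "m * y1\<^sup>2 \<ge> 0" "m * v\<^sup>2 \<ge> 0" using m_pos by auto
      ultimately show ?thesis by linarith
    qed
    then have "m * v * y1 < u * x1" by (rule power2_less_imp_less) (use less.prems x1_pos in simp)
    then have u'0: "u' > 0" by (simp add: u'_def)
    obtain n where n: "u' = sol_x n" "v' = sol_y n"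
      using less.hyps[of v' u'] v'v v'0 u'0 n' v by auto
    have "x1 * u' + m * y1 * v' = u * (x1\<^sup>2 - m * y1\<^sup>2)" "x1 * v' + y1 * u' = v * (x1\<^sup>2 - m * y1\<^sup>2)"
      unfolding u'_def v'_def by (simp_all add: algebra_simps power2_eq_square)
    then have "u = x1 * u' + m * y1 * v'" "v = x1 * v' + y1 * u'" using fund by simp_all
    then show ?thesis using n by (intro exI[of _ "Suc n"]) (simp add: sol_x_Suc sol_y_Suc)
  qed
qed


text \<open>The index \<open>r\<close> is the rank of apparition of \<open>p\<close> in the sequence \<open>sol_x\<close>.\<close>

definition has_rank :: "nat \<Rightarrow> nat \<Rightarrow> bool" where
  "has_rank p r \<longleftrightarrow> int p dvd sol_x r \<and> (\<forall>n<r. \<not> int p dvd sol_x n)"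

text \<open>Modulo the square of \<open>sol_x r\<close>, the solutions at the odd multiples of \<open>r\<close> have this simple form.  The
first equation controls multiplicities of primes, the second the sign of \<open>ord_diff\<close>.\<close>

lemma sol_odd_multiple:
  obtains z w where
    "sol_x (r * (2 * i + 1)) = sol_x r * ((-1) ^ i * (2 * int i + 1) + (sol_x r)\<^sup>2 * z)"
    "sol_y (r * (2 * i + 1)) = sol_y r * ((-1) ^ i + (sol_x r)\<^sup>2 * w)"
proof -
  have "\<exists>z w. sol_x (r * (2 * i + 1)) = sol_x r * ((-1) ^ i * (2 * int i + 1) + (sol_x r)\<^sup>2 * z) \<and>
    sol_y (r * (2 * i + 1)) = sol_y r * ((-1) ^ i + (sol_x r)\<^sup>2 * w)"
  proof (induction i)
    case 0
    then show ?case by (auto intro!: exI[of _ 0])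
  next
    case (Suc i)
    then obtain z w where zw:
      "sol_x (r * (2 * i + 1)) = sol_x r * ((-1) ^ i * (2 * int i + 1) + (sol_x r)\<^sup>2 * z)"
      "sol_y (r * (2 * i + 1)) = sol_y r * ((-1) ^ i + (sol_x r)\<^sup>2 * w)" by blast
    define s :: int where "s = (-1) ^ i"
    define x y j where "x = sol_x r" and "y = sol_y r" and "j = int i"
    have xy: "x\<^sup>2 - m * y\<^sup>2 = 1" using sol_norm by (simp add: x_def y_def)
    have e: "r * (2 * Suc i + 1) = r * (2 * i + 1) + 2 * r" by simp
    have "sol_x (r * (2 * Suc i + 1)) = x * (s * (2 * j + 1) + x\<^sup>2 * z) * (2 * x\<^sup>2 - 1)
        + m * (y * (s + x\<^sup>2 * w)) * (2 * x * y)"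
      unfolding e sol_add(1) zw sol_double by (simp add: x_def y_def s_def j_def)
    also have "m * (y * (s + x\<^sup>2 * w)) * (2 * x * y) = 2 * x * (m * y\<^sup>2) * (s + x\<^sup>2 * w)"
      by (simp add: power2_eq_square algebra_simps)
    also have "m * y\<^sup>2 = x\<^sup>2 - 1" using xy by simp
    also have "x * (s * (2 * j + 1) + x\<^sup>2 * z) * (2 * x\<^sup>2 - 1) + 2 * x * (x\<^sup>2 - 1) * (s + x\<^sup>2 * w)
      = x * (- s * (2 * (j + 1) + 1) + x\<^sup>2 *
        (2 * s * (2 * j + 1) + 2 * x\<^sup>2 * z - z + 2 * s + 2 * x\<^sup>2 * w - 2 * w))"
      by (simp add: algebra_simps)
    finally have A: "sol_x (r * (2 * Suc i + 1)) = \<dots>" .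
    have "sol_y (r * (2 * Suc i + 1)) = x * (s * (2 * j + 1) + x\<^sup>2 * z) * (2 * x * y)
        + y * (s + x\<^sup>2 * w) * (2 * x\<^sup>2 - 1)"
      unfolding e sol_add(2) zw sol_double by (simp add: x_def y_def s_def j_def)
    also have "\<dots> = y * (- s + x\<^sup>2 * (2 * s + 2 * x\<^sup>2 * w - w + 2 * (s * (2 * j + 1) + x\<^sup>2 * z)))"
      by (simp add: algebra_simps power2_eq_square)
    finally have B: "sol_y (r * (2 * Suc i + 1)) = \<dots>" .
    have s': "(-1) ^ Suc i = - s" by (simp add: s_def)
    have j': "int (Suc i) = j + 1" by (simp add: j_def)
    show ?case unfolding s' j' using A B unfolding x_def[symmetric] y_def[symmetric] by blast
  qed
  then show ?thesis using that by blast
qed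

lemma sol_x_dvd_odd_multiple: "sol_x r dvd sol_x (r * (2 * i + 1))"
  using sol_odd_multiple[of r i] by (metis dvd_triv_left)

lemma prime_dvd_sol_x:
  assumes "prime p" and "int p dvd sol_x n" shows "\<not> int p dvd sol_y n" "\<not> int p dvd m"
proof -
  have "\<not> int p dvd m * sol_y n * sol_y n"
  proof
    assume "int p dvd m * sol_y n * sol_y n"
    then have "int p dvd sol_x n * sol_x n - 1" by (simp only: m_sol_y_squared)
    then have "int p dvd 1" using assms(2) by (metis dvd_diff_right_iff dvd_mult2)
    then show False using assms(1) by auto
  qed
  then show "\<not> int p dvd sol_y n" "\<not> int p dvd m" by auto
qed

text \<open>Modulo \<open>p\<close> the index may be lowered by \<open>2r\<close> or reflected to \<open>2r - n\<close>, which ends at \<open>r\<close> or below it.\<close>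

lemma rank_dvd:
  assumes p: "prime p" and r: "has_rank p r"
  shows "int p dvd sol_x n \<Longrightarrow> \<exists>i. n = r * (2 * i + 1)"
proof (induction n rule: less_induct)
  case (less n)
  have pr: "int p dvd sol_x r" and min: "\<And>k. k < r \<Longrightarrow> \<not> int p dvd sol_x k"
    using r by (auto simp: has_rank_def)
  have pI: "prime (int p)" using p by simp
  have Y2r: "int p dvd sol_y (2 * r)" using pr by (simp add: sol_double)
  consider "n < r" | "n = r" | "r < n" "n < 2 * r" | "2 * r \<le> n" by linarith
  then show ?case
  proof cases
    case 1
    then show ?thesis using min less.prems by blast
  next
    case 2
    then show ?thesis by (intro exI[of _ 0]) simp
  next
    case 3
    define a where "a = 2 * r - n"
    have "sol_y (2 * r) = sol_x a * sol_y n + sol_y a * sol_x n" using sol_add(2)[of a n] 3 by (simp add: a_def)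
    then have "int p dvd sol_x a * sol_y n" using Y2r less.prems by (metis dvd_add_left_iff dvd_mult)
    then have "int p dvd sol_x a" using prime_dvd_sol_x[OF p less.prems] pI by (simp add: prime_dvd_mult_iff)
    moreover have "a < r" using 3 by (simp add: a_def)
    ultimately show ?thesis using min by blast
  next
    case 4
    have "n - 2 * r + 2 * r = n" using 4 by simp
    then have "sol_x n = sol_x (n - 2 * r) * sol_x (2 * r) + m * sol_y (n - 2 * r) * sol_y (2 * r)"
      using sol_add(1)[of "n - 2 * r" "2 * r"] by simp
    then have "int p dvd sol_x (n - 2 * r) * sol_x (2 * r)" using Y2r less.prems by (metis dvd_add_left_iff dvd_mult)
    moreover have "\<not> int p dvd sol_x (2 * r)"
    proof
      assume "int p dvd sol_x (2 * r)"
      then show False using prime_dvd_sol_x(1)[OF p, of "2 * r"] Y2r by blast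
    qed
    ultimately have "int p dvd sol_x (n - 2 * r)" using pI by (simp add: prime_dvd_mult_iff)
    moreover have "r > 0" using pr p by (cases r) auto
    ultimately obtain i where "n - 2 * r = r * (2 * i + 1)" using less.IH[of "n - 2 * r"] 4 by auto
    then have "n = r * (2 * Suc i + 1)" using 4 by simp
    then show ?thesis by blast
  qed
qed

text \<open>The residues of \<open>sol_x (2 * i)\<close> modulo \<open>p\<close> are distinct for \<open>0 \<le> i \<le> r\<close>: their differences are products
of values \<open>sol_y k\<close> with \<open>0 < k < 2r\<close>, and \<open>p\<close> divides none of these.\<close>

lemma rank_less:
  assumes p: "prime p" "odd p" and r: "has_rank p r"
  shows "r < p"
proof -
  have pI: "prime (int p)" using p by simp
  have pr: "int p dvd sol_x r" and min: "\<And>k. k < r \<Longrightarrow> \<not> int p dvd sol_x k"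
    using r by (auto simp: has_rank_def)
  have Yk: "\<not> int p dvd sol_y k" if k: "0 < k" "k < 2 * r" for k
  proof
    assume d: "int p dvd sol_y k"
    show False
    proof (cases "k \<le> r")
      case True
      have "sol_x r = sol_x k * sol_x (r - k) + m * sol_y k * sol_y (r - k)" using sol_add(1)[of k "r - k"] True by simp
      then have "int p dvd sol_x k * sol_x (r - k)" using pr d by (metis dvd_add_left_iff dvd_mult dvd_mult2)
      moreover have "\<not> int p dvd sol_x k" using prime_dvd_sol_x(1) p d by blast
      ultimately have "int p dvd sol_x (r - k)" using pI by (simp add: prime_dvd_mult_iff)
      then show False using min[of "r - k"] k True by simp
    next
      case False
      have "sol_y k = sol_x r * sol_y (k - r) + sol_y r * sol_x (k - r)" using sol_add(2)[of r "k - r"] False by simp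
      then have "int p dvd sol_y r * sol_x (k - r)" using pr d by (metis dvd_add_right_iff dvd_mult2)
      then have "int p dvd sol_x (k - r)" using prime_dvd_sol_x(1)[OF p(1) pr] pI by (simp add: prime_dvd_mult_iff)
      then show False using min[of "k - r"] k False by simp
    qed
  qed
  have neq: "sol_x (2 * i) mod int p \<noteq> sol_x (2 * j) mod int p" if "j < i" "i \<le> r" for i j
  proof
    assume "sol_x (2 * i) mod int p = sol_x (2 * j) mod int p"
    then have "int p dvd sol_x (2 * i) - sol_x (2 * j)" by (simp add: mod_eq_dvd_iff)
    moreover have "sol_x (2 * i) - sol_x (2 * j) = 2 * m * sol_y (2 * j + (i - j)) * sol_y (i - j)"
      using sol_x_step2[of "2 * j" "i - j"] that by (simp add: algebra_simps)
    ultimately have "int p dvd 2 * m * sol_y (2 * j + (i - j)) * sol_y (i - j)" by simp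
    then have "int p dvd 2" using Yk[of "2 * j + (i - j)"] Yk[of "i - j"] prime_dvd_sol_x(2)[OF p(1) pr] that pI
      by (auto simp: prime_dvd_mult_iff)
    then have "int p dvd int 2" by simp
    then have "p dvd 2" by (simp only: int_dvd_int_iff)
    then show False using p primes_dvd_imp_eq two_is_prime_nat by blast
  qed
  have "inj_on (\<lambda>i. sol_x (2 * i) mod int p) {0..r}"
    by (rule inj_onI) (metis atLeastAtMost_iff linorder_neqE_nat neq)
  moreover have "(\<lambda>i. sol_x (2 * i) mod int p) ` {0..r} \<subseteq> {0..<int p}" using p prime_gt_0_nat by auto
  ultimately have "card {0..r} \<le> card {0..<int p}" by (metis card_inj_on_le finite_atLeastLessThan_int)
  then show ?thesis by simp
qed

text \<open>Lifting the exponent: passing from index \<open>R\<close> to \<open>Rp\<close> multiplies \<open>sol_x R\<close> by \<open>p\<close> times a \<open>p\<close>-adic unit,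
and an odd factor of the index that is prime to \<open>p\<close> does not change the multiplicity.\<close>

lemma multiplicity_sol_x_odd_multiple:
  assumes p: "prime p" "int p dvd sol_x r"
  shows "odd k \<Longrightarrow> multiplicity (int p) (sol_x (r * k)) = multiplicity (int p) (sol_x r) + multiplicity p k"
proof (induction k rule: less_induct)
  case (less k)
  have pI: "prime (int p)" using p by simp
  have X0: "sol_x n \<noteq> 0" for n using sol_pos(1)[of n] by simp
  show ?case
  proof (cases "p dvd k")
    case False
    obtain i where k: "k = 2 * i + 1" using less.prems oddE by blast
    obtain z w where z: "sol_x (r * (2 * i + 1)) = sol_x r * ((-1) ^ i * (2 * int i + 1) + (sol_x r)\<^sup>2 * z)"
      using sol_odd_multiple[of r i] by metis
    define t where "t = (-1) ^ i * (2 * int i + 1) + (sol_x r)\<^sup>2 * z"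
    have "\<not> int p dvd t"
    proof
      assume "int p dvd t"
      moreover have "int p dvd (sol_x r)\<^sup>2 * z" using p by (simp add: power2_eq_square)
      ultimately have "int p dvd (-1) ^ i * (2 * int i + 1)" unfolding t_def by (simp add: dvd_add_left_iff)
      then have "int p dvd 2 * int i + 1" by (cases "even i") (simp_all only: minus_one_power_iff if_True if_False mult_minus1 dvd_minus_iff mult_1)
      then have "int p dvd int k" using k by (simp add: add.commute)
      then show False using False by (simp only: int_dvd_int_iff)
    qed
    then have mt: "multiplicity (int p) t = 0" by (rule not_dvd_imp_multiplicity_0)
    have t0: "t \<noteq> 0" using z X0[of "r * (2 * i + 1)"] by (auto simp: t_def)
    have "multiplicity (int p) (sol_x (r * k)) = multiplicity (int p) (sol_x r)"
    proof -
      have "multiplicity (int p) (sol_x r * t) = multiplicity (int p) (sol_x r) + multiplicity (int p) t"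
        using X0 pI t0 by (intro prime_elem_multiplicity_mult_distrib) auto
      then show ?thesis using z mt by (simp add: k flip: t_def)
    qed
    then show ?thesis using False by (simp add: not_dvd_imp_multiplicity_0)
  next
    case True
    then obtain k' where k': "k = p * k'" by (elim dvdE)
    have odd: "odd p" "odd k'" using less.prems k' by auto
    have "k' > 0" using odd by (cases k') auto
    then have "k' < k" using k' p prime_gt_1_nat by simp
    have IH: "multiplicity (int p) (sol_x (r * k')) = multiplicity (int p) (sol_x r) + multiplicity p k'"
      using less.IH \<open>k' < k\<close> odd by blast
    define R where "R = r * k'"
    obtain j where "k' = 2 * j + 1" using odd oddE by blast
    then have pR: "int p dvd sol_x R" using dvd_trans[OF p(2) sol_x_dvd_odd_multiple[of r j]] by (simp add: R_def)
    obtain i where i: "p = 2 * i + 1" using odd oddE by blast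
    obtain z w where z: "sol_x (R * (2 * i + 1)) = sol_x R * ((-1) ^ i * (2 * int i + 1) + (sol_x R)\<^sup>2 * z)"
      using sol_odd_multiple[of R i] by metis
    have ip: "2 * int i + 1 = int p" using i by simp
    obtain b where b: "sol_x R = int p * b" using pR by (elim dvdE)
    define t where "t = (-1) ^ i + int p * b\<^sup>2 * z"
    have zt: "sol_x (R * p) = sol_x R * (int p * t)"
    proof -
      have "sol_x (R * p) = sol_x R * ((-1) ^ i * int p + (sol_x R)\<^sup>2 * z)" using z unfolding ip i[symmetric] .
      also have "(sol_x R)\<^sup>2 = int p * (int p * b\<^sup>2)" unfolding b by (simp add: power2_eq_square)
      finally show ?thesis by (simp add: t_def algebra_simps)
    qed
    have "\<not> int p dvd t"
    proof
      assume "int p dvd t"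
      moreover have "int p dvd int p * b\<^sup>2 * z" by (simp add: mult.assoc)
      ultimately have "int p dvd (-1) ^ i" unfolding t_def by (simp only: dvd_add_left_iff)
      then show False using pI by (cases "even i") auto
    qed
    then have m0: "multiplicity (int p) t = 0" by (rule not_dvd_imp_multiplicity_0)
    have t0: "t \<noteq> 0" "int p \<noteq> 0" using zt X0[of "R * p"] p by auto
    have "multiplicity (int p) (sol_x (R * p)) = multiplicity (int p) (sol_x R) + 1"
    proof -
      have "multiplicity (int p) (sol_x R * (int p * t)) = multiplicity (int p) (sol_x R) + multiplicity (int p) (int p * t)"
        using X0 pI t0 by (intro prime_elem_multiplicity_mult_distrib) auto
      also have "multiplicity (int p) (int p * t) = multiplicity (int p) (int p) + multiplicity (int p) t"
        using pI t0 by (intro prime_elem_multiplicity_mult_distrib) auto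
      also have "multiplicity (int p) (int p) = 1" using pI by (intro multiplicity_self) auto
      finally show ?thesis unfolding zt using m0 by simp
    qed
    moreover have "multiplicity p k = multiplicity p k' + 1"
    proof -
      have "multiplicity p (p * k') = multiplicity p p + multiplicity p k'"
        using p \<open>k' > 0\<close> by (intro prime_elem_multiplicity_mult_distrib) auto
      also have "multiplicity p p = 1" using p by (intro multiplicity_self) auto
      finally show ?thesis unfolding k' by simp
    qed
    ultimately show ?thesis using IH by (simp add: R_def k' ac_simps)
  qed
qed

end

section \<open>Indices with a primitive prime\<close>

lemma multiplicity_of_nat:
  assumes "prime p" "r \<noteq> 0"
  shows "multiplicity (int p) (int r) = multiplicity p r"
proof (rule multiplicity_eqI)
  have "p ^ multiplicity p r dvd r" by (rule multiplicity_dvd)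
  then show "int p ^ multiplicity p r dvd int r" by (metis int_dvd_int_iff of_nat_power)
  have "\<not> p ^ Suc (multiplicity p r) dvd r"
    using assms by (subst power_dvd_iff_le_multiplicity) (auto simp: prime_gt_1_nat)
  then show "\<not> int p ^ Suc (multiplicity p r) dvd int r" by (metis int_dvd_int_iff of_nat_power)
qed

definition cofactor_sum :: "nat \<Rightarrow> nat" where
  "cofactor_sum r = (\<Sum>q\<in>prime_factors r. r div q)"

text \<open>For these indices a crude estimate provides a primitive prime.  The inequality says a little more than
that the reciprocals of the prime divisors of \<open>r\<close> sum to less than \<open>1/2\<close>; the slack is chosen so that
\<open>sparse_extend\<close> holds.\<close>

definition sparse :: "nat \<Rightarrow> bool" where
  "sparse r \<longleftrightarrow> odd r \<and> 2 * cofactor_sum r + 2 \<le> r"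

text \<open>The new cofactor sum is \<open>p\<^sup>i\<close> times the old one plus \<open>r p\<^bsup>i-1\<^esup>\<close>; as \<open>r < p\<close>, the last term is at most
\<open>p\<^sup>i - p\<^bsup>i-1\<^esup>\<close>, for which the slack leaves room.\<close>

lemma sparse_extend:
  assumes r: "sparse r" and p: "prime p" "r < p" and i: "i \<ge> 1"
  shows "sparse (r * p ^ i)"
proof -
  have r2: "r \<ge> 2" using r by (simp add: sparse_def)
  have "odd p" using p r2 prime_odd_nat[of p] by linarith
  have nd: "\<not> p dvd r" using p r2 by (auto dest: dvd_imp_le)
  have pf: "prime_factors (r * p ^ i) = insert p (prime_factors r)"
    using r2 p i by (subst prime_factors_product) (auto simp: prime_factorization_prime_power)
  obtain k where k: "i = Suc k" using i by (cases i) auto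
  have "cofactor_sum (r * p ^ i) = r * p ^ i div p + (\<Sum>q\<in>prime_factors r. r * p ^ i div q)"
    unfolding cofactor_sum_def pf using nd by (subst sum.insert) (auto simp: in_prime_factors_iff)
  also have "r * p ^ i div p = r * p ^ k" using p by (simp add: k)
  also have "(\<Sum>q\<in>prime_factors r. r * p ^ i div q) = (\<Sum>q\<in>prime_factors r. (r div q) * p ^ i)"
    by (rule sum.cong) (auto simp: in_prime_factors_iff div_mult_swap mult.commute)
  also have "\<dots> = cofactor_sum r * p ^ i" by (simp add: cofactor_sum_def sum_distrib_right)
  finally have "2 * cofactor_sum (r * p ^ i) + 2 = 2 * (r * p ^ k) + (2 * cofactor_sum r) * p ^ i + 2" by simp
  also have "\<dots> \<le> 2 * (r * p ^ k) + (r - 2) * p ^ i + 2"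
    using r by (intro add_mono mult_right_mono) (auto simp: sparse_def)
  also have "\<dots> \<le> (r - 2) * p ^ i + 2 * p ^ i"
  proof -
    have "(r + 1) * p ^ k \<le> p * p ^ k" using p by (intro mult_right_mono) auto
    then have "r * p ^ k + p ^ k \<le> p ^ i" by (simp add: k)
    moreover have "p ^ k \<ge> 1" using p prime_gt_0_nat by simp
    ultimately show ?thesis by linarith
  qed
  also have "\<dots> = (r - 2 + 2) * p ^ i" by (rule add_mult_distrib[symmetric])
  also have "r - 2 + 2 = r" using r2 by simp
  finally show ?thesis using r \<open>odd p\<close> by (simp add: sparse_def)
qed

lemma sparse_power3: "j \<ge> 2 \<Longrightarrow> sparse (3 ^ j)"
proof -
  assume j: "j \<ge> 2"
  obtain k where k: "j = Suc (Suc k)" using j by (metis add_2_eq_Suc le_Suc_ex)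
  have "prime_factors (3 ^ j :: nat) = {3}" using j by (subst prime_factorization_prime_power) auto
  then have "cofactor_sum (3 ^ j) = 3 * 3 ^ k" by (simp add: cofactor_sum_def k)
  moreover have "(3::nat) ^ k \<ge> 1" by simp
  ultimately have "2 * cofactor_sum (3 ^ j) + 2 \<le> 9 * 3 ^ k" by linarith
  then show ?thesis by (simp add: sparse_def k)
qed

context pell begin

lemma even_sol_x: "even (sol_x (2 * k + 1)) \<longleftrightarrow> even x1"
proof (induction k)
  case (Suc k)
  have "sol_x (2 * Suc k + 1) = sol_x (2 * k + 1) + 2 * m * sol_y (2 * k + 1 + 1) * sol_y 1"
    using sol_x_step2[of "2 * k + 1" 1] by (simp add: algebra_simps)
  then show ?case using Suc by simp
qed simp

text \<open>Suppose that every prime divisor of \<open>sol_x r\<close> divides \<open>sol_x (r div q)\<close> for some prime \<open>q\<close> dividing \<open>r\<close>.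
Lifting the exponent shows that \<open>sol_x r\<close> divides \<open>r\<close> times the product of these numbers.  As
\<open>sol_x a * sol_x b \<le> sol_x (a + b)\<close>, that product is at most \<open>sol_x s\<close>, where \<open>s < r/2\<close>, and so
\<open>sol_x (r - s) \<le> r\<close>, against the exponential growth.\<close>

lemma primitive_prime:
  assumes r: "sparse r"
  obtains p where "prime p" "odd p" "has_rank p r"
proof -
  have r2: "r > 1" "odd r" using r by (auto simp: sparse_def)
  let ?S = "prime_factors r"
  have X0: "sol_x n \<noteq> 0" for n using sol_pos(1)[of n] by simp
  have split: "r = (r div q) * q" "odd q" "odd (r div q)" if "q \<in> ?S" for q
  proof -
    show e: "r = (r div q) * q" using that by (auto simp: in_prime_factors_iff)
    show "odd q" "odd (r div q)" using r2 by (metis e even_mult_iff)+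
  qed
  have "\<exists>p. prime p \<and> int p dvd sol_x r \<and> (\<forall>q\<in>?S. \<not> int p dvd sol_x (r div q))"
  proof (rule ccontr)
    assume "\<not> ?thesis"
    then have A: "\<exists>q\<in>?S. int p dvd sol_x (r div q)" if "prime p" "int p dvd sol_x r" for p
      using that by blast
    define s where "s = (\<Sum>q\<in>?S. r div q)"
    have s: "2 * s + 2 \<le> r" using r by (simp add: sparse_def cofactor_sum_def s_def)
    let ?P = "int r * (\<Prod>q\<in>?S. sol_x (r div q))"
    have P0: "?P \<noteq> 0" using X0 r2 by auto
    have "sol_x r dvd ?P"
    proof (rule multiplicity_le_imp_dvd)
      show "sol_x r \<noteq> 0" by (rule X0)
      fix p' :: int assume "prime p'"
      then obtain p where p': "p' = int p" by (metis nonneg_int_cases prime_ge_0_int)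
      have p: "prime p" using \<open>prime p'\<close> p' by simp
      show "multiplicity p' (sol_x r) \<le> multiplicity p' ?P"
      proof (cases "int p dvd sol_x r")
        case False
        then show ?thesis by (simp add: p' not_dvd_imp_multiplicity_0)
      next
        case True
        obtain q where q: "q \<in> ?S" "int p dvd sol_x (r div q)" using A[OF p True] by blast
        have "multiplicity (int p) (sol_x r) = multiplicity (int p) (sol_x (r div q)) + multiplicity p q"
          using multiplicity_sol_x_odd_multiple[OF p q(2) split(2)[OF q(1)]] split(1)[OF q(1)] by simp
        also have "multiplicity p q \<le> multiplicity p r"
          using q(1) r2 by (intro dvd_imp_multiplicity_le) (auto simp: in_prime_factors_iff)
        also have "multiplicity p r = multiplicity (int p) (int r)" using p r2 by (simp add: multiplicity_of_nat)
        also have "multiplicity (int p) (sol_x (r div q)) \<le> multiplicity (int p) (\<Prod>q\<in>?S. sol_x (r div q))"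
          using q(1) X0 by (intro dvd_imp_multiplicity_le dvd_prodI) auto
        also have "multiplicity (int p) (\<Prod>q\<in>?S. sol_x (r div q)) + multiplicity (int p) (int r) = multiplicity (int p) ?P"
          using X0 r2 p by (subst prime_elem_multiplicity_mult_distrib) auto
        finally show ?thesis by (simp add: p')
      qed
    qed
    moreover have Ppos: "?P > 0"
    proof -
      have "(\<Prod>q\<in>?S. sol_x (r div q)) > 0" using sol_pos(1) by (intro prod_pos) (metis int_one_le_iff_zero_less)
      then show ?thesis using r2 by simp
    qed
    ultimately have "sol_x r \<le> ?P" by (intro zdvd_imp_le) auto
    moreover have "?P \<le> int r * sol_x s" unfolding s_def by (intro mult_left_mono sol_x_prod_le) auto
    ultimately have 1: "sol_x r \<le> int r * sol_x s" by linarith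
    have "sol_x (r - s) * sol_x s \<le> sol_x r" using sol_x_mult_le[of "r - s" s] s by simp
    then have "sol_x (r - s) * sol_x s \<le> int r * sol_x s" using 1 by linarith
    then have "sol_x (r - s) \<le> int r" using sol_pos(1)[of s] by (simp add: mult_le_cancel_right)
    then have "2 ^ (r - s) \<le> int r" using sol_x_ge_pow2[of "r - s"] by linarith
    then have "2 ^ (r - s) \<le> r" by (metis of_nat_le_iff of_nat_numeral of_nat_power)
    moreover have "2 * n \<le> 2 ^ n" if "n \<ge> 1" for n :: nat
      using that by (induction n rule: nat_induct_at_least) auto
    then have "2 * (r - s) \<le> 2 ^ (r - s)" using s by simp
    ultimately show False using s by simp
  qed
  then obtain p where p: "prime p" "int p dvd sol_x r" and np: "\<And>q. q \<in> ?S \<Longrightarrow> \<not> int p dvd sol_x (r div q)" by blast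
  define r0 where "r0 = (LEAST n. int p dvd sol_x n)"
  have rank: "has_rank p r0" unfolding has_rank_def r0_def
    using p(2) by (auto intro: LeastI dest: not_less_Least)
  obtain i where i: "r = r0 * (2 * i + 1)" using rank_dvd[OF p(1) rank p(2)] by blast
  have "r0 = r"
  proof (rule ccontr)
    assume "r0 \<noteq> r"
    then have "2 * i + 1 \<noteq> 1" using i by auto
    then obtain q where q: "prime q" "q dvd 2 * i + 1" using prime_factor_nat by blast
    have "q dvd r" unfolding i using q(2) by (rule dvd_mult)
    then have qS: "q \<in> ?S" using q(1) r2 by (simp add: in_prime_factors_iff)
    obtain c where c: "2 * i + 1 = q * c" using q by (elim dvdE)
    have "odd c" using c by (metis even_mult_iff odd_two_times_div_two_succ even_plus_one_iff dvd_triv_left)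
    then obtain e where e: "c = 2 * e + 1" by (elim oddE)
    have "r = q * (r0 * (2 * e + 1))" unfolding i c e by (simp only: ac_simps)
    then have "r div q = r0 * (2 * e + 1)" using q by (simp add: prime_gt_0_nat)
    moreover have "int p dvd sol_x r0" using rank by (simp add: has_rank_def)
    ultimately have "int p dvd sol_x (r div q)" using sol_x_dvd_odd_multiple dvd_trans by metis
    then show False using np[OF qS] by blast
  qed
  moreover have "odd p"
  proof
    assume "even p"
    then have "p = 2" using p(1) prime_prime_factor two_is_prime_nat primes_dvd_imp_eq by metis
    obtain k where k: "r = 2 * k + 1" using r2 by (elim oddE)
    have "even x1" using p(2) even_sol_x[of k] by (simp add: \<open>p = 2\<close> k)
    then have "int p dvd sol_x 1" by (simp add: \<open>p = 2\<close>)
    then show False using rank r2(1) \<open>r0 = r\<close> by (auto simp: has_rank_def)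
  qed
  ultimately show ?thesis using that p(1) rank by blast
qed

lemma sol_x_power3_succ_square:
  assumes "x1 + 1 = a0\<^sup>2"
  shows "\<exists>a \<ge> (if j = 0 then 2 else 3). sol_x (3 ^ j) + 1 = a\<^sup>2"
proof (induction j)
  case 0
  have "\<bar>a0\<bar> \<ge> 2"
  proof (rule ccontr)
    assume "\<not> ?thesis"
    then have "a0\<^sup>2 \<le> 1\<^sup>2" by (intro power2_le_iff_abs_le[THEN iffD2]) auto
    then show False using assms x1_ge2 by simp
  qed
  then show ?case using assms by (intro exI[of _ "\<bar>a0\<bar>"]) simp
next
  case (Suc j)
  then obtain a where a: "a \<ge> 2" "sol_x (3 ^ j) + 1 = a\<^sup>2" by (auto split: if_splits)
  have x: "sol_x (3 ^ j) \<ge> 2"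
    using sol_x_ge_pow2[of "3 ^ j"] power_increasing[of 1 "3 ^ j" "2::int"] by simp
  have "sol_x (3 ^ Suc j) + 1 = (sol_x (3 ^ j) + 1) * (2 * sol_x (3 ^ j) - 1)\<^sup>2"
    unfolding power_Suc sol_x_triple by (simp add: power2_eq_square power3_eq_cube algebra_simps)
  also have "\<dots> = (a * (2 * sol_x (3 ^ j) - 1))\<^sup>2" using a by (simp add: power_mult_distrib)
  finally have "sol_x (3 ^ Suc j) + 1 = \<dots>" .
  moreover have "2 * 3 \<le> a * (2 * sol_x (3 ^ j) - 1)" using a x by (intro mult_mono) auto
  ultimately show ?case by (intro exI[of _ "a * (2 * sol_x (3 ^ j) - 1)"]) auto
qed

lemma prime_not_3:
  fixes t :: int
  assumes "odd t" "t > 3" "\<not> 9 dvd t"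
  obtains p where "prime p" "p \<noteq> 3" "odd p" "int p dvd t"
proof -
  define u where "u = (if 3 dvd t then t div 3 else t)"
  have u: "u dvd t" "u > 1" "\<not> 3 dvd u"
  proof -
    show "u dvd t" by (auto simp: u_def)
    show "u > 1" using assms by (auto simp: u_def)
    show "\<not> 3 dvd u"
    proof
      assume "3 dvd u"
      show False
      proof (cases "3 dvd t")
        case True
        then have "3 * 3 dvd t" using \<open>3 dvd u\<close> by (metis dvd_mult_div_cancel mult_dvd_mono dvd_refl u_def)
        then show ?thesis using assms by simp
      qed (use \<open>3 dvd u\<close> in \<open>simp add: u_def\<close>)
    qed
  qed
  have "nat u \<noteq> 1" using u by simp
  then obtain p where p: "prime p" "p dvd nat u" using prime_factor_nat by blast
  then have "int p dvd int (nat u)" by (simp only: int_dvd_int_iff)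
  then have pu: "int p dvd u" using u by simp
  then have pt: "int p dvd t" using u dvd_trans by blast
  have "p \<noteq> 3" using pu u by auto
  moreover have "odd p"
  proof
    assume "even p"
    then have "2 dvd int p" by simp
    then show False using pt assms dvd_trans by blast
  qed
  ultimately show ?thesis using that p pt by blast
qed

text \<open>With \<open>sol_x n = a\<^sup>2 - 1\<close> the quotient of \<open>sol_x (3 * n)\<close> by \<open>sol_x n\<close> is
\<open>4(a\<^sup>2 - 1)\<^sup>2 - 3 = (2a\<^sup>2 - 2a - 1)(2a\<^sup>2 + 2a - 1)\<close>.  The two factors are odd and coprime, and apart from a
single factor \<open>3\<close> their primes do not divide \<open>sol_x n\<close>.\<close>

lemma two_primes_of_rank_power3:
  assumes sq: "x1 + 1 = a0\<^sup>2" and j: "j \<ge> 1"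
  obtains p q where "prime p" "prime q" "p \<noteq> q" "odd p" "odd q"
    "has_rank p (3 ^ Suc j)" "has_rank q (3 ^ Suc j)"
proof -
  obtain a where a: "a \<ge> 3" "sol_x (3 ^ j) + 1 = a\<^sup>2" using sol_x_power3_succ_square[OF sq, of j] j by auto
  define n x where "n = (3::nat) ^ j" and "x = sol_x n"
  define C D where "C = 2 * a\<^sup>2 - 2 * a - 1" and "D = 2 * a\<^sup>2 + 2 * a - 1"
  have xa: "x = a\<^sup>2 - 1" using a by (simp add: x_def n_def)
  have CD: "C * D = 4 * x\<^sup>2 - 3" unfolding xa C_def D_def by (simp add: power2_eq_square algebra_simps)
  have X3: "sol_x (3 * n) = x * (C * D)"
    unfolding CD sol_x_triple x_def by (simp add: power2_eq_square power3_eq_cube algebra_simps)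
  have a6: "a * 3 \<le> a * a" using a by (intro mult_left_mono) auto
  have gt: "C > 3" "D > 3" using a a6 unfolding C_def D_def power2_eq_square by linarith+
  have odd: "odd C" "odd D" unfolding C_def D_def by auto
  have no9: "\<not> 9 dvd C * D"
  proof
    assume d9: "9 dvd C * D"
    then have "3 dvd 4 * x\<^sup>2 - 3" unfolding CD using dvd_trans[of 3 9] by auto
    then have "3 dvd 4 * x\<^sup>2" by (metis dvd_diff_left_iff dvd_refl)
    then have "3 dvd 4 * (x * x)" by (simp add: power2_eq_square)
    then have "3 dvd x"
      using prime_dvd_mult_iff[of "3::int"] by auto
    then have "3 * 3 dvd x * x" by (intro mult_dvd_mono)
    then have "9 dvd 4 * x\<^sup>2" by (simp add: power2_eq_square)
    then have "9 dvd (4 * x\<^sup>2 - (4 * x\<^sup>2 - 3))" using d9 unfolding CD by (rule dvd_diff)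
    then have "9 dvd (3::int)" by (simp only: diff_diff_eq2 add_diff_cancel_left')
    then show False by simp
  qed
  have "\<not> 9 dvd C" "\<not> 9 dvd D" using no9 by auto
  then obtain p q where p: "prime p" "p \<noteq> 3" "odd p" "int p dvd C"
    and q: "prime q" "q \<noteq> 3" "odd q" "int q dvd D"
    using prime_not_3 gt odd by metis
  have "p \<noteq> q"
  proof
    assume "p = q"
    then have "int p dvd D - C" using p q by auto
    also have "D - C = 4 * a" by (simp add: C_def D_def)
    finally have "int p dvd 4 * a" .
    moreover have "\<not> int p dvd 4"
    proof
      assume "int p dvd 4"
      then have "int p dvd int (2 * 2)" by simp
      then have "p dvd 2 * 2" by (simp only: int_dvd_int_iff)
      then have "p dvd 2" using p(1) prime_dvd_mult_nat by blast
      then show False using p(1,3) primes_dvd_imp_eq two_is_prime_nat by blast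
    qed
    ultimately have "int p dvd a" using p(1) by (simp add: prime_dvd_mult_iff)
    then have "int p dvd 2 * a * (a - 1)" by simp
    also have "2 * a * (a - 1) = C + 1" by (simp add: C_def power2_eq_square algebra_simps)
    finally have "int p dvd 1" using p(4) by (metis dvd_add_right_iff)
    then show False using p(1) by auto
  qed
  have rank: "has_rank p (3 ^ Suc j)" if p: "prime p" "p \<noteq> 3" "int p dvd C * D" for p
  proof -
    have pI: "prime (int p)" using p by simp
    have px: "\<not> int p dvd x"
    proof
      assume "int p dvd x"
      then have "int p dvd 4 * x\<^sup>2" by (simp add: power2_eq_square)
      moreover have "int p dvd 4 * x\<^sup>2 - 3" using p(3) unfolding CD .
      ultimately have "int p dvd 4 * x\<^sup>2 - (4 * x\<^sup>2 - 3)" by (rule dvd_diff)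
      then have "int p dvd int 3" by simp
      then have "p dvd 3" by (simp only: int_dvd_int_iff)
      then show False using p(1,2) primes_dvd_imp_eq[of p 3] by auto
    qed
    have sol_x: "int p dvd sol_x (3 * n)" using p(3) unfolding X3 by simp
    define r where "r = (LEAST n. int p dvd sol_x n)"
    have hr: "has_rank p r" unfolding has_rank_def r_def
      using sol_x by (auto intro: LeastI dest: not_less_Least)
    obtain i where i: "3 * n = r * (2 * i + 1)" using rank_dvd[OF p(1) hr sol_x] by blast
    then have "r dvd 3 ^ Suc j" by (simp add: n_def)
    moreover have "prime (3::nat)" by simp
    ultimately obtain k where k: "k \<le> Suc j" "r = 3 ^ k" using divides_primepow_nat by blast
    have "k = Suc j"
    proof (rule ccontr)
      assume "k \<noteq> Suc j"
      then have "k \<le> j" using k by simp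
      then have "n = r * 3 ^ (j - k)" using k by (simp add: n_def flip: power_add)
      moreover obtain e where "(3::nat) ^ (j - k) = 2 * e + 1" by (metis even_power odd_numeral oddE)
      ultimately have "sol_x r dvd x" using sol_x_dvd_odd_multiple unfolding x_def by metis
      then show False using px hr by (meson dvd_trans has_rank_def)
    qed
    then show ?thesis using hr k by simp
  qed
  show ?thesis using that[OF p(1) q(1) \<open>p \<noteq> q\<close> p(3) q(3)] rank p q by simp
qed

end

section \<open>Relations between Pell classes\<close>

lemma chi4_odd_mult:
  assumes "odd r" shows "chi4 (r * (2 * i + 1)) = chi4 r * (-1) ^ i"
  using chi4_mult[OF assms, of "2 * i + 1"] chi4_power[of "2 * i + 1"] by simp

lemma chi4_nonzero [simp]: "chi4 n \<noteq> 0" by (simp add: chi4_def)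

definition odd_multiples :: "nat \<Rightarrow> nat \<Rightarrow> nat set" where
  "odd_multiples M r = {n. n < M \<and> odd n \<and> r dvd n}"

text \<open>The sign compares solutions of different indices: \<open>sol_y (r * k)\<close> is congruent to \<open>chi4 k * sol_y r\<close>
modulo the primes of rank \<open>r\<close>, for odd \<open>r\<close> and \<open>k\<close>.\<close>

definition twisted_sum :: "nat \<Rightarrow> (nat \<Rightarrow> int) \<Rightarrow> nat \<Rightarrow> int" where
  "twisted_sum M b r = (\<Sum>n\<in>odd_multiples M r. chi4 n * b n)"

lemma finite_odd_multiples [simp]: "finite (odd_multiples M r)"
  by (simp add: odd_multiples_def)

lemma multiplicity_eq_sum:
  assumes p: "prime p" and k: "0 < k" "k < M"
  shows "multiplicity p k = (\<Sum>i\<in>{1..M}. if p ^ i dvd k then 1 else 0)"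
proof -
  let ?v = "multiplicity p k"
  have p1: "p > 1" using p prime_gt_1_nat by blast
  have iff: "p ^ i dvd k \<longleftrightarrow> i \<le> ?v" for i
    using k p1 by (intro power_dvd_iff_le_multiplicity) auto
  have "?v < p ^ ?v" by (rule order_less_le_trans[OF less_exp]) (use p1 in \<open>auto intro: power_mono\<close>)
  also have "p ^ ?v \<le> k" using k by (intro dvd_imp_le multiplicity_dvd) auto
  finally have v: "?v < M" using k by simp
  have "(\<Sum>i\<in>{1..M}. if p ^ i dvd k then 1 else (0::nat)) = card {i\<in>{1..M}. i \<le> ?v}"
    unfolding iff by (subst sum.inter_filter[symmetric]) auto
  also have "{i\<in>{1..M}. i \<le> ?v} = {1..?v}" using v by auto
  finally show ?thesis by simp
qed

text \<open>Counting the powers of \<open>p\<close> that divide \<open>n div r\<close> and exchanging the sums gives the twisted sums at the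
indices \<open>rp\<^sup>i\<close>.\<close>

lemma multiplicity_sum_eq_0:
  assumes p: "prime p" and r: "r > 0"
    and z: "\<And>i. i \<ge> 1 \<Longrightarrow> twisted_sum M b (r * p ^ i) = 0"
  shows "(\<Sum>n\<in>odd_multiples M r. chi4 n * b n * int (multiplicity p (n div r))) = 0"
proof -
  let ?A = "odd_multiples M r"
  have "(\<Sum>n\<in>?A. chi4 n * b n * int (multiplicity p (n div r)))
      = (\<Sum>n\<in>?A. \<Sum>i\<in>{1..M}. if r * p ^ i dvd n then chi4 n * b n else 0)"
  proof (rule sum.cong[OF refl])
    fix n assume n: "n \<in> ?A"
    then obtain k where k: "n = r * k" by (auto simp: odd_multiples_def)
    have k0: "k > 0" using n k by (auto simp: odd_multiples_def intro!: Nat.gr0I)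
    have kM: "k < M"
    proof -
      have "1 * k \<le> r * k" using r by (intro mult_right_mono) auto
      moreover have "r * k < M" using n k by (simp add: odd_multiples_def)
      ultimately show ?thesis by linarith
    qed
    have "int (multiplicity p (n div r)) = (\<Sum>i\<in>{1..M}. if p ^ i dvd k then 1 else 0)"
      using multiplicity_eq_sum[OF p k0 kM] r by (auto simp: k intro!: sum.cong)
    moreover have "r * p ^ i dvd n \<longleftrightarrow> p ^ i dvd k" for i using r by (simp add: k)
    ultimately show "chi4 n * b n * int (multiplicity p (n div r)) = (\<Sum>i\<in>{1..M}. if r * p ^ i dvd n then chi4 n * b n else 0)"
      by (simp add: sum_distrib_left if_distrib cong: if_cong)
  qed
  also have "\<dots> = (\<Sum>i\<in>{1..M}. \<Sum>n\<in>?A. if r * p ^ i dvd n then chi4 n * b n else 0)" by (rule sum.swap)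
  also have "\<dots> = (\<Sum>i\<in>{1..M}. twisted_sum M b (r * p ^ i))"
  proof (rule sum.cong[OF refl])
    fix i
    have "odd_multiples M (r * p ^ i) = {n \<in> ?A. r * p ^ i dvd n}"
      by (auto simp: odd_multiples_def intro: dvd_trans[OF dvd_triv_left])
    then show "(\<Sum>n\<in>?A. if r * p ^ i dvd n then chi4 n * b n else 0) = twisted_sum M b (r * p ^ i)"
      by (simp add: twisted_sum_def sum.inter_filter)
  qed
  also have "\<dots> = 0" using z by (intro sum.neutral) auto
  finally show ?thesis .
qed

context pell begin

lemma split_prime_if_dvd_sol_x:
  assumes "prime p" "odd p" "int p dvd sol_x n"
  shows "split_prime m p"
proof -
  have "(m * sol_y n)\<^sup>2 + m = m * (m * sol_y n * sol_y n + 1)" by (simp add: power2_eq_square algebra_simps)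
  also have "\<dots> = m * (sol_x n * sol_x n)" unfolding m_sol_y_squared by simp
  finally have "int p dvd (m * sol_y n)\<^sup>2 + m" using assms(3) by simp
  then show ?thesis unfolding split_prime_def using assms prime_dvd_sol_x(2) by blast
qed

lemma ord_diff_sol:
  assumes sp: "split_prime m p" and r: "has_rank p r" "odd r" and n: "odd n"
  shows "ord_diff m p 1 (sol_y n) = (if r dvd n then chi4 n * ord_diff m p 1 (sol_y r) * chi4 r
    + 2 * (chi4 n * chi4 r * (if int p dvd 1 + root_mod_prime m p * sol_y r then 1 else -1)) * int (multiplicity p (n div r)) else 0)"
proof -
  have p: "prime p" and pI: "prime (int p)" using sp by (auto simp: split_prime_def)
  have n1: "1\<^sup>2 + m * (sol_y n)\<^sup>2 = (sol_x n)\<^sup>2" for n using sol_norm[of n] by simp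
  have p1: "\<not> int p dvd 1" using p by auto
  have pr: "int p dvd sol_x r" using r by (simp add: has_rank_def)
  show ?thesis
  proof (cases "r dvd n")
    case False
    have "\<not> int p dvd sol_x n" using rank_dvd[OF p r(1), of n] False by auto
    then have "\<not> int p dvd (sol_x n)\<^sup>2" using pI by (simp add: prime_dvd_power_iff)
    then show ?thesis using False ord_diff_eq_0[OF m_pos, of p 1 "sol_y n"] unfolding n1 by simp
  next
    case True
    then obtain k where k: "n = r * k" by (elim dvdE)
    then have "odd k" using n by simp
    then obtain i where i: "k = 2 * i + 1" by (elim oddE)
    have ni: "n = r * (2 * i + 1)" by (simp only: k i)
    have r0: "r > 0" using r(2) by (cases r) auto
    define s :: "int \<Rightarrow> int" where "s y = (if int p dvd 1 + root_mod_prime m p * y then 1 else -1)" for y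
    have X0: "sol_x n \<noteq> 0" for n using sol_pos(1)[of n] by simp
    have m2: "multiplicity (int p) ((sol_x n)\<^sup>2) = 2 * multiplicity (int p) (sol_x n)" for n
      using X0 pI by (intro prime_elem_multiplicity_power_distrib) auto
    have val: "ord_diff m p 1 (sol_y n) = s (sol_y n) * (2 * int (multiplicity (int p) (sol_x n)))" for n
      using ord_diff_value[OF sp m_pos p1, of "sol_y n"] unfolding n1 m2 s_def by simp
    have val': "ord_diff m p 1 (- sol_y n) = s (- sol_y n) * (2 * int (multiplicity (int p) (sol_x n)))" for n
      using ord_diff_value[OF sp m_pos p1, of "- sol_y n"] unfolding power2_minus n1 m2 s_def by simp
    have s_cong: "s y = s y'" if "int p dvd y - y'" for y y'
    proof -
      have "1 + root_mod_prime m p * y = (1 + root_mod_prime m p * y') + root_mod_prime m p * (y - y')" by (simp add: algebra_simps)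
      then have "int p dvd 1 + root_mod_prime m p * y \<longleftrightarrow> int p dvd 1 + root_mod_prime m p * y'"
        using that by (metis dvd_add_left_iff dvd_mult)
      then show ?thesis by (simp add: s_def)
    qed
    obtain w where w: "sol_y n = sol_y r * ((-1) ^ i + (sol_x r)\<^sup>2 * w)" using sol_odd_multiple[of r i] unfolding ni by metis
    have "int p dvd sol_y n - (-1) ^ i * sol_y r" using pr unfolding w by (simp add: algebra_simps power2_eq_square)
    then have "ord_diff m p 1 (sol_y n) = (-1) ^ i * s (sol_y r) * (2 * int (multiplicity (int p) (sol_x n)))"
    proof (cases "even i")
      case True
      then have "s (sol_y n) = s (sol_y r)" using \<open>int p dvd sol_y n - _\<close> by (intro s_cong) simp
      then show ?thesis using True val by simp
    next
      case False
      then have "int p dvd sol_y n + sol_y r" using \<open>int p dvd sol_y n - _\<close> by simp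
      then have "int p dvd - (sol_y n + sol_y r)" by (simp only: dvd_minus_iff)
      also have "- (sol_y n + sol_y r) = - sol_y n - sol_y r" by simp
      finally have "s (- sol_y n) = s (sol_y r)" by (rule s_cong)
      then show ?thesis using False val'[of n] by (simp add: ord_diff_uminus)
    qed
    also have "multiplicity (int p) (sol_x n) = multiplicity (int p) (sol_x r) + multiplicity p k"
      unfolding k by (rule multiplicity_sol_x_odd_multiple[OF p pr \<open>odd k\<close>])
    finally have e: "ord_diff m p 1 (sol_y n) = (-1) ^ i * (ord_diff m p 1 (sol_y r) + 2 * s (sol_y r) * int (multiplicity p k))"
      by (simp add: val algebra_simps)
    have "chi4 r * chi4 r = 1" by (simp add: chi4_def)
    then have "(-1) ^ i = chi4 n * chi4 r" unfolding ni chi4_odd_mult[OF r(2)] by (simp add: ac_simps)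
    moreover have "n div r = k" using r0 by (simp add: k)
    ultimately show ?thesis using e True by (simp add: s_def algebra_simps)
  qed
qed


lemma ord_diff_sol_even:
  assumes sp: "split_prime m p" and r: "has_rank p r" "odd r" and n: "even n"
  shows "ord_diff m p 1 (sol_y n) = 0"
proof (rule ord_diff_eq_0[OF m_pos])
  have p: "prime p" "prime (int p)" using sp by (auto simp: split_prime_def)
  have "n \<noteq> r * (2 * i + 1)" for i using n r(2) by auto
  then have "\<not> int p dvd sol_x n" using rank_dvd[OF p(1) r(1), of n] by blast
  then have "\<not> int p dvd (sol_x n)\<^sup>2" using p by (simp add: prime_dvd_power_iff)
  then show "\<not> int p dvd 1\<^sup>2 + m * (sol_y n)\<^sup>2" using sol_norm[of n] by (simp add: algebra_simps)
qed

text \<open>The value at a prime of rank \<open>r\<close> only sees the indices divisible by \<open>r\<close>.  It would be a multiple of the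
twisted sum at \<open>r\<close> if the multiplicity of \<open>p\<close> did not grow along these indices; \<open>z\<close> removes that growth.\<close>

lemma relation_at_rank:
  assumes p: "prime p" "odd p" and r: "has_rank p r" "odd r"
    and z: "\<And>i. i \<ge> 1 \<Longrightarrow> twisted_sum M b (r * p ^ i) = 0"
  shows "(\<Sum>n<M. b n * ord_diff m p 1 (sol_y n)) = twisted_sum M b r * (chi4 r * ord_diff m p 1 (sol_y r))"
proof -
  have pr: "int p dvd sol_x r" using r by (simp add: has_rank_def)
  have sp: "split_prime m p" by (rule split_prime_if_dvd_sol_x[OF p pr])
  have r0: "r > 0" using r(2) by (cases r) auto
  define s :: int where "s = (if int p dvd 1 + root_mod_prime m p * sol_y r then 1 else -1)"
  let ?A = "odd_multiples M r"
  have "(\<Sum>n<M. b n * ord_diff m p 1 (sol_y n)) = (\<Sum>n\<in>?A. b n * ord_diff m p 1 (sol_y n))"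
  proof (rule sum.mono_neutral_right)
    show "\<forall>n\<in>{..<M} - ?A. b n * ord_diff m p 1 (sol_y n) = 0"
    proof
      fix n assume "n \<in> {..<M} - ?A"
      then have "even n \<or> (odd n \<and> \<not> r dvd n)" by (auto simp: odd_multiples_def)
      then show "b n * ord_diff m p 1 (sol_y n) = 0" using ord_diff_sol[OF sp r, of n] ord_diff_sol_even[OF sp r, of n] by auto
    qed
  qed (auto simp: odd_multiples_def)
  also have "\<dots> = (\<Sum>n\<in>?A. chi4 n * b n * (chi4 r * ord_diff m p 1 (sol_y r))
      + 2 * chi4 r * s * (chi4 n * b n * int (multiplicity p (n div r))))"
  proof (rule sum.cong[OF refl])
    fix n assume "n \<in> ?A"
    then have n: "odd n" "r dvd n" by (auto simp: odd_multiples_def)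
    show "b n * ord_diff m p 1 (sol_y n) = chi4 n * b n * (chi4 r * ord_diff m p 1 (sol_y r))
      + 2 * chi4 r * s * (chi4 n * b n * int (multiplicity p (n div r)))"
      unfolding ord_diff_sol[OF sp r n(1)] s_def[symmetric] using n by (simp add: algebra_simps)
  qed
  also have "\<dots> = twisted_sum M b r * (chi4 r * ord_diff m p 1 (sol_y r))
      + 2 * chi4 r * s * (\<Sum>n\<in>?A. chi4 n * b n * int (multiplicity p (n div r)))"
    by (simp only: sum.distrib twisted_sum_def sum_distrib_left sum_distrib_right)
  also have "(\<Sum>n\<in>?A. chi4 n * b n * int (multiplicity p (n div r))) = 0"
    by (rule multiplicity_sum_eq_0[OF p(1) r0 z])
  finally show ?thesis by simp
qed


lemma ord_diff_sol_rank_nonzero: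
  assumes "split_prime m p" "has_rank p r"
  shows "ord_diff m p 1 (sol_y r) \<noteq> 0"
proof -
  have pI: "prime (int p)" using assms by (simp add: split_prime_def)
  have n1: "1\<^sup>2 + m * (sol_y r)\<^sup>2 = (sol_x r)\<^sup>2" using sol_norm[of r] by simp
  have "sol_x r \<noteq> 0" using sol_pos(1)[of r] by simp
  moreover have "int p dvd (sol_x r)\<^sup>2" using assms(2) by (simp add: has_rank_def power2_eq_square)
  ultimately have "multiplicity (int p) ((sol_x r)\<^sup>2) \<noteq> 0"
    using pI by (subst multiplicity_eq_zero_iff) auto
  moreover have "\<not> int p dvd 1" using pI by auto
  ultimately show ?thesis using ord_diff_value[OF assms(1) m_pos, of 1 "sol_y r"] unfolding n1 by auto
qed

text \<open>Descending induction on \<open>r\<close>, which starts where no index below \<open>M\<close> is a multiple of \<open>r\<close>.  A primitive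
prime \<open>p\<close> of rank \<open>r\<close> is larger than \<open>r\<close> and hence than \<open>K\<close>, so the value at \<open>p\<close> is zero, while the indices
\<open>rp\<^sup>i\<close> are sparse again and covered by induction.\<close>

lemma twisted_sum_eq_0:
  assumes f: "\<And>p. split_prime m p \<Longrightarrow> p > K \<Longrightarrow> (\<Sum>n<M. b n * ord_diff m p 1 (sol_y n)) = 0"
  shows "sparse r \<Longrightarrow> r \<ge> K \<Longrightarrow> twisted_sum M b r = 0"
proof (induction "M - r" arbitrary: r rule: less_induct)
  case less
  have r: "odd r" "r \<ge> 2" using less.prems by (auto simp: sparse_def)
  show ?case
  proof (cases "r < M")
    case False
    have "odd_multiples M r = {}"
    proof (rule equals0I)
      fix n assume "n \<in> odd_multiples M r"
      then have n: "n < M" "odd n" "r dvd n" by (auto simp: odd_multiples_def)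
      then have "r \<le> n" by (intro dvd_imp_le) (auto intro!: Nat.gr0I)
      then show False using n False by simp
    qed
    then show ?thesis by (simp add: twisted_sum_def)
  next
    case True
    obtain p where p: "prime p" "odd p" "has_rank p r" by (rule primitive_prime[OF less.prems(1)])
    have rp: "r < p" by (rule rank_less[OF p])
    have sp: "split_prime m p"
      using p by (intro split_prime_if_dvd_sol_x[of p r]) (auto simp: has_rank_def)
    have "twisted_sum M b (r * p ^ i) = 0" if i: "i \<ge> 1" for i
    proof (rule less.hyps)
      have "r * 1 < r * p ^ i" using i r rp by (intro mult_strict_left_mono one_less_power) auto
      then have "r < r * p ^ i" by simp
      then show "M - r * p ^ i < M - r" "K \<le> r * p ^ i" using True less.prems by linarith+
      show "sparse (r * p ^ i)" by (rule sparse_extend[OF less.prems(1) p(1) rp i])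
    qed
    from relation_at_rank[OF p(1,2,3) r(1) this]
    have "twisted_sum M b r * (chi4 r * ord_diff m p 1 (sol_y r)) = 0"
      using f[OF sp] rp less.prems by simp
    then show ?thesis using ord_diff_sol_rank_nonzero[OF sp p(3)] by simp
  qed
qed

text \<open>Here \<open>Q\<close> consists of the smaller ones of two primes \<open>p < q\<close> of the same rank \<open>r\<close>.  If the values of an
element of \<open>P\<^sub>m\<close> vanish at all primes above \<open>p\<close>, the twisted sums at \<open>rp\<^sup>i\<close> and \<open>rq\<^sup>i\<close> with \<open>i \<ge> 1\<close> are zero,
so the values at \<open>p\<close> and \<open>q\<close> are nonzero multiples of the twisted sum at \<open>r\<close>.  The value at \<open>q\<close> is zero,
and therefore the value at \<open>p\<close> too.\<close>

theorem rank_infinite_if_square: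
  assumes least: "\<And>u v. u > 0 \<Longrightarrow> v > 0 \<Longrightarrow> u\<^sup>2 - m * v\<^sup>2 = 1 \<Longrightarrow> y1 \<le> v"
    and sq: "x1 + 1 = a0\<^sup>2"
  shows "group_rank (G_group m Mod P_subgroup m) = \<infinity>"
proof -
  define V :: "(nat \<Rightarrow> int) set" where
    "V = {f. \<exists>M b. \<forall>p. f p = (\<Sum>n<M. b n * ord_diff m p 1 (sol_y n))}"
  define Q where "Q = {p. int p > m \<and> (\<exists>j\<ge>1. \<exists>q>p. prime p \<and> prime q \<and> odd p \<and> odd q \<and>
    has_rank p (3 ^ Suc j) \<and> has_rank q (3 ^ Suc j))}"
  show ?thesis
  proof (rule rank_criterion[OF m_pos, where V = V and Q = Q])
    show "(\<lambda>p. 0) \<in> V" unfolding V_def by (intro CollectI exI[of _ 0]) simp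
  next
    fix f f' assume "f \<in> V" "f' \<in> V"
    then obtain M b M' b' where f: "\<And>p. f p = (\<Sum>n<M. b n * ord_diff m p 1 (sol_y n))"
      and f': "\<And>p. f' p = (\<Sum>n<M'. b' n * ord_diff m p 1 (sol_y n))" unfolding V_def by blast
    define c where "c n = (if n < M then b n else 0) + (if n < M' then b' n else 0)" for n
    have ext: "(\<Sum>n<L. d n * g n) = (\<Sum>n<L + L'. (if n < L then d n else 0) * g n)" for L L' and d g :: "nat \<Rightarrow> int"
      by (rule sum.mono_neutral_cong_left) auto
    have "f p + f' p = (\<Sum>n<M + M'. c n * ord_diff m p 1 (sol_y n))" for p
      unfolding f f' ext[of b _ M M'] ext[of b' _ M' M]
      by (simp add: c_def distrib_right sum.distrib add.commute)
    then show "(\<lambda>p. f p + f' p) \<in> V" unfolding V_def by blast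
  next
    fix f assume "f \<in> V"
    then obtain M b where f: "\<And>p. f p = (\<Sum>n<M. b n * ord_diff m p 1 (sol_y n))" unfolding V_def by blast
    have "- f p = (\<Sum>n<M. (- b n) * ord_diff m p 1 (sol_y n))" for p by (simp add: f sum_negf)
    then show "(\<lambda>p. - f p) \<in> V" unfolding V_def by (intro CollectI exI[of _ M] exI[of _ "\<lambda>n. - b n"]) blast
  next
    fix u v :: int assume uv: "u\<^sup>2 - m * v\<^sup>2 = 1" "u > 0"
    have "\<exists>n. u = sol_x n \<and> \<bar>v\<bar> = sol_y n" by (rule sol_complete) (use least uv in auto)
    then obtain n where n: "\<bar>v\<bar> = sol_y n" by blast
    define b :: "nat \<Rightarrow> int" where "b k = (if k = n then (if v \<ge> 0 then 1 else -1) else 0)" for k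
    have "ord_diff m p 1 v = (\<Sum>k<Suc n. b k * ord_diff m p 1 (sol_y k))" for p
    proof -
      have "(\<Sum>k<Suc n. b k * ord_diff m p 1 (sol_y k)) = b n * ord_diff m p 1 (sol_y n)"
        by (simp add: b_def)
      also have "\<dots> = ord_diff m p 1 v"
      proof (cases "v \<ge> 0")
        case False
        then have "sol_y n = - v" using n by simp
        then show ?thesis using False by (simp add: b_def ord_diff_uminus)
      qed (use n in \<open>simp add: b_def\<close>)
      finally show ?thesis by simp
    qed
    then show "(\<lambda>p. ord_diff m p 1 v) \<in> V" unfolding V_def by blast
  next
    show "infinite Q" unfolding infinite_nat_iff_unbounded
    proof
      fix B
      define j where "j = Suc (B + nat m)"
      have "(2::nat) ^ Suc j \<le> 3 ^ Suc j" by (rule power_mono) auto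
      then have "Suc j < 3 ^ Suc j" using less_exp[of "Suc j"] by linarith
      then have jB: "B + nat m < 3 ^ Suc j" by (simp add: j_def)
      obtain p q where pq: "prime p" "prime q" "p \<noteq> q" "odd p" "odd q"
        "has_rank p (3 ^ Suc j)" "has_rank q (3 ^ Suc j)"
        using two_primes_of_rank_power3[OF sq, of j] by (auto simp: j_def)
      have big: "B < p" "int p > m" "B < q" "int q > m"
        using rank_less[OF pq(1,4,6)] rank_less[OF pq(2,5,7)] jB by linarith+
      have j1: "j \<ge> 1" by (simp add: j_def)
      show "\<exists>p>B. p \<in> Q"
      proof (cases "p < q")
        case True
        then have "p \<in> Q" unfolding Q_def using pq big j1 by blast
        then show ?thesis using big by blast
      next
        case False
        then have "q < p" using pq by simp
        then have "q \<in> Q" unfolding Q_def using pq big j1 by blast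
        then show ?thesis using big by blast
      qed
    qed
  next
    fix p assume "p \<in> Q"
    then show "split_prime m p \<and> int p > m"
      unfolding Q_def has_rank_def using split_prime_if_dvd_sol_x by blast
  next
    fix f p assume f: "f \<in> V" and p: "p \<in> Q" and nz: "f p \<noteq> 0"
    show "\<exists>P>p. split_prime m P \<and> f P \<noteq> 0"
    proof (rule ccontr)
      assume "\<not> ?thesis"
      then have zero: "f P = 0" if "split_prime m P" "P > p" for P using that by blast
      obtain M b where fb: "\<And>p. f p = (\<Sum>n<M. b n * ord_diff m p 1 (sol_y n))" using f unfolding V_def by blast
      obtain j q where j: "j \<ge> 1" and q: "q > p" "prime p" "prime q" "odd p" "odd q"
        "has_rank p (3 ^ Suc j)" "has_rank q (3 ^ Suc j)" using p unfolding Q_def by blast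
      define r where "r = (3::nat) ^ Suc j"
      have r: "sparse r" "odd r" "r \<ge> 1" using sparse_power3[of "Suc j"] j by (auto simp: r_def)
      have vanish: "twisted_sum M b (r * P ^ i) = 0" if P: "prime P" "r < P" "p \<le> P" "i \<ge> 1" for P i
      proof (rule twisted_sum_eq_0[where K = p])
        show "sparse (r * P ^ i)" by (rule sparse_extend[OF r(1) P(1,2,4)])
        have "1 * P ^ 1 \<le> r * P ^ i" using r P prime_gt_0_nat[OF P(1)] by (intro mult_mono power_increasing) auto
        then show "p \<le> r * P ^ i" using P by simp
      qed (use zero fb in auto)
      have hr: "has_rank p r" "has_rank q r" using q by (simp_all add: r_def)
      have lt: "r < p" "r < q" using rank_less q hr by blast+
      have spq: "split_prime m q" using q split_prime_if_dvd_sol_x by (meson has_rank_def)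
      have "twisted_sum M b r * (chi4 r * ord_diff m q 1 (sol_y r)) = f q"
        unfolding fb using relation_at_rank[OF q(3,5) hr(2) r(2) vanish] q lt by simp
      also have "f q = 0" using zero spq q by blast
      finally have "twisted_sum M b r = 0" using ord_diff_sol_rank_nonzero[OF spq hr(2)] by simp
      moreover have "f p = twisted_sum M b r * (chi4 r * ord_diff m p 1 (sol_y r))"
        unfolding fb using relation_at_rank[OF q(2,4) hr(1) r(2) vanish] q lt by simp
      ultimately show False using nz by simp
    qed
  qed
qed

end

section \<open>Infinite rank\<close>

theorem proposition15:
  fixes m :: int
  assumes "m > 1" and "squarefree m"
  shows "group_rank (G_group m Mod P_subgroup m) = \<infinity>"
proof -
  have m: "m > 0" using assms(1) by simp
  let ?sol = "\<lambda>u v. u > 0 \<and> v > 0 \<and> u\<^sup>2 - m * v\<^sup>2 = 1"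
  show ?thesis
  proof (cases "\<exists>u v. ?sol u v")
    case False
    \<comment> \<open>With trivial solutions only, every nonsquare serves as c.\<close>
    show ?thesis
    proof (rule rank_infinite_if_nonsquare[OF m, where c = 2])
      show "2 \<noteq> k\<^sup>2" for k :: int by (rule two_not_square)
      fix u v :: int assume uv: "u > 0" "u\<^sup>2 - m * v\<^sup>2 = 1"
      have "v = 0"
      proof (rule ccontr)
        assume "v \<noteq> 0"
        then have "?sol u \<bar>v\<bar>" using uv by simp
        then show False using False by blast
      qed
      then have "u = 1" using uv by (simp add: power2_eq_1_iff)
      then show "(\<exists>w. u = 2 * w\<^sup>2 - 1) \<or> (\<exists>w. (u + 1) * 2 = w\<^sup>2)" by (intro disjI1 exI[of _ 1]) simp
    qed simp
  next
    case True
    then obtain u0 v0 where "?sol u0 v0" by blast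
    then have ex: "\<exists>n. \<exists>u. ?sol u (int n)" by (intro exI[of _ "nat v0"] exI[of _ u0]) simp
    define n1 where "n1 = (LEAST n. \<exists>u. ?sol u (int n))"
    define y1 where "y1 = int n1"
    obtain x1 where x1: "?sol x1 y1" using LeastI_ex[OF ex] unfolding y1_def n1_def by blast
    have least: "y1 \<le> v" if "u > 0" "v > 0" "u\<^sup>2 - m * v\<^sup>2 = 1" for u v
    proof -
      have "\<exists>u. ?sol u (int (nat v))" using that by (intro exI[of _ u]) simp
      then have "n1 \<le> nat v" unfolding n1_def by (rule Least_le)
      then show ?thesis using that by (simp add: y1_def)
    qed
    interpret pell m x1 y1 by unfold_locales (use m x1 in auto)
    show ?thesis
    proof (cases "\<exists>a. x1 + 1 = a\<^sup>2")
      case True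
      then obtain a where "x1 + 1 = a\<^sup>2" by blast
      then show ?thesis by (intro rank_infinite_if_square) (use least in auto)
    next
      case False
      show ?thesis
      proof (rule rank_infinite_if_nonsquare[OF m, where c = "x1 + 1"])
        show "x1 + 1 > 0" using x1_pos by simp
        show "x1 + 1 \<noteq> k\<^sup>2" for k using False by blast
        fix u v :: int assume uv: "u > 0" "u\<^sup>2 - m * v\<^sup>2 = 1"
        have "\<exists>n. u = sol_x n \<and> \<bar>v\<bar> = sol_y n" by (rule sol_complete) (use least uv in auto)
        then obtain n where n: "u = sol_x n" by blast
        show "(\<exists>w. u = 2 * w\<^sup>2 - 1) \<or> (\<exists>w. (u + 1) * (x1 + 1) = w\<^sup>2)"
        proof (cases "even n")
          case True
          then obtain k where "n = 2 * k" by (elim evenE)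
          then show ?thesis using sol_double(1)[of k] n by auto
        next
          case False
          then obtain k where "n = 2 * k + 1" by (elim oddE)
          then show ?thesis using sol_x_odd[of k] n by auto
        qed
      qed
    qed
  qed
qed

end
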